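(* Let $S$ be a countable strongly $0$-$E$-unitary inverse semigroup with idempotent set $E=E(S)$ and universal group $G=\mathscr U(S)$. Then $C^*_r(S)\cong C^*(E)\rtimes_r G$, the reduced partial crossed product for the partial action of $G$ on $C^*(E)\cong C_0(\widehat E)$ induced by the partial action of $G$ on $\widehat E$ described in the context.
   Context: An inverse semigroup is a semigroup $S$ in which each $s$ has a unique $s^*$ with $s=ss^*s$ and $s^*=s^*ss^*$. $E(S)$ is its commutative subsemigroup of idempotents; the natural partial order is $s\le t$ iff $s=te$ for some $e\in E(S)$. Let $S$ have a zero. A partial homomorphism from $S$ to a group $G$ is a map $\varphi\colon S\setminus\{0\}\to G$ with $\varphi(st)=\varphi(s)\varphi(t)$ whenever $st\ne 0$; it is idempotent pure if $\varphi^{-1}(1)=E(S)\setminus\{0\}$. $S$ is strongly $0$-$E$-unitary if it admits an idempotent pure partial homomorphism to a group. The universal group $\mathscr U(S)$ is the group generated by the set $S$ subject to the relations $s\cdot t=st$ whenever $st\neq 0$ in $S$, with its canonical partial homomorphism $\iota\colon S\setminus\{0\}\to\mathscr U(S)$, through which every partial homomorphism from $S$ to a group factors uniquely. Conventions for inverse semigroups with zero: the $C^*$-algebras are contracted. The (non-contracted) reduced algebra is generated by the operators $\Lambda_s$ on $\ell^2(S)$ with $\Lambda_s\delta_t=\delta_{st}$ if $s^*st=t$ and $0$ otherwise, and $C^*_r(S)$ is its quotient by the one-dimensional ideal $\mathbb C z$ spanned by the zero $z$ of $S$. $C^*(E)$ is the universal $C^*$-algebra for $*$-representations of $E$ sending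 the zero to $0$. $\widehat E$ is the space of non-zero homomorphisms $\varphi\colon E\to\{0,1\}$ with $\varphi(0)=0$, a subspace of $\{0,1\}^E$; $C^*(E)\cong C_0(\widehat E)$; $D(e)=\{\varphi\in\widehat E\mid\varphi(e)=1\}$. $S$ acts on $\widehat E$: for $\varphi\in D(s^*s)$, $s\varphi\in D(ss^* )$ is $(s\varphi)(e)=\varphi(s^*es)$. A partial action of a discrete group $G$ on a locally compact Hausdorff space $X$ is a map $\theta$ from $G$ to the homeomorphisms between open subsets of $X$ with $\theta(1)=1_X$, $\theta(g^{-1})=\theta(g)^{-1}$, and $\theta(g)\theta(h)$ a restriction of $\theta(gh)$; the domain of $\theta(g)$ is written $X_{g^{-1}}$ and $\theta(g)(x)$ is written $gx$. The partial action of $G=\mathscr U(S)$ on $X=\widehat E$ is: $X_{g^{-1}}=\bigcup_{s\in\iota^{-1}(g)}D(s^*s)$, and $g\varphi=s\varphi$ whenever $s\in S\setminus\{0\}$, $\iota(s)=g$ and $\varphi\in D(s^*s)$. Reduced partial crossed product $C_0(X)\rtimes_r G$: let $A=C_0(X)$, $A_g=C_0(X_g)$, $\alpha_g\colon A_{g^{-1}}\to A_g$, $\alpha_g(f)(x)=f(g^{-1}x)$. On finite sums $\sum_g a_g\delta_g$ with $a_g\in A_g$ put $(a\delta_g)(b\delta_h)=\alpha_g(\alpha_{g^{-1}}(a)b)\delta_{gh}$ and $(a\delta_g)^*=\alpha_{g^{-1}}(a^* )\delta_{g^{-1}}$. Take a faithful representation $\pi\colon A\to B(H)$; for $h\in G$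 let $\pi_h\colon A\to B(H)$ be the extension of $\pi\circ\alpha_{h^{-1}}\colon A_h\to B(H)$ to $A$ given by $\pi_h(a)=\text{strong-}\lim_\lambda \pi(\alpha_{h^{-1}}(a e_\lambda))$ with $(e_\lambda)$ an approximate unit of $A_h$. Then $A\rtimes_r G$ is the norm closure of the image of the representation on $\ell^2(G,H)$ given by $(a\delta_g\cdot\xi)(h)=\pi_h(a)\xi(g^{-1}h)$; it is independent of the choice of faithful $\pi$. *)

theory Defs
  imports "HOL-Analysis.Analysis"
begin

section \<open>Complex Hilbert spaces\<close>

text \<open>Positive definiteness of the inner product is contained in the norm axiom, because
  \<^term>\<open>sqrt\<close> is negative on negative reals and the norm is positive on nonzero vectors.
  Completeness comes from \<^class>\<open>banach\<close>.\<close>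

class complex_hilbert_space = banach +
  fixes scaleC :: "complex \<Rightarrow> 'a \<Rightarrow> 'a"  (infixr \<open>*\<^sub>C\<close> 75)
    and cinner :: "'a \<Rightarrow> 'a \<Rightarrow> complex"
  assumes scaleC_add_right: "c *\<^sub>C (x + y) = c *\<^sub>C x + c *\<^sub>C y"
    and scaleC_add_left: "(c + d) *\<^sub>C x = c *\<^sub>C x + d *\<^sub>C x"
    and scaleC_scaleC: "c *\<^sub>C d *\<^sub>C x = (c * d) *\<^sub>C x"
    and scaleC_of_real: "complex_of_real r *\<^sub>C x = r *\<^sub>R x"
    and cinner_commute: "cinner x y = cnj (cinner y x)"
    and cinner_add_right: "cinner x (y + z) = cinner x y + cinner x z"
    and cinner_scaleC_right: "cinner x (c *\<^sub>C y) = c * cinner x y"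
    and norm_eq_sqrt_cinner: "norm x = sqrt (Re (cinner x x))"
begin

lemma cinner_add_left: "cinner (x + y) z = cinner x z + cinner y z"
  by (metis cinner_add_right cinner_commute complex_cnj_add)

lemma cinner_scaleC_left: "cinner (c *\<^sub>C x) y = cnj c * cinner x y"
  by (metis cinner_commute cinner_scaleC_right complex_cnj_mult)

lemma cinner_self: "cinner x x = complex_of_real ((norm x)\<^sup>2)"
proof -
  have "Re (cinner x x) \<ge> 0"
    by (metis norm_eq_sqrt_cinner norm_ge_zero real_sqrt_ge_0_iff)
  moreover have "Im (cinner x x) = 0"
    by (metis cinner_commute cnj.simps(2) equal_neg_zero)
  ultimately show ?thesis
    by (simp add: complex_eq_iff norm_eq_sqrt_cinner)
qed

lemma norm_scaleC: "norm (c *\<^sub>C x) = cmod c * norm x"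
proof -
  have "complex_of_real ((norm (c *\<^sub>C x))\<^sup>2) = c * cnj c * cinner x x"
    by (simp only: cinner_self[symmetric] cinner_scaleC_left cinner_scaleC_right mult_ac)
  also have "\<dots> = complex_of_real ((cmod c * norm x)\<^sup>2)"
    by (simp add: cinner_self complex_norm_square[symmetric] power_mult_distrib)
  finally have "complex_of_real ((norm (c *\<^sub>C x))\<^sup>2) = complex_of_real ((cmod c * norm x)\<^sup>2)" .
  then show ?thesis
    by (simp only: of_real_eq_iff) (rule power2_eq_imp_eq, simp_all)
qed

lemma norm_cinner_le: "2 * cmod (cinner x y) \<le> (norm x)\<^sup>2 + (norm y)\<^sup>2"
proof -
  obtain c where c: "cmod c = 1" "c * cinner x y = complex_of_real (- cmod (cinner x y))"
  proof (cases "cinner x y = 0")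
    case True
    then show ?thesis by (intro that[of 1]) auto
  next
    case False
    show ?thesis
    proof (rule that[of "- (cnj (cinner x y) / complex_of_real (cmod (cinner x y)))"])
      show "cmod (- (cnj (cinner x y) / complex_of_real (cmod (cinner x y)))) = 1"
        using False by (simp add: norm_divide)
      have "cinner x y * cnj (cinner x y) = complex_of_real ((cmod (cinner x y))\<^sup>2)"
        by (metis complex_norm_square of_real_power)
      then show "- (cnj (cinner x y) / complex_of_real (cmod (cinner x y))) * cinner x y
          = complex_of_real (- cmod (cinner x y))"
        using False by (simp add: field_simps power2_eq_square)
    qed
  qed
  have "cinner y x * cnj c = complex_of_real (- cmod (cinner x y))"
    by (metis c(2) cinner_commute complex_cnj_complex_of_real complex_cnj_mult mult.commute)
  then have "cinner (x + c *\<^sub>C y) (x + c *\<^sub>C y)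
      = complex_of_real ((norm x)\<^sup>2 + (norm (c *\<^sub>C y))\<^sup>2 - 2 * cmod (cinner x y))"
    unfolding cinner_add_left cinner_add_right cinner_self[symmetric] of_real_diff of_real_add
      of_real_mult
    using c(2) by (simp add: cinner_scaleC_left[of c y x] cinner_scaleC_right[of x c y] mult.commute
        cinner_self[symmetric])
  then have "(norm (x + c *\<^sub>C y))\<^sup>2 = (norm x)\<^sup>2 + (norm (c *\<^sub>C y))\<^sup>2 - 2 * cmod (cinner x y)"
    using cinner_self of_real_eq_iff by metis
  then show ?thesis
    using c(1) norm_scaleC[of c y] zero_le_power2[of "norm (x + c *\<^sub>C y)"] by simp
qed

end

instantiation complex :: complex_hilbert_space
begin
definition scaleC_complex :: "complex \<Rightarrow> complex \<Rightarrow> complex" where "scaleC_complex = (*)"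
definition cinner_complex :: "complex \<Rightarrow> complex \<Rightarrow> complex" where "cinner_complex x y = cnj x * y"
instance
  by standard (auto simp: scaleC_complex_def cinner_complex_def algebra_simps scaleR_conv_of_real
      cmod_def power2_eq_square)
end


section \<open>The Hilbert space of square-summable families\<close>

typedef (overloaded) ('i, 'h) l2 =
  "{f :: 'i \<Rightarrow> 'h::complex_hilbert_space. (\<lambda>i. (norm (f i))\<^sup>2) summable_on UNIV}"
  morphisms l2_nth Abs_l2
  by (rule exI[of _ "\<lambda>_. 0"]) simp

setup_lifting type_definition_l2

lemma l2_summableI:
  fixes f :: "'i \<Rightarrow> 'h::real_normed_vector"
  assumes "\<And>F. finite F \<Longrightarrow> L2_set (\<lambda>i. norm (f i)) F \<le> B"
  shows "(\<lambda>i. (norm (f i))\<^sup>2) summable_on UNIV" "sqrt (\<Sum>\<^sub>\<infinity>i. (norm (f i))\<^sup>2) \<le> B"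
proof -
  have B: "0 \<le> B" using assms[of "{}"] by simp
  have *: "(\<Sum>i\<in>F. (norm (f i))\<^sup>2) \<le> B\<^sup>2" if "finite F" for F
    using assms[OF that] B by (simp add: L2_set_def sqrt_le_D)
  show 1: "(\<lambda>i. (norm (f i))\<^sup>2) summable_on UNIV"
    by (rule nonneg_bdd_above_summable_on) (auto intro!: bdd_aboveI2[where M="B\<^sup>2"] *)
  have "(\<Sum>\<^sub>\<infinity>i. (norm (f i))\<^sup>2) \<le> B\<^sup>2"
    by (rule infsum_le_finite_sums[OF 1]) (use * in auto)
  then show "sqrt (\<Sum>\<^sub>\<infinity>i. (norm (f i))\<^sup>2) \<le> B"
    using B real_le_lsqrt by (simp add: infsum_nonneg)
qed

lemma L2_set_le_infsum:
  fixes f :: "'i \<Rightarrow> 'h::real_normed_vector"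
  assumes "(\<lambda>i. (norm (f i))\<^sup>2) summable_on UNIV" "finite F"
  shows "L2_set (\<lambda>i. norm (f i)) F \<le> sqrt (\<Sum>\<^sub>\<infinity>i. (norm (f i))\<^sup>2)"
  unfolding L2_set_def using finite_sum_le_infsum[OF assms(1,2)] by simp

lemma L2_set_norm_add_le:
  fixes f g :: "'i \<Rightarrow> 'h::real_normed_vector"
  shows "L2_set (\<lambda>i. norm (f i + g i)) F
    \<le> L2_set (\<lambda>i. norm (f i)) F + L2_set (\<lambda>i. norm (g i)) F"
  by (rule order_trans[OF L2_set_mono L2_set_triangle_ineq]) (auto intro: norm_triangle_ineq)

lemma l2_add:
  fixes f g :: "'i \<Rightarrow> 'h::real_normed_vector"
  assumes "(\<lambda>i. (norm (f i))\<^sup>2) summable_on UNIV" "(\<lambda>i. (norm (g i))\<^sup>2) summable_on UNIV"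
  shows "(\<lambda>i. (norm (f i + g i))\<^sup>2) summable_on UNIV"
    "sqrt (\<Sum>\<^sub>\<infinity>i. (norm (f i + g i))\<^sup>2)
      \<le> sqrt (\<Sum>\<^sub>\<infinity>i. (norm (f i))\<^sup>2) + sqrt (\<Sum>\<^sub>\<infinity>i. (norm (g i))\<^sup>2)"
proof -
  have "L2_set (\<lambda>i. norm (f i + g i)) F
      \<le> sqrt (\<Sum>\<^sub>\<infinity>i. (norm (f i))\<^sup>2) + sqrt (\<Sum>\<^sub>\<infinity>i. (norm (g i))\<^sup>2)" if "finite F" for F
    using L2_set_norm_add_le[of f g F] L2_set_le_infsum[OF assms(1) that]
      L2_set_le_infsum[OF assms(2) that] by linarith
  note * = l2_summableI[OF this]
  show "(\<lambda>i. (norm (f i + g i))\<^sup>2) summable_on UNIV"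
    "sqrt (\<Sum>\<^sub>\<infinity>i. (norm (f i + g i))\<^sup>2)
      \<le> sqrt (\<Sum>\<^sub>\<infinity>i. (norm (f i))\<^sup>2) + sqrt (\<Sum>\<^sub>\<infinity>i. (norm (g i))\<^sup>2)"
    by (rule *, assumption)+
qed

lemma cinner_abs_summable:
  fixes f g :: "'i \<Rightarrow> 'h::complex_hilbert_space"
  assumes "(\<lambda>i. (norm (f i))\<^sup>2) summable_on UNIV" "(\<lambda>i. (norm (g i))\<^sup>2) summable_on UNIV"
  shows "(\<lambda>i. cinner (f i) (g i)) summable_on UNIV"
proof (rule abs_summable_summable, rule Infinite_Sum.abs_summable_on_comparison_test')
  show "(\<lambda>i. (norm (f i))\<^sup>2 + (norm (g i))\<^sup>2) summable_on UNIV"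
    using assms by (rule summable_on_add)
  show "norm (cinner (f i) (g i)) \<le> (norm (f i))\<^sup>2 + (norm (g i))\<^sup>2" for i
    using norm_cinner_le[of "f i" "g i"] norm_ge_zero[of "cinner (f i) (g i)"] by linarith
qed

lemma l2_scaleC_summable:
  fixes f :: "'i \<Rightarrow> 'h::complex_hilbert_space"
  assumes "(\<lambda>i. (norm (f i))\<^sup>2) summable_on UNIV"
  shows "(\<lambda>i. (norm (c *\<^sub>C f i))\<^sup>2) summable_on UNIV"
  using assms by (simp add: norm_scaleC power_mult_distrib summable_on_cmult_right)

instantiation l2 :: (type, complex_hilbert_space) real_vector
begin
lift_definition zero_l2 :: "('a, 'b) l2" is "\<lambda>_. 0" by simp
lift_definition plus_l2 :: "('a, 'b) l2 \<Rightarrow> ('a, 'b) l2 \<Rightarrow> ('a, 'b) l2" is "\<lambda>f g i. f i + g i"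
  by (rule l2_add)
lift_definition uminus_l2 :: "('a, 'b) l2 \<Rightarrow> ('a, 'b) l2" is "\<lambda>f i. - f i" by simp
lift_definition minus_l2 :: "('a, 'b) l2 \<Rightarrow> ('a, 'b) l2 \<Rightarrow> ('a, 'b) l2" is "\<lambda>f g i. f i - g i"
  using l2_add(1)[of _ "\<lambda>i. - _ i"] by fastforce
lift_definition scaleR_l2 :: "real \<Rightarrow> ('a, 'b) l2 \<Rightarrow> ('a, 'b) l2" is "\<lambda>r f i. r *\<^sub>R f i"
  by (simp add: power_mult_distrib summable_on_cmult_right)
instance
  by standard (transfer, simp add: algebra_simps fun_eq_iff)+
end

instantiation l2 :: (type, complex_hilbert_space) real_normed_vector
begin
lift_definition norm_l2 :: "('a, 'b) l2 \<Rightarrow> real" is "\<lambda>f. sqrt (\<Sum>\<^sub>\<infinity>i. (norm (f i))\<^sup>2)" .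
definition dist_l2 :: "('a, 'b) l2 \<Rightarrow> ('a, 'b) l2 \<Rightarrow> real" where "dist_l2 x y = norm (x - y)"
definition sgn_l2 :: "('a, 'b) l2 \<Rightarrow> ('a, 'b) l2" where "sgn_l2 x = x /\<^sub>R norm x"
definition uniformity_l2 :: "(('a, 'b) l2 \<times> ('a, 'b) l2) filter"
  where "uniformity_l2 = (INF e\<in>{0 <..}. principal {(x, y). dist x y < e})"
definition open_l2 :: "('a, 'b) l2 set \<Rightarrow> bool"
  where "open_l2 S = (\<forall>x\<in>S. \<forall>\<^sub>F (x', y) in uniformity. x' = x \<longrightarrow> y \<in> S)"
instance
proof
  fix x y :: "('a, 'b) l2" and r :: real
  show "(norm x = 0) = (x = 0)"
  proof transfer
    fix f :: "'a \<Rightarrow> 'b" assume f: "(\<lambda>i. (norm (f i))\<^sup>2) summable_on UNIV"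
    show "(sqrt (\<Sum>\<^sub>\<infinity>i. (norm (f i))\<^sup>2) = 0) = (f = (\<lambda>_. 0))"
    proof
      assume 0: "sqrt (\<Sum>\<^sub>\<infinity>i. (norm (f i))\<^sup>2) = 0"
      show "f = (\<lambda>_. 0)"
      proof
        fix i show "f i = 0"
          using L2_set_le_infsum[OF f, of "{i}"] 0 by simp
      qed
    qed simp
  qed
  show "norm (x + y) \<le> norm x + norm y"
    by transfer (rule l2_add)
  show "norm (r *\<^sub>R x) = \<bar>r\<bar> * norm x"
    by transfer (simp add: power_mult_distrib infsum_cmult_right' real_sqrt_mult)
qed (simp_all add: dist_l2_def sgn_l2_def uniformity_l2_def open_l2_def)
end

lemma norm_l2_nth_le: "norm (l2_nth x i) \<le> norm x"
  using L2_set_le_infsum[of "l2_nth x" "{i}"] by (simp add: norm_l2.rep_eq l2_nth[simplified])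

instance l2 :: (type, complex_hilbert_space) banach
proof
  fix X :: "nat \<Rightarrow> ('a, 'b) l2" assume X: "Cauchy X"
  have "Cauchy (\<lambda>n. l2_nth (X n) i)" for i
  proof (rule metric_CauchyI)
    fix e :: real assume "0 < e"
    from metric_CauchyD[OF X this] obtain M where M: "\<forall>m\<ge>M. \<forall>n\<ge>M. dist (X m) (X n) < e" by blast
    show "\<exists>M. \<forall>m\<ge>M. \<forall>n\<ge>M. dist (l2_nth (X m) i) (l2_nth (X n) i) < e"
    proof (intro exI allI impI)
      fix m n assume "m \<ge> M" "n \<ge> M"
      then have "norm (X m - X n) < e" using M by (simp add: dist_norm)
      then show "dist (l2_nth (X m) i) (l2_nth (X n) i) < e"
        using norm_l2_nth_le[of "X m - X n" i] by (simp add: dist_norm minus_l2.rep_eq)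
    qed
  qed
  then have "\<exists>l. (\<lambda>n. l2_nth (X n) i) \<longlonglongrightarrow> l" for i
    using Cauchy_convergent_iff convergent_def by blast
  then obtain f where f: "\<And>i. (\<lambda>n. l2_nth (X n) i) \<longlonglongrightarrow> f i" by metis
  have main: "\<exists>M. \<forall>n\<ge>M. \<forall>F. finite F \<longrightarrow> L2_set (\<lambda>i. norm (f i - l2_nth (X n) i)) F \<le> e"
    if "0 < e" for e :: real
  proof -
    from metric_CauchyD[OF X that] obtain M where M: "\<forall>m\<ge>M. \<forall>n\<ge>M. dist (X m) (X n) < e" by blast
    show ?thesis
    proof (intro exI allI impI)
      fix n F assume n: "M \<le> n" and F: "finite (F :: 'a set)"
      have "(\<lambda>m. L2_set (\<lambda>i. norm (l2_nth (X m) i - l2_nth (X n) i)) F)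
          \<longlonglongrightarrow> L2_set (\<lambda>i. norm (f i - l2_nth (X n) i)) F"
        unfolding L2_set_def by (intro tendsto_intros f)
      then show "L2_set (\<lambda>i. norm (f i - l2_nth (X n) i)) F \<le> e"
      proof (rule LIMSEQ_le_const2)
        have "L2_set (\<lambda>i. norm (l2_nth (X m) i - l2_nth (X n) i)) F \<le> e" if "m \<ge> M" for m
        proof -
          have "norm (X m - X n) < e" using M n that by (simp add: dist_norm)
          then show ?thesis
            using L2_set_le_infsum[of "l2_nth (X m - X n)" F, OF _ F] l2_nth[of "X m - X n"]
            by (simp add: norm_l2.rep_eq minus_l2.rep_eq)
        qed
        then show "\<exists>N. \<forall>m\<ge>N. L2_set (\<lambda>i. norm (l2_nth (X m) i - l2_nth (X n) i)) F \<le> e" by blast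
      qed
    qed
  qed
  from main[of 1] obtain M where
    "\<And>F. finite F \<Longrightarrow> L2_set (\<lambda>i. norm (f i - l2_nth (X M) i)) F \<le> 1" by auto
  then have "(\<lambda>i. (norm (f i - l2_nth (X M) i))\<^sup>2) summable_on UNIV" by (rule l2_summableI)
  from l2_add(1)[OF this, of "l2_nth (X M)"] l2_nth[of "X M"]
  have fl2: "(\<lambda>i. (norm (f i))\<^sup>2) summable_on UNIV" by simp
  have nth: "l2_nth (Abs_l2 f) = f" by (rule Abs_l2_inverse) (use fl2 in simp)
  have "X \<longlonglongrightarrow> Abs_l2 f"
  proof (rule metric_LIMSEQ_I)
    fix e :: real assume e: "0 < e"
    then obtain M where M: "\<And>n F. n \<ge> M \<Longrightarrow> finite F \<Longrightarrow> L2_set (\<lambda>i. norm (f i - l2_nth (X n) i)) F \<le> e/2"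
      using main[of "e/2"] by auto
    show "\<exists>M. \<forall>n\<ge>M. dist (X n) (Abs_l2 f) < e"
    proof (intro exI allI impI)
      fix n assume "M \<le> n"
      then have "norm (Abs_l2 f - X n) \<le> e/2"
        using l2_summableI(2)[of "\<lambda>i. f i - l2_nth (X n) i", OF M]
        by (simp add: norm_l2.rep_eq minus_l2.rep_eq nth)
      then show "dist (X n) (Abs_l2 f) < e" using e by (simp add: dist_norm norm_minus_commute)
    qed
  qed
  then show "convergent X" by (auto simp: convergent_def)
qed

instantiation l2 :: (type, complex_hilbert_space) complex_hilbert_space
begin
lift_definition scaleC_l2 :: "complex \<Rightarrow> ('a, 'b) l2 \<Rightarrow> ('a, 'b) l2" is "\<lambda>c f i. c *\<^sub>C f i"
  by (rule l2_scaleC_summable)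
lift_definition cinner_l2 :: "('a, 'b) l2 \<Rightarrow> ('a, 'b) l2 \<Rightarrow> complex"
  is "\<lambda>f g. \<Sum>\<^sub>\<infinity>i. cinner (f i) (g i)" .
instance
proof
  fix c d :: complex and r :: real and x y z :: "('a, 'b) l2"
  show "c *\<^sub>C (x + y) = c *\<^sub>C x + c *\<^sub>C y" by transfer (simp add: scaleC_add_right)
  show "(c + d) *\<^sub>C x = c *\<^sub>C x + d *\<^sub>C x" by transfer (simp add: scaleC_add_left)
  show "c *\<^sub>C d *\<^sub>C x = (c * d) *\<^sub>C x" by transfer (simp add: scaleC_scaleC)
  show "complex_of_real r *\<^sub>C x = r *\<^sub>R x" by transfer (simp add: scaleC_of_real)
  show "cinner x y = cnj (cinner y x)"
    by transfer (simp add: infsum_cnj[symmetric] cinner_commute[symmetric])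
  show "cinner x (y + z) = cinner x y + cinner x z"
    by transfer (simp add: cinner_add_right infsum_add cinner_abs_summable)
  show "cinner x (c *\<^sub>C y) = c * cinner x y"
    by transfer (simp add: cinner_scaleC_right infsum_cmult_right')
  show "norm x = sqrt (Re (cinner x x))"
  proof transfer
    fix f :: "'a \<Rightarrow> 'b" assume "(\<lambda>i. (norm (f i))\<^sup>2) summable_on UNIV"
    then have "((\<lambda>i. complex_of_real ((norm (f i))\<^sup>2)) has_sum complex_of_real (\<Sum>\<^sub>\<infinity>i. (norm (f i))\<^sup>2)) UNIV"
      using has_sum_bounded_linear[OF bounded_linear_of_real] has_sum_infsum by blast
    from infsumI[OF this]
    show "sqrt (\<Sum>\<^sub>\<infinity>i. (norm (f i))\<^sup>2) = sqrt (Re (\<Sum>\<^sub>\<infinity>i. cinner (f i) (f i)))"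
      by (simp add: cinner_self)
  qed
qed
end

lift_definition delta :: "'i \<Rightarrow> ('i, complex) l2" is "\<lambda>i j. if j = i then 1 else 0"
proof -
  fix i :: 'i
  show "(\<lambda>j. (norm (if j = i then 1 else 0 :: complex))\<^sup>2) summable_on UNIV"
    by (rule finite_nonzero_values_imp_summable_on) (auto intro: finite_subset[of _ "{i}"])
qed


section \<open>C*-algebras, homomorphisms and quotients\<close>

text \<open>The data of a (not necessarily unital) normed *-algebra over the complex numbers.\<close>

record 'a star_alg =
  alg_carrier :: "'a set"
  alg_add :: "'a \<Rightarrow> 'a \<Rightarrow> 'a"
  alg_scale :: "complex \<Rightarrow> 'a \<Rightarrow> 'a"
  alg_mult :: "'a \<Rightarrow> 'a \<Rightarrow> 'a"
  alg_star :: "'a \<Rightarrow> 'a"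
  alg_norm :: "'a \<Rightarrow> real"

definition star_hom :: "'a star_alg \<Rightarrow> 'b star_alg \<Rightarrow> ('a \<Rightarrow> 'b) \<Rightarrow> bool" where
  "star_hom A B f \<longleftrightarrow>
     (\<forall>x\<in>alg_carrier A. f x \<in> alg_carrier B) \<and>
     (\<forall>x\<in>alg_carrier A. \<forall>y\<in>alg_carrier A. f (alg_add A x y) = alg_add B (f x) (f y)) \<and>
     (\<forall>c. \<forall>x\<in>alg_carrier A. f (alg_scale A c x) = alg_scale B c (f x)) \<and>
     (\<forall>x\<in>alg_carrier A. \<forall>y\<in>alg_carrier A. f (alg_mult A x y) = alg_mult B (f x) (f y)) \<and>
     (\<forall>x\<in>alg_carrier A. f (alg_star A x) = alg_star B (f x))"

text \<open>A bijective *-homomorphism between C*-algebras is automatically isometric; here the norms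
  are part of the structure, so this is required explicitly.\<close>

definition cstar_isomorphic :: "'a star_alg \<Rightarrow> 'b star_alg \<Rightarrow> bool"  (infix \<open>\<cong>\<^sub>C\<close> 50) where
  "A \<cong>\<^sub>C B \<longleftrightarrow> (\<exists>f. star_hom A B f \<and> bij_betw f (alg_carrier A) (alg_carrier B) \<and>
     (\<forall>x\<in>alg_carrier A. alg_norm B (f x) = alg_norm A x))"

definition alg_coset :: "'a star_alg \<Rightarrow> 'a set \<Rightarrow> 'a \<Rightarrow> 'a set" where
  "alg_coset A I x = alg_add A x ` I"

definition quotient_alg :: "'a star_alg \<Rightarrow> 'a set \<Rightarrow> 'a set star_alg" where
  "quotient_alg A I = \<lparr>
     alg_carrier = alg_coset A I ` alg_carrier A,
     alg_add = (\<lambda>X Y. \<Union>x\<in>X. \<Union>y\<in>Y. alg_coset A I (alg_add A x y)),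
     alg_scale = (\<lambda>c X. \<Union>x\<in>X. alg_coset A I (alg_scale A c x)),
     alg_mult = (\<lambda>X Y. \<Union>x\<in>X. \<Union>y\<in>Y. alg_coset A I (alg_mult A x y)),
     alg_star = (\<lambda>X. \<Union>x\<in>X. alg_coset A I (alg_star A x)),
     alg_norm = (\<lambda>X. INF x\<in>X. alg_norm A x) \<rparr>"


section \<open>Operators on a complex Hilbert space\<close>

text \<open>\<^typ>\<open>'h \<Rightarrow>\<^sub>L 'h\<close> consists of the bounded real-linear operators.\<close>

definition bounded_ops :: "('h::complex_hilbert_space \<Rightarrow>\<^sub>L 'h) set" where
  "bounded_ops = {T. \<forall>c x. blinfun_apply T (c *\<^sub>C x) = c *\<^sub>C blinfun_apply T x}"

definition scale_op :: "complex \<Rightarrow> ('h::complex_hilbert_space \<Rightarrow>\<^sub>L 'h) \<Rightarrow> ('h \<Rightarrow>\<^sub>L 'h)" where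
  "scale_op c T = Blinfun (\<lambda>x. c *\<^sub>C blinfun_apply T x)"

definition adj_op :: "('h::complex_hilbert_space \<Rightarrow>\<^sub>L 'h) \<Rightarrow> ('h \<Rightarrow>\<^sub>L 'h)" where
  "adj_op T = (THE T'. \<forall>x y. cinner (blinfun_apply T x) y = cinner x (blinfun_apply T' y))"

definition op_alg :: "('h::complex_hilbert_space \<Rightarrow>\<^sub>L 'h) set \<Rightarrow> ('h \<Rightarrow>\<^sub>L 'h) star_alg" where
  "op_alg A = \<lparr> alg_carrier = A, alg_add = (+), alg_scale = scale_op, alg_mult = (o\<^sub>L),
     alg_star = adj_op, alg_norm = norm \<rparr>"

definition is_cstar_subalgebra :: "('h::complex_hilbert_space \<Rightarrow>\<^sub>L 'h) set \<Rightarrow> bool" where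
  "is_cstar_subalgebra A \<longleftrightarrow> A \<subseteq> bounded_ops \<and> 0 \<in> A \<and>
     (\<forall>S\<in>A. \<forall>T\<in>A. S + T \<in> A \<and> S o\<^sub>L T \<in> A) \<and>
     (\<forall>T\<in>A. adj_op T \<in> A \<and> (\<forall>c. scale_op c T \<in> A)) \<and> closed A"


section \<open>Inverse semigroups with zero\<close>

class inverse_semigroup_0 = semigroup_mult + mult_zero +
  assumes ex1_inverse: "\<exists>!t. s = s * t * s \<and> t = t * s * t"
begin

definition star :: "'a \<Rightarrow> 'a"  (\<open>_\<^sup>\<star>\<close> [1000] 999) where
  "s\<^sup>\<star> = (THE t. s = s * t * s \<and> t = t * s * t)"

definition idempotents :: "'a set" where
  "idempotents = {e. e * e = e}"

end

text \<open>Groups are written additively, since \<^class>\<open>group_add\<close> is the type class of (not necessarily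
  commutative) groups. Values at zero of a partial homomorphism are irrelevant.\<close>

definition partial_hom :: "('s::inverse_semigroup_0 \<Rightarrow> 'g::group_add) \<Rightarrow> bool" where
  "partial_hom \<phi> \<longleftrightarrow> (\<forall>s t. s * t \<noteq> 0 \<longrightarrow> \<phi> (s * t) = \<phi> s + \<phi> t)"

definition idempotent_pure :: "('s::inverse_semigroup_0 \<Rightarrow> 'g::group_add) \<Rightarrow> bool" where
  "idempotent_pure \<phi> \<longleftrightarrow> {s. s \<noteq> 0 \<and> \<phi> s = 0} = idempotents - {0}"

text \<open>The type argument \<^typ>\<open>'g\<close> is the group; leaving it a free type variable in the hypothesis of
  a theorem expresses that some group, of whatever type, exists.\<close>

definition strongly_0_E_unitary :: "'s::inverse_semigroup_0 itself \<Rightarrow> 'g::group_add itself \<Rightarrow> bool" where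
  "strongly_0_E_unitary _ _ \<longleftrightarrow> (\<exists>\<phi> :: 's \<Rightarrow> 'g. partial_hom \<phi> \<and> idempotent_pure \<phi>)"


subsection \<open>The universal group\<close>

text \<open>Words over the nonzero elements and their formal inverses: the letter \<^term>\<open>(s, True)\<close> stands
  for \<open>s\<close> and \<^term>\<open>(s, False)\<close> for its inverse. Zero is not a generator: no relation involves it,
  and factorisations through the universal group would otherwise not be unique.\<close>

inductive univ_rel :: "('s::inverse_semigroup_0 \<times> bool) list \<Rightarrow> ('s \<times> bool) list \<Rightarrow> bool" where
  empty: "univ_rel [] []"
| letter: "s \<noteq> 0 \<Longrightarrow> univ_rel [(s, b)] [(s, b)]"
| sym: "univ_rel u v \<Longrightarrow> univ_rel v u"
| trans: "univ_rel u v \<Longrightarrow> univ_rel v w \<Longrightarrow> univ_rel u w"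
| append: "univ_rel u u' \<Longrightarrow> univ_rel v v' \<Longrightarrow> univ_rel (u @ v) (u' @ v')"
| cancel: "s \<noteq> 0 \<Longrightarrow> univ_rel [(s, b), (s, \<not> b)] []"
| relation: "s * t \<noteq> 0 \<Longrightarrow> univ_rel [(s, True), (t, True)] [(s * t, True)]"

lemma univ_rel_nonzero:
  assumes "univ_rel u v"
  shows "\<forall>x\<in>set u \<union> set v. fst x \<noteq> 0"
  using assms by induction auto

lemma univ_rel_refl: "\<forall>x\<in>set w. fst x \<noteq> 0 \<Longrightarrow> univ_rel w w"
proof (induction w)
  case Nil
  show ?case by (rule univ_rel.empty)
next
  case (Cons x w)
  then show ?case
    using univ_rel.append[of "[x]" "[x]" w w] univ_rel.letter[of "fst x" "snd x"] by simp
qed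

definition inv_word :: "('s \<times> bool) list \<Rightarrow> ('s \<times> bool) list" where
  "inv_word w = rev (map (\<lambda>(s, b). (s, \<not> b)) w)"

lemma inv_word_simps [simp]:
  "inv_word [] = []" "inv_word (u @ v) = inv_word v @ inv_word u" "inv_word [(s, b)] = [(s, \<not> b)]"
  "inv_word ((s, b) # w) = inv_word w @ [(s, \<not> b)]"
  by (simp_all add: inv_word_def)

lemma inv_word_nonzero: "\<forall>x\<in>set w. fst x \<noteq> 0 \<Longrightarrow> \<forall>x\<in>set (inv_word w). fst x \<noteq> 0"
  by (auto simp: inv_word_def)

lemma univ_rel_left_inverse: "\<forall>x\<in>set w. fst x \<noteq> 0 \<Longrightarrow> univ_rel (inv_word w @ w) []"
proof (induction w)
  case Nil
  show ?case by (simp add: univ_rel.empty)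
next
  case (Cons x w)
  obtain s b where x: "x = (s, b)" by (cases x)
  from Cons.prems have s: "s \<noteq> 0" and w: "\<forall>x\<in>set w. fst x \<noteq> 0" by (auto simp: x)
  have "univ_rel [(s, \<not> b), (s, \<not> \<not> b)] []" using s by (rule univ_rel.cancel)
  then have "univ_rel ([(s, \<not> b), (s, b)] @ w) ([] @ w)"
    using univ_rel.append univ_rel_refl[OF w] by (metis (full_types))
  then have "univ_rel (inv_word w @ [(s, \<not> b), (s, b)] @ w) (inv_word w @ w)"
    using univ_rel.append[OF univ_rel_refl[OF inv_word_nonzero[OF w]]] by force
  from univ_rel.trans[OF this Cons.IH[OF w]] show ?case by (simp add: x)
qed

lemma inv_word_inv_word: "inv_word (inv_word w) = w"
  by (induction w) (auto simp: inv_word_def rev_map comp_def)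

lemma univ_rel_inv_word:
  assumes "univ_rel u v" shows "univ_rel (inv_word u) (inv_word v)"
proof -
  have u: "\<forall>x\<in>set u. fst x \<noteq> 0" and v: "\<forall>x\<in>set v. fst x \<noteq> 0"
    using univ_rel_nonzero[OF assms] by auto
  note iu = inv_word_nonzero[OF u] and iv = inv_word_nonzero[OF v]
  have "univ_rel (inv_word u @ v @ inv_word v) (inv_word u @ [])"
    using univ_rel.append[OF univ_rel_refl[OF iu] univ_rel_left_inverse[OF iv]]
    by (simp add: inv_word_inv_word)
  moreover have "univ_rel ((inv_word u @ v) @ inv_word v) ((inv_word u @ u) @ inv_word v)"
    by (intro univ_rel.append univ_rel_refl iu iv univ_rel.sym[OF assms])
  moreover have "univ_rel ((inv_word u @ u) @ inv_word v) ([] @ inv_word v)"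
    by (intro univ_rel.append univ_rel_refl iv univ_rel_left_inverse u)
  ultimately show ?thesis
    by (metis append.assoc append_Nil append_Nil2 univ_rel.sym univ_rel.trans)
qed

quotient_type (overloaded) 's univ_group = "('s::inverse_semigroup_0 \<times> bool) list" / partial: univ_rel
proof (rule part_equivpI)
  show "\<exists>w :: ('s \<times> bool) list. univ_rel w w" using univ_rel.empty by blast
  show "symp (univ_rel :: ('s \<times> bool) list \<Rightarrow> _)" by (auto intro: sympI univ_rel.sym)
  show "transp (univ_rel :: ('s \<times> bool) list \<Rightarrow> _)" by (auto intro: transpI univ_rel.trans)
qed

instantiation univ_group :: (inverse_semigroup_0) group_add
begin
lift_definition zero_univ_group :: "'a univ_group" is "[]" by (rule univ_rel.empty)
lift_definition plus_univ_group :: "'a univ_group \<Rightarrow> 'a univ_group \<Rightarrow> 'a univ_group" is "(@)"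
  by (rule univ_rel.append)
lift_definition uminus_univ_group :: "'a univ_group \<Rightarrow> 'a univ_group" is inv_word
  by (rule univ_rel_inv_word)
definition minus_univ_group :: "'a univ_group \<Rightarrow> 'a univ_group \<Rightarrow> 'a univ_group" where
  "minus_univ_group g h = g + - h"
instance
proof
  fix a b c :: "'a univ_group"
  show "a + b + c = a + (b + c)"
    by transfer (simp add: univ_rel.append)
  show "0 + a = a" by transfer simp
  show "a + 0 = a" by transfer simp
  show "- a + a = 0" by transfer (use univ_rel_left_inverse univ_rel_nonzero in blast)
  show "a + - b = a - b" by (simp add: minus_univ_group_def)
qed
end

text \<open>The value at zero is irrelevant.\<close>

lift_definition univ_map :: "'s::inverse_semigroup_0 \<Rightarrow> 's univ_group"
  is "\<lambda>s. if s = 0 then [] else [(s, True)]"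
  by (simp add: univ_rel.empty univ_rel.letter)


subsection \<open>The reduced C*-algebra\<close>

definition Lambda :: "'s::inverse_semigroup_0 \<Rightarrow> ('s, complex) l2 \<Rightarrow>\<^sub>L ('s, complex) l2" where
  "Lambda s = (THE T. T \<in> bounded_ops \<and>
     (\<forall>t. blinfun_apply T (delta t) = (if s\<^sup>\<star> * s * t = t then delta (s * t) else 0)))"

definition reduced_cstar ::
    "'s::inverse_semigroup_0 itself \<Rightarrow> (('s, complex) l2 \<Rightarrow>\<^sub>L ('s, complex) l2) set star_alg" where
  "reduced_cstar _ = quotient_alg
     (op_alg (is_cstar_subalgebra hull range (Lambda :: 's \<Rightarrow> _)))
     (range (\<lambda>c. scale_op c (Lambda 0)))"


subsection \<open>The spectrum of the idempotents\<close>

definition spectrum :: "('s::inverse_semigroup_0 \<Rightarrow> bool) topology" where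
  "spectrum = subtopology (product_topology (\<lambda>_. discrete_topology UNIV) idempotents)
     {\<phi>. (\<forall>e\<in>idempotents. \<forall>f\<in>idempotents. \<phi> (e * f) \<longleftrightarrow> \<phi> e \<and> \<phi> f) \<and>
          (\<exists>e\<in>idempotents. \<phi> e) \<and> \<not> \<phi> 0}"

definition spectrum_basic :: "'s::inverse_semigroup_0 \<Rightarrow> ('s \<Rightarrow> bool) set" where
  "spectrum_basic e = {\<phi> \<in> topspace spectrum. \<phi> e}"

definition spectrum_act :: "'s::inverse_semigroup_0 \<Rightarrow> ('s \<Rightarrow> bool) \<Rightarrow> ('s \<Rightarrow> bool)" where
  "spectrum_act s \<phi> = (\<lambda>e\<in>idempotents. \<phi> (s\<^sup>\<star> * e * s))"


section \<open>Reduced partial crossed products\<close>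

definition C0 :: "'x topology \<Rightarrow> ('x \<Rightarrow> complex) set" where
  "C0 X = {f. continuous_map X euclidean f \<and>
     (\<forall>\<epsilon>>0. compactin X {x \<in> topspace X. \<epsilon> \<le> cmod (f x)}) \<and>
     (\<forall>x. x \<notin> topspace X \<longrightarrow> f x = 0)}"

definition C0_alg :: "'x topology \<Rightarrow> ('x \<Rightarrow> complex) star_alg" where
  "C0_alg X = \<lparr> alg_carrier = C0 X, alg_add = (\<lambda>f g x. f x + g x), alg_scale = (\<lambda>c f x. c * f x),
     alg_mult = (\<lambda>f g x. f x * g x), alg_star = (\<lambda>f x. cnj (f x)),
     alg_norm = (\<lambda>f. SUP x. cmod (f x)) \<rparr>"

text \<open>For open \<^term>\<open>U\<close>, functions in \<open>C\<^sub>0(U)\<close> are extended by zero, giving an ideal of \<^term>\<open>C0 X\<close>.\<close>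

definition C0_ideal :: "'x topology \<Rightarrow> 'x set \<Rightarrow> ('x \<Rightarrow> complex) set" where
  "C0_ideal X U = {f \<in> C0 X. \<forall>x. x \<notin> U \<longrightarrow> f x = 0}"

definition faithful_rep ::
    "'a star_alg \<Rightarrow> ('a \<Rightarrow> 'h::complex_hilbert_space \<Rightarrow>\<^sub>L 'h) \<Rightarrow> bool" where
  "faithful_rep A \<pi> \<longleftrightarrow> star_hom A (op_alg bounded_ops) \<pi> \<and> inj_on \<pi> (alg_carrier A)"

text \<open>A net of positive contractions in the ideal \<^term>\<open>I\<close> of \<^term>\<open>C0 X\<close> is represented by the filter it
  generates on the function space.\<close>

definition approx_unit :: "'x topology \<Rightarrow> ('x \<Rightarrow> complex) set \<Rightarrow> ('x \<Rightarrow> complex) filter \<Rightarrow> bool" where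
  "approx_unit X I \<F> \<longleftrightarrow> \<F> \<noteq> bot \<and>
     (\<forall>\<^sub>F u in \<F>. u \<in> I \<and> (\<forall>x. \<exists>r\<in>{0..1}. u x = complex_of_real r)) \<and>
     (\<forall>a\<in>I. ((\<lambda>u. alg_norm (C0_alg X) (\<lambda>x. a x * u x - a x)) \<longlongrightarrow> 0) \<F>)"

text \<open>A partial action \<open>\<theta>\<close> of a group on \<^term>\<open>X\<close> is given by the family \<open>D\<close> of open sets \<open>X\<^sub>g\<close> and
  the maps \<open>\<theta> g\<close>, from \<open>D (- g)\<close> onto \<open>D g\<close>; values of \<open>\<theta> g\<close> outside \<open>D (- g)\<close> are irrelevant.\<close>

definition partial_alpha ::
    "('g::group_add \<Rightarrow> 'x set) \<Rightarrow> ('g \<Rightarrow> 'x \<Rightarrow> 'x) \<Rightarrow> 'g \<Rightarrow> ('x \<Rightarrow> complex) \<Rightarrow> ('x \<Rightarrow> complex)" where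
  "partial_alpha D \<theta> g f x = (if x \<in> D g then f (\<theta> (- g) x) else 0)"

text \<open>The vector \<open>\<pi>\<^sub>h(a) \<xi>\<close>, i.e. the strong limit defining \<open>\<pi>\<^sub>h(a)\<close> applied to \<open>\<xi>\<close>; it is the
  same for all approximate units of \<open>A\<^sub>h\<close>.\<close>

definition rep_shift ::
    "'x topology \<Rightarrow> ('g::group_add \<Rightarrow> 'x set) \<Rightarrow> ('g \<Rightarrow> 'x \<Rightarrow> 'x) \<Rightarrow>
     (('x \<Rightarrow> complex) \<Rightarrow> 'h::complex_hilbert_space \<Rightarrow>\<^sub>L 'h) \<Rightarrow> 'g \<Rightarrow> ('x \<Rightarrow> complex) \<Rightarrow> 'h \<Rightarrow> 'h" where
  "rep_shift X D \<theta> \<pi> h a \<xi> = (THE \<eta>. \<forall>\<F>. approx_unit X (C0_ideal X (D h)) \<F> \<longrightarrow>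
     ((\<lambda>u. blinfun_apply (\<pi> (partial_alpha D \<theta> (- h) (\<lambda>x. a x * u x))) \<xi>) \<longlongrightarrow> \<eta>) \<F>)"

definition crossed_op ::
    "'x topology \<Rightarrow> ('g::group_add \<Rightarrow> 'x set) \<Rightarrow> ('g \<Rightarrow> 'x \<Rightarrow> 'x) \<Rightarrow>
     (('x \<Rightarrow> complex) \<Rightarrow> 'h::complex_hilbert_space \<Rightarrow>\<^sub>L 'h) \<Rightarrow>
     ('x \<Rightarrow> complex) \<Rightarrow> 'g \<Rightarrow> ('g, 'h) l2 \<Rightarrow>\<^sub>L ('g, 'h) l2" where
  "crossed_op X D \<theta> \<pi> a g = (THE T. T \<in> bounded_ops \<and>
     (\<forall>\<xi> h. l2_nth (blinfun_apply T \<xi>) h = rep_shift X D \<theta> \<pi> h a (l2_nth \<xi> (- g + h))))"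

text \<open>The finite sums \<open>\<Sum>\<^sub>g a\<^sub>g \<delta>\<^sub>g\<close>. Their product and involution are those of the
  operators representing them.\<close>

definition crossed_sums ::
    "'x topology \<Rightarrow> ('g::group_add \<Rightarrow> 'x set) \<Rightarrow> ('g \<Rightarrow> 'x \<Rightarrow> complex) set" where
  "crossed_sums X D = {a. finite {g. a g \<noteq> (\<lambda>_. 0)} \<and> (\<forall>g. a g \<in> C0_ideal X (D g))}"

definition crossed_rep ::
    "'x topology \<Rightarrow> ('g::group_add \<Rightarrow> 'x set) \<Rightarrow> ('g \<Rightarrow> 'x \<Rightarrow> 'x) \<Rightarrow>
     (('x \<Rightarrow> complex) \<Rightarrow> 'h::complex_hilbert_space \<Rightarrow>\<^sub>L 'h) \<Rightarrow>
     ('g \<Rightarrow> 'x \<Rightarrow> complex) \<Rightarrow> ('g, 'h) l2 \<Rightarrow>\<^sub>L ('g, 'h) l2" where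
  "crossed_rep X D \<theta> \<pi> a = (\<Sum>g | a g \<noteq> (\<lambda>_. 0). crossed_op X D \<theta> \<pi> (a g) g)"

definition reduced_crossed_product ::
    "'x topology \<Rightarrow> ('g::group_add \<Rightarrow> 'x set) \<Rightarrow> ('g \<Rightarrow> 'x \<Rightarrow> 'x) \<Rightarrow>
     (('x \<Rightarrow> complex) \<Rightarrow> 'h::complex_hilbert_space \<Rightarrow>\<^sub>L 'h) \<Rightarrow>
     (('g, 'h) l2 \<Rightarrow>\<^sub>L ('g, 'h) l2) star_alg" where
  "reduced_crossed_product X D \<theta> \<pi> = op_alg (closure (crossed_rep X D \<theta> \<pi> ` crossed_sums X D))"


subsection \<open>The partial action of the universal group on the spectrum\<close>

definition univ_dom :: "'s::inverse_semigroup_0 univ_group \<Rightarrow> ('s \<Rightarrow> bool) set" where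
  "univ_dom g = (\<Union>s\<in>{s. s \<noteq> 0 \<and> univ_map s = - g}. spectrum_basic (s\<^sup>\<star> * s))"

definition univ_act :: "'s::inverse_semigroup_0 univ_group \<Rightarrow> ('s \<Rightarrow> bool) \<Rightarrow> ('s \<Rightarrow> bool)" where
  "univ_act g \<phi> = spectrum_act (SOME s. s \<noteq> 0 \<and> univ_map s = g \<and> \<phi> \<in> spectrum_basic (s\<^sup>\<star> * s)) \<phi>"

end

theory Submission
  imports Defs
begin

text \<open>Write \<open>\<iota>\<close> for the canonical map into \<open>G\<close>. Both algebras are closed spans of partial isometries indexed
  by \<open>S\<close>: the operators \<open>\<Lambda>\<^sub>s\<close> on \<open>l\<^sup>2(S)\<close> and the operators \<open>V\<^sub>s\<close> given by \<open>1\<^bsub>D(s s*)\<^esub> \<delta>\<^bsub>\<iota>(s)\<^esub>\<close> in the crossed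
  product. Since \<open>\<Lambda>\<^sub>0\<close> is the projection onto the coordinate \<open>0\<close> and spans the ideal that is divided
  out, it suffices to see that \<open>\<Sum> c\<^sub>s V\<^sub>s\<close> and \<open>(\<Sum> c\<^sub>s \<Lambda>\<^sub>s) (1 - \<Lambda>\<^sub>0)\<close> have the same norm.

  Purity of \<open>\<iota>\<close> means that a nonzero \<open>t\<close> is determined by \<open>\<iota>(t)\<close> and \<open>t* t\<close>. The space \<open>l\<^sup>2(S)\<close> splits over
  the idempotents \<open>e = t* t\<close>, and on the part over \<open>e\<close> one may replace \<open>t\<close> by \<open>\<iota>(t)\<close>. On the crossed
  product side finitely many idempotents cut \<open>H\<close> into the ranges of the projections of the sets
  \<open>D(e)\<close> minus smaller \<open>D(f)\<close>; on such a range \<open>\<Sum> c\<^sub>s V\<^sub>s\<close> acts like the corresponding compression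
  of \<open>\<Sum> c\<^sub>s \<Lambda>\<^sub>s\<close> tensored with the identity, which gives one inequality. All these sets are nonempty
  because they contain principal characters, so by faithfulness the ranges are nonzero, which
  gives the other inequality.\<close>

section \<open>Bounded operators on complex Hilbert spaces\<close>

text \<open>The usual route represents C0 of the spectrum on l^2 over the principal characters,
  where the crossed product visibly contains the regular representation of S, and then appeals to
  independence of the faithful representation. Here \<pi> is arbitrary, and H need not contain a
  vector concentrated at a single character. But on finitely many coordinates a finite combination
  tests only finitely many idempotents t* s* s t against e, so a small compact open neighbourhood of
  the principal character of e is as good as the character itself. The other obstacle is that the
  domain of a group element is open but in general not compact, so its projection exists only as a
  strong limit. Countability of S lets these limits be taken along increasing sequences of compact
  open sets, where they exist by monotonicity. The two algebras are compared through formal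
  combinations of elements of S: both families multiply like S, so equality of norms makes the
  correspondence well defined, multiplicative and continuous. The only asymmetry is at zero, where
  V_0 = 0 whereas \<Lambda>_0 has rank one.\<close>

lemma scaleC_zero_right [simp]: "c *\<^sub>C 0 = 0"
  using scaleC_add_right[of c 0 0] by simp

lemma scaleC_zero_left [simp]: "0 *\<^sub>C x = 0"
  using scaleC_add_left[of 0 0 x] by simp

lemma scaleC_one [simp]: "1 *\<^sub>C x = x"
  using scaleC_of_real[of 1 x] by simp

lemma scaleC_minus_right: "c *\<^sub>C (- x) = - (c *\<^sub>C x)"
  using scaleC_add_right[of c x "- x"] by (simp add: eq_neg_iff_add_eq_0 add.commute)

lemma scaleC_diff_right: "c *\<^sub>C (x - y) = c *\<^sub>C x - c *\<^sub>C y"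
  using scaleC_add_right[of c x "- y"] by (simp add: scaleC_minus_right)

lemma scaleC_sum_right: "c *\<^sub>C sum f I = (\<Sum>i\<in>I. c *\<^sub>C f i)"
  by (induction I rule: infinite_finite_induct) (simp_all add: scaleC_add_right)

lemma scaleC_scaleR: "c *\<^sub>C r *\<^sub>R x = r *\<^sub>R c *\<^sub>C x"
  unfolding scaleC_of_real[symmetric] scaleC_scaleC by (simp add: mult.commute)

lemma scaleC_sum_left: "sum f I *\<^sub>C x = (\<Sum>i\<in>I. f i *\<^sub>C x)"
  by (induction I rule: infinite_finite_induct) (simp_all add: scaleC_add_left)

lemma bounded_linear_scaleC: "bounded_linear (\<lambda>x. c *\<^sub>C x)"
  by (rule bounded_linear_intro[where K = "cmod c"])
    (simp_all add: scaleC_add_right scaleC_scaleR norm_scaleC mult.commute)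

lemma cinner_zero_right [simp]: "cinner x 0 = 0"
  using cinner_add_right[of x 0 0] by simp

lemma cinner_zero_left [simp]: "cinner 0 x = 0"
  using cinner_add_left[of 0 0 x] by simp

lemma cinner_minus_right: "cinner x (- y) = - cinner x y"
  using cinner_add_right[of x y "- y"] by (simp add: eq_neg_iff_add_eq_0 add.commute)

lemma cinner_diff_right: "cinner x (y - z) = cinner x y - cinner x z"
  using cinner_add_right[of x y "- z"] by (simp add: cinner_minus_right)

lemma cinner_diff_left: "cinner (y - z) x = cinner y x - cinner z x"
  by (metis cinner_commute cinner_diff_right complex_cnj_diff)

lemma cinner_sum_right: "cinner x (sum f I) = (\<Sum>i\<in>I. cinner x (f i))"
  by (induction I rule: infinite_finite_induct) (simp_all add: cinner_add_right)

lemma cinner_sum_left: "cinner (sum f I) x = (\<Sum>i\<in>I. cinner (f i) x)"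
  by (induction I rule: infinite_finite_induct) (simp_all add: cinner_add_left)

lemma cinner_scaleR_right: "cinner x (r *\<^sub>R y) = of_real r * cinner x y"
  by (metis cinner_scaleC_right scaleC_of_real)

lemma norm_power2_eq_cinner: "complex_of_real ((norm x)\<^sup>2) = cinner x x"
  by (simp only: cinner_self)

lemma norm_add_power2: "(norm (x + y))\<^sup>2 = (norm x)\<^sup>2 + 2 * Re (cinner x y) + (norm y)\<^sup>2"
proof -
  have "complex_of_real ((norm (x + y))\<^sup>2) = cinner x x + (cinner x y + cnj (cinner x y)) + cinner y y"
    unfolding norm_power2_eq_cinner
    by (simp add: cinner_add_left cinner_add_right cinner_commute[of y x])
  also have "\<dots> = complex_of_real ((norm x)\<^sup>2 + 2 * Re (cinner x y) + (norm y)\<^sup>2)"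
    by (simp add: cinner_self complex_add_cnj)
  finally show ?thesis using of_real_eq_iff by blast
qed

lemma norm_diff_power2: "(norm (x - y))\<^sup>2 = (norm x)\<^sup>2 - 2 * Re (cinner x y) + (norm y)\<^sup>2"
  using norm_add_power2[of x "- y"] by (simp add: cinner_minus_right)

text \<open>Scaling both vectors to norm one turns the additive bound \<open>norm_cinner_le\<close>
  into the multiplicative one.\<close>

lemma cinner_cauchy_schwarz: "cmod (cinner x y) \<le> norm x * norm y"
proof (cases "x = 0 \<or> y = 0")
  case False
  then have "0 < norm x" "0 < norm y" by auto
  moreover have "2 * cmod (cinner (of_real (1 / norm x) *\<^sub>C x) (of_real (1 / norm y) *\<^sub>C y)) \<le> 1 + 1"
    using norm_cinner_le[of "of_real (1 / norm x) *\<^sub>C x" "of_real (1 / norm y) *\<^sub>C y"] False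
    by (simp add: norm_scaleC norm_divide)
  ultimately show ?thesis
    by (simp add: cinner_scaleC_left cinner_scaleC_right norm_mult norm_divide field_simps)
qed auto

lemma bounded_linear_cinner_right: "bounded_linear (cinner x)"
  by (rule bounded_linear_intro[where K = "norm x"])
    (simp_all add: cinner_add_right cinner_scaleR_right scaleR_conv_of_real
      cinner_cauchy_schwarz mult.commute[of _ "norm x"])

lemma cinner_ext: "(\<And>x. cinner x y = cinner x z) \<Longrightarrow> y = z"
  using cinner_self[of "y - z"] by (simp add: cinner_diff_right)

lemma cinner_eq_zero_imp_zero: "cinner x x = 0 \<Longrightarrow> x = 0"
  using cinner_self[of x] by simp

lemma tendsto_scaleC [tendsto_intros]:
  fixes f :: "'a \<Rightarrow> 'h::complex_hilbert_space"
  assumes "(f \<longlongrightarrow> x) F" shows "((\<lambda>i. c *\<^sub>C f i) \<longlongrightarrow> c *\<^sub>C x) F"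
  using bounded_linear.tendsto[OF bounded_linear_scaleC assms] .

lemma tendsto_cinner_right [tendsto_intros]:
  fixes f :: "'a \<Rightarrow> 'h::complex_hilbert_space"
  assumes "(f \<longlongrightarrow> x) F" shows "((\<lambda>i. cinner y (f i)) \<longlongrightarrow> cinner y x) F"
  using bounded_linear.tendsto[OF bounded_linear_cinner_right assms] .

lemma tendsto_cinner_left [tendsto_intros]:
  fixes f :: "'a \<Rightarrow> 'h::complex_hilbert_space"
  assumes "(f \<longlongrightarrow> x) F" shows "((\<lambda>i. cinner (f i) y) \<longlongrightarrow> cinner x y) F"
  unfolding cinner_commute[of _ y] by (intro tendsto_intros assms)

text \<open>The representing vector is the minimiser of \<open>\<parallel>x\<parallel>\<^sup>2 - 2 Re l(x)\<close>; minimising sequences are Cauchy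
  by the parallelogram law.\<close>

theorem riesz_representation:
  fixes l :: "'h::complex_hilbert_space \<Rightarrow> complex"
  assumes l: "bounded_linear l" and lC: "\<And>c x. l (c *\<^sub>C x) = c * l x"
  shows "\<exists>z. \<forall>x. l x = cinner z x"
proof -
  interpret l: bounded_linear l by fact
  define J where "J x = (norm x)\<^sup>2 - 2 * Re (l x)" for x
  obtain K where K: "\<And>x. cmod (l x) \<le> norm x * K"
    using l.bounded by blast
  have low: "- K\<^sup>2 \<le> J x" for x
  proof -
    have "Re (l x) \<le> norm x * K" using K[of x] complex_Re_le_cmod[of "l x"] by linarith
    moreover have "0 \<le> (norm x - K)\<^sup>2" by simp
    ultimately show ?thesis unfolding J_def power2_diff by linarith
  qed
  define m where "m = Inf (range J)"
  have bdd: "bdd_below (range J)" using low by (intro bdd_belowI2)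
  have mle: "m \<le> J x" for x unfolding m_def by (rule cInf_lower[OF _ bdd]) simp
  define d where "d n = 1 / real (Suc n)" for n
  have "\<exists>x. J x < m + d n" for n
    using cInf_lessD[of "range J" "m + d n"] unfolding m_def d_def by auto
  then obtain x where x: "\<And>n. J (x n) < m + d n" by metis
  \<comment> \<open>Minimality of m at the midpoint of u and v shows that near-minimisers are close
    to each other.\<close>
  have par: "(norm (u - v))\<^sup>2 \<le> 2 * (J u - m) + 2 * (J v - m)" for u v
  proof -
    have "(norm ((1/2) *\<^sub>R (u + v)))\<^sup>2 = (1/4) * (norm (u + v))\<^sup>2"
      by (simp add: power2_eq_square)
    moreover have "Re (l ((1/2) *\<^sub>R (u + v))) = (Re (l u) + Re (l v)) / 2"
      by (simp add: l.scaleR l.add)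
    ultimately have "4 * m \<le> (norm (u + v))\<^sup>2 - 4 * (Re (l u) + Re (l v))"
      using mle[of "(1/2) *\<^sub>R (u + v)"] by (simp add: J_def)
    then show ?thesis
      unfolding norm_diff_power2 norm_add_power2 J_def by argo
  qed
  have "Cauchy x"
  proof (rule CauchyI)
    fix e :: real assume e: "0 < e"
    then obtain N where N: "4 / e\<^sup>2 < real N" using reals_Archimedean2 by blast
    show "\<exists>M. \<forall>m\<ge>M. \<forall>n\<ge>M. norm (x m - x n) < e"
    proof (intro exI allI impI)
      fix i j assume ij: "N \<le> i" "N \<le> j"
      have le: "d k \<le> d N" if "N \<le> k" for k
        unfolding d_def using that by (simp add: frac_le)
      have "(norm (x i - x j))\<^sup>2 < 2 * d i + 2 * d j"
        using par[of "x i" "x j"] x[of i] x[of j] by argo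
      also have "\<dots> \<le> 4 * d N" using le[OF ij(1)] le[OF ij(2)] by linarith
      also have "\<dots> < e\<^sup>2"
      proof -
        have "4 < e\<^sup>2 * real N" using N e by (simp add: field_simps)
        also have "\<dots> \<le> e\<^sup>2 * real (Suc N)" by (intro mult_left_mono) auto
        finally show ?thesis by (simp add: d_def field_simps)
      qed
      finally show "norm (x i - x j) < e" using e by (simp add: power_less_imp_less_base)
    qed
  qed
  then obtain z where z: "x \<longlonglongrightarrow> z" using Cauchy_convergent_iff convergent_def by blast
  have "(\<lambda>n. J (x n)) \<longlonglongrightarrow> J z" unfolding J_def
    by (intro tendsto_intros z l.tendsto)
  moreover have "(\<lambda>n. m + d n) \<longlonglongrightarrow> m"
    using tendsto_add[OF tendsto_const LIMSEQ_inverse_real_of_nat]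
    by (simp add: inverse_eq_divide d_def)
  ultimately have Jz: "J z \<le> m"
    by (rule LIMSEQ_le) (use x less_imp_le in blast)
  have Re: "Re (cinner z y) = Re (l y)" for y
  proof (rule ccontr)
    define b where "b = Re (cinner z y) - Re (l y)"
    assume "Re (cinner z y) \<noteq> Re (l y)"
    then have b: "b \<noteq> 0" by (simp add: b_def)
    \<comment> \<open>First variation at the minimiser z: a non-zero linear coefficient b is
      contradicted at the minimum of this quadratic in t, which is at t = - b / |y|^2.\<close>
    have ineq: "0 \<le> 2 * t * b + t\<^sup>2 * (norm y)\<^sup>2" for t :: real
    proof -
      have "J z \<le> J (z + t *\<^sub>R y)" using Jz mle[of "z + t *\<^sub>R y"] by linarith
      then show ?thesis
        unfolding J_def norm_add_power2
        by (simp add: l.add l.scaleR b_def cinner_scaleR_right power_mult_distrib algebra_simps)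
    qed
    have y: "norm y \<noteq> 0"
    proof
      assume "norm y = 0"
      then show False using b by (simp add: b_def l.zero)
    qed
    have "2 * (- b / (norm y)\<^sup>2) * b + (- b / (norm y)\<^sup>2)\<^sup>2 * (norm y)\<^sup>2 = - (b\<^sup>2 / (norm y)\<^sup>2)"
      using y by (simp add: field_simps power2_eq_square)
    moreover have "0 < b\<^sup>2 / (norm y)\<^sup>2" using b y by simp
    ultimately show False using ineq[of "- b / (norm y)\<^sup>2"] by linarith
  qed
  have "l y = cinner z y" for y
  proof (rule complex_eqI)
    show "Re (l y) = Re (cinner z y)" using Re by simp
    \<comment> \<open>Complex linearity recovers the imaginary part: Re l(iy) = - Im l(y).\<close>
    show "Im (l y) = Im (cinner z y)"
      using Re[of "\<i> *\<^sub>C y"] by (simp add: cinner_scaleC_right lC)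
  qed
  then show ?thesis by blast
qed

section \<open>Complex-linear bounded operators and their adjoints\<close>

lemma bounded_opsD: "T \<in> bounded_ops \<Longrightarrow> blinfun_apply T (c *\<^sub>C x) = c *\<^sub>C blinfun_apply T x"
  by (simp add: bounded_ops_def)

lemma scale_op_apply [simp]: "blinfun_apply (scale_op c T) x = c *\<^sub>C blinfun_apply T x"
  unfolding scale_op_def
  by (subst bounded_linear_Blinfun_apply)
    (auto intro: bounded_linear_compose[OF bounded_linear_scaleC] blinfun.bounded_linear_right)

lemma adj_op_unique:
  assumes "\<And>x y. cinner (blinfun_apply T x) y = cinner x (blinfun_apply T' y)"
  shows "adj_op T = T'"
  unfolding adj_op_def
proof (rule the_equality)
  show "\<And>T''. \<forall>x y. cinner (blinfun_apply T x) y = cinner x (blinfun_apply T'' y) \<Longrightarrow> T'' = T'"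
    by (rule blinfun_eqI, rule cinner_ext) (metis assms)
qed (use assms in blast)

lemma cinner_adj_op:
  assumes T: "T \<in> bounded_ops"
  shows "cinner (blinfun_apply T x) y = cinner x (blinfun_apply (adj_op T) y)"
    and "adj_op T \<in> bounded_ops" and "norm (adj_op T) \<le> norm T"
proof -
  have "\<exists>z. \<forall>x. cinner y (blinfun_apply T x) = cinner z x" for y
    by (rule riesz_representation)
      (auto intro: bounded_linear_compose[OF bounded_linear_cinner_right] blinfun.bounded_linear_right
        simp: bounded_opsD[OF T] cinner_scaleC_right)
  then obtain A where A: "\<And>y x. cinner y (blinfun_apply T x) = cinner (A y) x" by metis
  have A': "cinner (blinfun_apply T x) y = cinner x (A y)" for x y
    by (metis A cinner_commute)
  have AC: "A (c *\<^sub>C y) = c *\<^sub>C A y" for c y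
    by (rule cinner_ext) (simp add: A'[symmetric] cinner_scaleC_right)
  have bd: "norm (A y) \<le> norm y * norm T" for y
  proof (cases "A y = 0")
    case False
    have "norm (A y) * norm (A y) = cmod (cinner (blinfun_apply T (A y)) y)"
      unfolding A' cinner_self by (simp add: power2_eq_square norm_mult)
    also have "\<dots> \<le> norm (blinfun_apply T (A y)) * norm y" by (rule cinner_cauchy_schwarz)
    also have "\<dots> \<le> norm T * norm (A y) * norm y"
      by (intro mult_right_mono norm_blinfun norm_ge_zero)
    finally have "norm (A y) * norm (A y) \<le> norm (A y) * (norm y * norm T)" by (simp add: ac_simps)
    then show ?thesis using False by simp
  qed simp
  have bl: "bounded_linear A"
  proof (rule bounded_linear_intro[where K = "norm T"])
    show "A (x + y) = A x + A y" for x y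
      by (rule cinner_ext) (simp add: A'[symmetric] cinner_add_right)
    show "A (r *\<^sub>R x) = r *\<^sub>R A x" for r x
      using AC[of "of_real r" x] by (simp add: scaleC_of_real)
  qed (use bd in \<open>simp add: mult.commute\<close>)
  have ap: "blinfun_apply (Blinfun A) = A" using bl by (rule bounded_linear_Blinfun_apply)
  have eq: "adj_op T = Blinfun A" by (rule adj_op_unique) (simp add: ap A')
  show "cinner (blinfun_apply T x) y = cinner x (blinfun_apply (adj_op T) y)"
    by (simp add: eq ap A')
  show "adj_op T \<in> bounded_ops" by (simp add: bounded_ops_def eq ap AC)
  show "norm (adj_op T) \<le> norm T"
    by (rule norm_blinfun_bound) (use bd in \<open>simp_all add: eq ap mult.commute\<close>)
qed

lemma bounded_ops_zero: "0 \<in> bounded_ops"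
  and bounded_ops_add: "S \<in> bounded_ops \<Longrightarrow> T \<in> bounded_ops \<Longrightarrow> S + T \<in> bounded_ops"
  and bounded_ops_diff: "S \<in> bounded_ops \<Longrightarrow> T \<in> bounded_ops \<Longrightarrow> S - T \<in> bounded_ops"
  and bounded_ops_scale: "T \<in> bounded_ops \<Longrightarrow> scale_op c T \<in> bounded_ops"
  by (simp_all add: bounded_ops_def blinfun.add_left blinfun.diff_left scaleC_add_right
      scaleC_diff_right scaleC_scaleC mult.commute)

lemma closed_bounded_ops: "closed (bounded_ops :: ('h::complex_hilbert_space \<Rightarrow>\<^sub>L 'h) set)"
unfolding closed_sequential_limits
proof (intro allI impI, elim conjE)
  fix T :: "nat \<Rightarrow> 'h \<Rightarrow>\<^sub>L 'h" and L assume T': "\<forall>n. T n \<in> bounded_ops" and T2: "T \<longlonglongrightarrow> L"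
  have T: "\<And>n. T n \<in> bounded_ops" "T \<longlonglongrightarrow> L" using T' T2 by auto
  have "(\<lambda>n. blinfun_apply (T n) (c *\<^sub>C x)) \<longlonglongrightarrow> c *\<^sub>C blinfun_apply L x" for c x
    unfolding bounded_opsD[OF T(1)] by (intro tendsto_intros blinfun.tendsto T(2))
  moreover have "(\<lambda>n. blinfun_apply (T n) (c *\<^sub>C x)) \<longlonglongrightarrow> blinfun_apply L (c *\<^sub>C x)" for c x
    by (intro tendsto_intros blinfun.tendsto T(2))
  ultimately show "L \<in> bounded_ops" unfolding bounded_ops_def using LIMSEQ_unique by blast
qed

lemma norm_scale_op_le: "norm (scale_op c T) \<le> cmod c * norm T"
  by (rule norm_blinfun_bound) (auto simp: norm_scaleC mult.assoc intro!: mult_left_mono norm_blinfun)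

lemma scale_op_simps [simp]:
  "scale_op c (S + T) = scale_op c S + scale_op c T"
  "scale_op c (S - T) = scale_op c S - scale_op c T"
  "scale_op c 0 = 0" "scale_op 1 T = T" "scale_op 0 T = 0"
  "scale_op c (scale_op d T) = scale_op (c * d) T"
  by (auto intro!: blinfun_eqI simp: blinfun.add_left blinfun.diff_left scaleC_add_right
      scaleC_diff_right scaleC_scaleC)

lemma scale_op_add_left: "scale_op (c + d) T = scale_op c T + scale_op d T"
  by (auto intro!: blinfun_eqI simp: blinfun.add_left scaleC_add_left)

lemma scale_op_compose_left: "scale_op c S o\<^sub>L T = scale_op c (S o\<^sub>L T)"
  by (rule blinfun_eqI) simp

lemma scale_op_compose_right:
  "S \<in> bounded_ops \<Longrightarrow> S o\<^sub>L scale_op c T = scale_op c (S o\<^sub>L T)"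
  by (rule blinfun_eqI) (simp add: bounded_opsD)

lemma bounded_linear_scale_op: "bounded_linear (scale_op c)"
  by (rule bounded_linear_intro[where K = "cmod c"])
    (auto intro!: blinfun_eqI simp: blinfun.scaleR_left scaleC_scaleR mult.commute
      order_trans[OF norm_scale_op_le])

lemma tendsto_scale_op:
  assumes "(T \<longlongrightarrow> L) F" shows "((\<lambda>i. scale_op c (T i)) \<longlongrightarrow> scale_op c L) F"
  using bounded_linear.tendsto[OF bounded_linear_scale_op assms] .

lemma tendsto_blinfun_compose:
  assumes "(S \<longlongrightarrow> K) F" "(T \<longlongrightarrow> L) F" shows "((\<lambda>i. S i o\<^sub>L T i) \<longlongrightarrow> K o\<^sub>L L) F"
  using bounded_bilinear.tendsto[OF bounded_bilinear_blinfun_compose assms] .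

lemma adj_op_add:
  assumes "S \<in> bounded_ops" "T \<in> bounded_ops" shows "adj_op (S + T) = adj_op S + adj_op T"
  by (rule adj_op_unique)
    (simp add: blinfun.add_left cinner_add_left cinner_add_right cinner_adj_op(1) assms)

lemma adj_op_diff:
  assumes "S \<in> bounded_ops" "T \<in> bounded_ops" shows "adj_op (S - T) = adj_op S - adj_op T"
  by (rule adj_op_unique)
    (simp add: blinfun.diff_left cinner_diff_left cinner_diff_right cinner_adj_op(1) assms)

lemma adj_op_scale:
  assumes "T \<in> bounded_ops" shows "adj_op (scale_op c T) = scale_op (cnj c) (adj_op T)"
  by (rule adj_op_unique)
    (simp add: cinner_scaleC_left cinner_scaleC_right cinner_adj_op(1) assms)

lemma adj_op_zero [simp]: "adj_op 0 = 0"
  by (rule adj_op_unique) simp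

lemma tendsto_adj_op:
  fixes T :: "nat \<Rightarrow> 'h::complex_hilbert_space \<Rightarrow>\<^sub>L 'h"
  assumes T: "\<And>n. T n \<in> bounded_ops" "T \<longlonglongrightarrow> L"
  shows "(\<lambda>n. adj_op (T n)) \<longlonglongrightarrow> adj_op L"
proof -
  have L: "L \<in> bounded_ops" using closed_sequentially[OF closed_bounded_ops] T by blast
  have "norm (adj_op (T n) - adj_op L) \<le> norm (T n - L)" for n
    using cinner_adj_op(3)[OF bounded_ops_diff[OF T(1) L], of n] by (simp add: adj_op_diff T(1) L)
  moreover have "(\<lambda>n. norm (T n - L)) \<longlonglongrightarrow> 0" using T(2) by (simp add: LIM_zero tendsto_norm_zero)
  ultimately have "(\<lambda>n. adj_op (T n) - adj_op L) \<longlonglongrightarrow> 0"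
    by (rule Lim_null_comparison[OF always_eventually, rule_format])
  then show ?thesis by (rule LIM_zero_cancel)
qed

section \<open>Operators on square-summable families\<close>

lemma l2_nth_simps [simp]:
  "l2_nth 0 i = 0" "l2_nth (x + y) i = l2_nth x i + l2_nth y i"
  "l2_nth (x - y) i = l2_nth x i - l2_nth y i" "l2_nth (c *\<^sub>C x) i = c *\<^sub>C l2_nth x i"
  "l2_nth (r *\<^sub>R x) i = r *\<^sub>R l2_nth x i"
  by (simp_all add: zero_l2.rep_eq plus_l2.rep_eq minus_l2.rep_eq scaleC_l2.rep_eq scaleR_l2.rep_eq)

lemma l2_nth_sum: "l2_nth (sum f I) i = (\<Sum>j\<in>I. l2_nth (f j) i)"
  by (induction I rule: infinite_finite_induct) simp_all

lemma l2_nth_delta: "l2_nth (delta i) j = (if j = i then 1 else 0)"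
  by (simp add: delta.rep_eq)

lemma l2_eqI: "(\<And>i. l2_nth x i = l2_nth y i) \<Longrightarrow> x = y"
  by (metis l2_nth_inject ext)

lemma l2_sum_le_norm:
  assumes "finite F" shows "(\<Sum>i\<in>F. (norm (l2_nth x i))\<^sup>2) \<le> (norm x)\<^sup>2"
proof -
  have "sqrt (\<Sum>i\<in>F. (norm (l2_nth x i))\<^sup>2) \<le> norm x"
    using L2_set_le_infsum[of "l2_nth x" F, OF _ assms] l2_nth[of x]
    by (simp add: norm_l2.rep_eq L2_set_def)
  then show ?thesis by (rule sqrt_le_D)
qed

lemma L2_set_le_of_sum_le:
  assumes "0 \<le> B" "(\<Sum>i\<in>F. (f i)\<^sup>2) \<le> B\<^sup>2" shows "L2_set f F \<le> B"
  unfolding L2_set_def using assms by (simp add: real_le_lsqrt sum_nonneg)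

lemma l2_norm_le:
  assumes "0 \<le> B" "\<And>F. finite F \<Longrightarrow> (\<Sum>i\<in>F. (norm (l2_nth x i))\<^sup>2) \<le> B\<^sup>2"
  shows "norm x \<le> B"
  unfolding norm_l2.rep_eq
  by (rule l2_summableI(2)) (intro L2_set_le_of_sum_le assms)

lemma l2_exI:
  fixes f :: "'i \<Rightarrow> 'h::complex_hilbert_space"
  assumes "0 \<le> B" "\<And>F. finite F \<Longrightarrow> (\<Sum>i\<in>F. (norm (f i))\<^sup>2) \<le> B\<^sup>2"
  shows "\<exists>x. l2_nth x = f \<and> norm x \<le> B"
proof (intro exI conjI)
  have "(\<lambda>i. (norm (f i))\<^sup>2) summable_on UNIV"
    by (rule l2_summableI(1)[where B = B]) (intro L2_set_le_of_sum_le assms)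
  then show eq: "l2_nth (Abs_l2 f) = f" by (simp add: Abs_l2_inverse)
  show "norm (Abs_l2 f) \<le> B" by (rule l2_norm_le) (use assms eq in auto)
qed

lemma l2_finite_support:
  fixes f :: "'i \<Rightarrow> 'h::complex_hilbert_space"
  assumes "finite K" "\<And>i. i \<notin> K \<Longrightarrow> f i = 0"
  obtains x where "l2_nth x = f" "(norm x)\<^sup>2 = (\<Sum>i\<in>K. (norm (f i))\<^sup>2)"
proof -
  have *: "(\<Sum>i\<in>F. (norm (f i))\<^sup>2) \<le> (sqrt (\<Sum>i\<in>K. (norm (f i))\<^sup>2))\<^sup>2" if "finite F" for F
  proof -
    have "(\<Sum>i\<in>F. (norm (f i))\<^sup>2) = (\<Sum>i\<in>F \<inter> K. (norm (f i))\<^sup>2)"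
      using assms that by (intro sum.mono_neutral_right) auto
    also have "\<dots> \<le> (\<Sum>i\<in>K. (norm (f i))\<^sup>2)" by (intro sum_mono2 assms) auto
    finally show ?thesis by (simp add: sum_nonneg)
  qed
  from l2_exI[OF _ this] obtain x
    where x: "l2_nth x = f" "norm x \<le> sqrt (\<Sum>i\<in>K. (norm (f i))\<^sup>2)" by (auto simp: sum_nonneg)
  have "(norm x)\<^sup>2 \<le> (\<Sum>i\<in>K. (norm (f i))\<^sup>2)"
    using x(2) power_mono[OF x(2) norm_ge_zero, of 2] by (simp add: sum_nonneg)
  with l2_sum_le_norm[OF assms(1), of x] show ?thesis using that[OF x(1)] x(1) by simp
qed

text \<open>Both regular representations have this shape: reindex the coordinates by \<sigma>, then
  apply an operator in each coordinate. Injectivity is asked for only on S because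
  \<open>r \<mapsto> s\<^sup>\<star> * r\<close> is in general injective only on the range of
  s.\<close>

lemma l2_reindexed_operator:
  fixes K :: "'i \<Rightarrow> 'h::complex_hilbert_space \<Rightarrow> 'h" and \<sigma> :: "'i \<Rightarrow> 'i"
  assumes add: "\<And>i v w. K i (v + w) = K i v + K i w"
    and scale: "\<And>i c v. K i (c *\<^sub>C v) = c *\<^sub>C K i v"
    and bound: "\<And>i v. norm (K i v) \<le> B * norm v" and B: "0 \<le> B"
    and inj: "inj_on \<sigma> S" and supp: "\<And>i v. i \<notin> S \<Longrightarrow> K i v = 0"
  obtains T where "T \<in> bounded_ops" "norm T \<le> B"
    "\<And>\<xi> i. l2_nth (blinfun_apply T \<xi>) i = K i (l2_nth \<xi> (\<sigma> i))"
proof -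
  have "\<exists>y. l2_nth y = (\<lambda>i. K i (l2_nth \<xi> (\<sigma> i))) \<and> norm y \<le> B * norm \<xi>" for \<xi>
  proof (rule l2_exI)
    fix F :: "'i set" assume F: "finite F"
    have "(\<Sum>i\<in>F. (norm (K i (l2_nth \<xi> (\<sigma> i))))\<^sup>2)
        = (\<Sum>i\<in>F \<inter> S. (norm (K i (l2_nth \<xi> (\<sigma> i))))\<^sup>2)"
      using F supp by (intro sum.mono_neutral_right) auto
    also have "\<dots> \<le> (\<Sum>i\<in>F \<inter> S. B\<^sup>2 * (norm (l2_nth \<xi> (\<sigma> i)))\<^sup>2)"
      unfolding power_mult_distrib[symmetric] by (intro sum_mono power_mono bound norm_ge_zero)
    also have "\<dots> = B\<^sup>2 * (\<Sum>j\<in>\<sigma> ` (F \<inter> S). (norm (l2_nth \<xi> j))\<^sup>2)"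
      using inj by (simp add: sum_distrib_left sum.reindex inj_on_Int)
    also have "\<dots> \<le> B\<^sup>2 * (norm \<xi>)\<^sup>2"
      using F by (intro mult_left_mono l2_sum_le_norm) auto
    finally show "(\<Sum>i\<in>F. (norm (K i (l2_nth \<xi> (\<sigma> i))))\<^sup>2) \<le> (B * norm \<xi>)\<^sup>2"
      by (simp add: power_mult_distrib)
  qed (use B in simp)
  then obtain t where t: "\<And>\<xi>. l2_nth (t \<xi>) = (\<lambda>i. K i (l2_nth \<xi> (\<sigma> i)))"
    "\<And>\<xi>. norm (t \<xi>) \<le> B * norm \<xi>" by metis
  have tC: "t (c *\<^sub>C \<xi>) = c *\<^sub>C t \<xi>" for c \<xi>
    by (rule l2_eqI) (simp add: t scale)
  have "bounded_linear t"
  proof (rule bounded_linear_intro[where K = B])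
    show "t (x + y) = t x + t y" for x y by (rule l2_eqI) (simp add: t add)
    show "t (r *\<^sub>R x) = r *\<^sub>R t x" for r x using tC[of "of_real r" x] by (simp add: scaleC_of_real)
  qed (use t(2) in \<open>simp add: mult.commute\<close>)
  then have ap: "blinfun_apply (Blinfun t) = t" by (rule bounded_linear_Blinfun_apply)
  show ?thesis
  proof (rule that[of "Blinfun t"])
    show "Blinfun t \<in> bounded_ops" by (simp add: bounded_ops_def ap tC)
    show "norm (Blinfun t) \<le> B" by (rule norm_blinfun_bound[OF B]) (simp add: ap t)
  qed (simp add: ap t)
qed

lemma cinner_delta: "cinner (delta i) x = l2_nth x i"
proof -
  have "cinner (delta i) x = (\<Sum>\<^sub>\<infinity>j. if j = i then l2_nth x i else 0)"
    unfolding cinner_l2.rep_eq by (intro infsum_cong) (simp add: delta.rep_eq cinner_complex_def)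
  also have "\<dots> = (\<Sum>\<^sub>\<infinity>j\<in>{i}. l2_nth x i)"
    by (intro infsum_cong_neutral) auto
  finally show ?thesis by simp
qed

text \<open>Coordinate i of the adjoint of S - T at y is the inner product of the image of
  \<open>delta i\<close> with y, so the adjoint vanishes, and with it S - T. This makes
  \<open>Lambda\<close> well defined by its values on basis vectors.\<close>

lemma bounded_ops_eq_if_eq_on_delta:
  assumes "S \<in> bounded_ops" "T \<in> bounded_ops"
    and "\<And>i. blinfun_apply S (delta i) = blinfun_apply T (delta i)"
  shows "S = T"
proof -
  have R: "S - T \<in> bounded_ops" using assms by (simp add: bounded_ops_diff)
  have "cinner (blinfun_apply (S - T) (delta i)) y = 0" for i y
    by (simp add: blinfun.diff_left assms(3))
  then have 0: "blinfun_apply (adj_op (S - T)) y = 0" for y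
    unfolding cinner_adj_op(1)[OF R] cinner_delta by (intro l2_eqI) simp
  have "blinfun_apply (S - T) x = 0" for x
    by (rule cinner_eq_zero_imp_zero) (simp add: cinner_adj_op(1)[OF R] 0)
  then show ?thesis by (metis blinfun_eqI eq_iff_diff_eq_0 zero_blinfun.rep_eq)
qed


subsection \<open>Scalar matrices acting on vector-valued families\<close>

text \<open>Gram-Schmidt: the new vector contributes its normalised residual \<zeta>, unless that is
  zero. It reduces statements about H-valued families to scalar coordinates.\<close>

lemma finite_orthonormal_expansion:
  fixes \<eta> :: "'k \<Rightarrow> 'h::complex_hilbert_space"
  assumes "finite K"
  shows "\<exists>B. finite B \<and> (\<forall>b\<in>B. \<forall>b'\<in>B. cinner b b' = (if b = b' then 1 else 0)) \<and>
    (\<forall>k\<in>K. \<eta> k = (\<Sum>b\<in>B. cinner b (\<eta> k) *\<^sub>C b))"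
  using assms
proof induction
  case empty
  show ?case by (rule exI[of _ "{}"]) simp
next
  case (insert k K)
  then obtain B where B: "finite B" "\<And>b b'. b \<in> B \<Longrightarrow> b' \<in> B \<Longrightarrow> cinner b b' = (if b = b' then 1 else 0)"
    "\<And>k. k \<in> K \<Longrightarrow> \<eta> k = (\<Sum>b\<in>B. cinner b (\<eta> k) *\<^sub>C b)" by blast
  define \<zeta> where "\<zeta> = \<eta> k - (\<Sum>b\<in>B. cinner b (\<eta> k) *\<^sub>C b)"
  show ?case
  proof (cases "\<zeta> = 0")
    case True
    then show ?thesis using B by (intro exI[of _ B]) (auto simp: \<zeta>_def)
  next
    case False
    have orth: "cinner b \<zeta> = 0" if b: "b \<in> B" for b
    proof -
      have "(\<Sum>b'\<in>B. cinner b' (\<eta> k) * cinner b b') = (\<Sum>b'\<in>B. if b = b' then cinner b' (\<eta> k) else 0)"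
        using B(2) b by (intro sum.cong) auto
      then show ?thesis
        using b B(1) by (simp add: \<zeta>_def cinner_diff_right cinner_sum_right cinner_scaleC_right)
    qed
    define e where "e = of_real (1 / norm \<zeta>) *\<^sub>C \<zeta>"
    have orthe: "cinner b e = 0" "cinner e b = 0" if "b \<in> B" for b
      using orth[OF that] cinner_commute[of \<zeta> b]
      by (simp_all add: e_def cinner_scaleC_right cinner_scaleC_left)
    have ee: "cinner e e = 1" unfolding cinner_self using False by (simp add: e_def norm_scaleC norm_divide)
    have eB: "e \<notin> B" using orthe ee by force
    have "\<zeta> = of_real (norm \<zeta>) *\<^sub>C e" using False by (simp add: e_def scaleC_scaleC)
    moreover have "cinner e \<zeta> = of_real (norm \<zeta>)"
      using False by (simp add: e_def cinner_scaleC_left cinner_self power2_eq_square)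
    moreover have "cinner e (\<eta> k) = cinner e \<zeta>"
      by (simp add: \<zeta>_def cinner_diff_right cinner_sum_right cinner_scaleC_right orthe)
    ultimately have k: "\<eta> k = cinner e (\<eta> k) *\<^sub>C e + (\<Sum>b\<in>B. cinner b (\<eta> k) *\<^sub>C b)"
      by (simp add: \<zeta>_def)
    have K: "cinner e (\<eta> j) = 0" if "j \<in> K" for j
      by (subst B(3)[OF that]) (simp add: cinner_sum_right cinner_scaleC_right orthe)
    show ?thesis
    proof (intro exI[of _ "insert e B"] conjI ballI)
      show "cinner b b' = (if b = b' then 1 else 0)" if "b \<in> insert e B" "b' \<in> insert e B" for b b'
        using that B(2) ee orthe eB by auto
      show "\<eta> j = (\<Sum>b\<in>insert e B. cinner b (\<eta> j) *\<^sub>C b)" if "j \<in> insert k K" for j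
        using that k K B(3) B(1) eB by auto
    qed (use B(1) in simp)
  qed
qed

text \<open>M tensored with the identity of H has the bound of M: the vectors \<eta> k lie in a
  finite-dimensional space, the hypothesis applies to each coordinate in an orthonormal basis of it,
  and Parseval adds the coordinates up.\<close>

lemma scalar_matrix_ampliation:
  fixes \<eta> :: "'k \<Rightarrow> 'h::complex_hilbert_space" and M :: "'r \<Rightarrow> 'k \<Rightarrow> complex"
  assumes K: "finite K"
    and M: "\<And>z. (\<Sum>r\<in>R. (cmod (\<Sum>k\<in>K. M r k * z k))\<^sup>2) \<le> C * (\<Sum>k\<in>K. (cmod (z k))\<^sup>2)"
  shows "(\<Sum>r\<in>R. (norm (\<Sum>k\<in>K. M r k *\<^sub>C \<eta> k))\<^sup>2) \<le> C * (\<Sum>k\<in>K. (norm (\<eta> k))\<^sup>2)"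
proof -
  obtain B where B: "finite B" "\<And>b b'. b \<in> B \<Longrightarrow> b' \<in> B \<Longrightarrow> cinner b b' = (if b = b' then 1 else 0)"
    "\<And>k. k \<in> K \<Longrightarrow> \<eta> k = (\<Sum>b\<in>B. cinner b (\<eta> k) *\<^sub>C b)"
    using finite_orthonormal_expansion[OF K, of \<eta>] by blast
  have parseval: "(norm (\<Sum>b\<in>B. a b *\<^sub>C b))\<^sup>2 = (\<Sum>b\<in>B. (cmod (a b))\<^sup>2)" for a
  proof -
    have "complex_of_real ((norm (\<Sum>b\<in>B. a b *\<^sub>C b))\<^sup>2)
        = (\<Sum>b\<in>B. cnj (a b) * (\<Sum>b'\<in>B. a b' * cinner b b'))"
      unfolding norm_power2_eq_cinner
      by (subst cinner_sum_left, intro sum.cong refl)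
        (simp add: cinner_sum_right cinner_scaleC_left cinner_scaleC_right sum_distrib_left ac_simps)
    also have "\<dots> = (\<Sum>b\<in>B. cnj (a b) * a b)"
    proof (intro sum.cong refl arg_cong2[where f = "(*)"])
      fix b assume b: "b \<in> B"
      have "(\<Sum>b'\<in>B. a b' * cinner b b') = (\<Sum>b'\<in>B. if b = b' then a b' else 0)"
        using B(2) b by (intro sum.cong) auto
      then show "(\<Sum>b'\<in>B. a b' * cinner b b') = a b" using b B(1) by simp
    qed
    also have "\<dots> = complex_of_real (\<Sum>b\<in>B. (cmod (a b))\<^sup>2)"
      unfolding of_real_sum
      by (intro sum.cong refl) (metis complex_norm_square mult.commute of_real_power)
    finally show ?thesis by (simp only: of_real_eq_iff)
  qed
  have "(\<Sum>k\<in>K. M r k *\<^sub>C \<eta> k) = (\<Sum>b\<in>B. (\<Sum>k\<in>K. M r k * cinner b (\<eta> k)) *\<^sub>C b)" for r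
  proof -
    have "(\<Sum>k\<in>K. M r k *\<^sub>C \<eta> k) = (\<Sum>k\<in>K. \<Sum>b\<in>B. (M r k * cinner b (\<eta> k)) *\<^sub>C b)"
    proof (intro sum.cong refl)
      fix k assume "k \<in> K"
      from B(3)[OF this] have "M r k *\<^sub>C \<eta> k = M r k *\<^sub>C (\<Sum>b\<in>B. cinner b (\<eta> k) *\<^sub>C b)" by simp
      then show "M r k *\<^sub>C \<eta> k = (\<Sum>b\<in>B. (M r k * cinner b (\<eta> k)) *\<^sub>C b)"
        by (simp add: scaleC_sum_right scaleC_scaleC)
    qed
    also have "\<dots> = (\<Sum>b\<in>B. (\<Sum>k\<in>K. M r k * cinner b (\<eta> k)) *\<^sub>C b)"
      by (subst sum.swap) (simp add: scaleC_sum_left)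
    finally show ?thesis .
  qed
  then have "(\<Sum>r\<in>R. (norm (\<Sum>k\<in>K. M r k *\<^sub>C \<eta> k))\<^sup>2)
      = (\<Sum>b\<in>B. \<Sum>r\<in>R. (cmod (\<Sum>k\<in>K. M r k * cinner b (\<eta> k)))\<^sup>2)"
    by (subst sum.swap) (simp add: parseval)
  also have "\<dots> \<le> (\<Sum>b\<in>B. C * (\<Sum>k\<in>K. (cmod (cinner b (\<eta> k)))\<^sup>2))"
    by (intro sum_mono M)
  also have "\<dots> = C * (\<Sum>k\<in>K. \<Sum>b\<in>B. (cmod (cinner b (\<eta> k)))\<^sup>2)"
    by (subst sum.swap) (simp add: sum_distrib_left)
  also have "\<dots> = C * (\<Sum>k\<in>K. (norm (\<eta> k))\<^sup>2)"
    using parseval[symmetric] B(3)[symmetric] by simp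
  finally show ?thesis .
qed

section \<open>Inverse semigroups and the universal group\<close>

context inverse_semigroup_0
begin

lemma star_props: "s * s\<^sup>\<star> * s = s" "s\<^sup>\<star> * s * s\<^sup>\<star> = s\<^sup>\<star>"
  using theI'[OF ex1_inverse[of s]] unfolding star_def[symmetric] by auto

lemma star_assoc_props: "s * (s\<^sup>\<star> * s) = s" "s\<^sup>\<star> * (s * s\<^sup>\<star>) = s\<^sup>\<star>"
  "s * (s\<^sup>\<star> * (s * t)) = s * t" "s\<^sup>\<star> * (s * (s\<^sup>\<star> * t)) = s\<^sup>\<star> * t"
  using star_props by (simp_all add: mult.assoc[symmetric])

lemma star_unique: "s * t * s = s \<Longrightarrow> t * s * t = t \<Longrightarrow> s\<^sup>\<star> = t"
  unfolding star_def using ex1_inverse[of s] by (intro the1_equality) auto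

lemma star_star [simp]: "(s\<^sup>\<star>)\<^sup>\<star> = s"
  by (rule star_unique) (rule star_props)+

lemma star_zero [simp]: "0\<^sup>\<star> = 0"
  by (rule star_unique) simp_all

lemma star_eq_0_iff [simp]: "s\<^sup>\<star> = 0 \<longleftrightarrow> s = 0"
  by (metis star_star star_zero)

lemma idempotentsD: "e \<in> idempotents \<Longrightarrow> e * e = e" "e \<in> idempotents \<Longrightarrow> e * (e * t) = e * t"
  by (simp_all add: idempotents_def mult.assoc[symmetric])

lemma idempotentsI: "e * e = e \<Longrightarrow> e \<in> idempotents"
  by (simp add: idempotents_def)

lemma idempotent_star: "e \<in> idempotents \<Longrightarrow> e\<^sup>\<star> = e"
  by (intro star_unique) (simp_all add: idempotentsD)

text \<open>The inverse \<open>x\<close> of \<open>ef\<close> equals \<open>fxe\<close> and is thus idempotent, hence so is \<open>ef\<close>.\<close>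

lemma idempotents_mult:
  assumes "e \<in> idempotents" "f \<in> idempotents" shows "e * f \<in> idempotents"
proof -
  define x where "x = (e * f)\<^sup>\<star>"
  note x = star_assoc_props[of "e * f", folded x_def, simplified mult.assoc]
  have "(e * f)\<^sup>\<star> = f * x * e"
    by (rule star_unique) (use x in \<open>simp_all add: mult.assoc idempotentsD assms\<close>)
  then have fxe: "x = f * x * e" by (simp add: x_def)
  have "x * x = f * (x * (e * (f * x))) * e" by (subst (1 2) fxe) (simp add: mult.assoc)
  also have "\<dots> = x" using x fxe by simp
  finally have "x \<in> idempotents" by (rule idempotentsI)
  then show ?thesis using idempotent_star[of x] by (metis star_star x_def)
qed

text \<open>ef and fe are idempotent and inverse to each other; as an idempotent ef is also its own
  inverse, so uniqueness of inverses identifies them.\<close>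

lemma idempotents_commute:
  assumes "e \<in> idempotents" "f \<in> idempotents" shows "e * f = f * e"
proof -
  note ef = idempotents_mult[OF assms] and fe = idempotents_mult[OF assms(2,1)]
  have "(e * f)\<^sup>\<star> = f * e"
    by (rule star_unique)
      (use idempotentsD(1)[OF ef] idempotentsD(1)[OF fe] in
        \<open>simp_all add: mult.assoc idempotentsD assms\<close>)
  then show ?thesis using idempotent_star[OF ef] by simp
qed

lemma star_mult_idempotent [simp]: "s\<^sup>\<star> * s \<in> idempotents" "s * s\<^sup>\<star> \<in> idempotents"
  by (simp_all add: idempotents_def star_assoc_props mult.assoc)

lemma zero_idempotent [simp]: "0 \<in> idempotents"
  by (simp add: idempotents_def)

text \<open>Both inverse laws come from commuting the idempotents \<open>t * t\<^sup>\<star>\<close>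
  and \<open>s\<^sup>\<star> * s\<close> in the middle.\<close>

lemma star_mult: "(s * t)\<^sup>\<star> = t\<^sup>\<star> * s\<^sup>\<star>"
proof (rule star_unique)
  have c: "(t * t\<^sup>\<star>) * (s\<^sup>\<star> * s) = (s\<^sup>\<star> * s) * (t * t\<^sup>\<star>)" by (rule idempotents_commute) simp_all
  have "s * t * (t\<^sup>\<star> * s\<^sup>\<star>) * (s * t) = s * ((t * t\<^sup>\<star>) * (s\<^sup>\<star> * s)) * t" by (simp add: mult.assoc)
  also have "\<dots> = s * t" unfolding c by (simp add: mult.assoc star_assoc_props)
  finally show "s * t * (t\<^sup>\<star> * s\<^sup>\<star>) * (s * t) = s * t" .
  have "t\<^sup>\<star> * s\<^sup>\<star> * (s * t) * (t\<^sup>\<star> * s\<^sup>\<star>) = t\<^sup>\<star> * ((s\<^sup>\<star> * s) * (t * t\<^sup>\<star>)) * s\<^sup>\<star>" by (simp add: mult.assoc)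
  also have "\<dots> = t\<^sup>\<star> * s\<^sup>\<star>" unfolding c[symmetric] by (simp add: mult.assoc star_assoc_props)
  finally show "t\<^sup>\<star> * s\<^sup>\<star> * (s * t) * (t\<^sup>\<star> * s\<^sup>\<star>) = t\<^sup>\<star> * s\<^sup>\<star>" .
qed

text \<open>\<open>s * s\<^sup>\<star> * r = r\<close> says that r lies in the range of s acting
  from the left, with preimage \<open>s\<^sup>\<star> * r\<close>. The range of st thus consists of
  the r in the range of s whose preimage is in the range of t; this underlies the product rules of
  both families.\<close>

lemma range_mult_iff:
  "(s * t) * (s * t)\<^sup>\<star> * r = r \<longleftrightarrow> s * s\<^sup>\<star> * r = r \<and> t * t\<^sup>\<star> * (s\<^sup>\<star> * r) = s\<^sup>\<star> * r"
proof
  assume r: "(s * t) * (s * t)\<^sup>\<star> * r = r"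
  have "s * s\<^sup>\<star> * r = s * s\<^sup>\<star> * ((s * t) * (s * t)\<^sup>\<star> * r)" using r by simp
  also have "\<dots> = (s * t) * (s * t)\<^sup>\<star> * r" by (simp add: mult.assoc star_assoc_props)
  finally have sr: "s * s\<^sup>\<star> * r = r" using r by simp
  have comm: "(t * t\<^sup>\<star>) * (s\<^sup>\<star> * s) = (s\<^sup>\<star> * s) * (t * t\<^sup>\<star>)" by (rule idempotents_commute) simp_all
  have "s\<^sup>\<star> * r = s\<^sup>\<star> * ((s * t) * (s * t)\<^sup>\<star> * r)" using r by simp
  also have "\<dots> = ((s\<^sup>\<star> * s) * (t * t\<^sup>\<star>)) * (s\<^sup>\<star> * r)" by (simp add: star_mult mult.assoc)
  also have "\<dots> = (t * t\<^sup>\<star>) * (s\<^sup>\<star> * r)"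
    unfolding comm[symmetric] by (simp add: mult.assoc star_assoc_props)
  finally show "s * s\<^sup>\<star> * r = r \<and> t * t\<^sup>\<star> * (s\<^sup>\<star> * r) = s\<^sup>\<star> * r" using sr by simp
next
  assume r: "s * s\<^sup>\<star> * r = r \<and> t * t\<^sup>\<star> * (s\<^sup>\<star> * r) = s\<^sup>\<star> * r"
  have "(s * t) * (s * t)\<^sup>\<star> * r = s * (t * t\<^sup>\<star> * (s\<^sup>\<star> * r))" by (simp add: star_mult mult.assoc)
  also have "\<dots> = r" using r by (metis mult.assoc)
  finally show "(s * t) * (s * t)\<^sup>\<star> * r = r" .
qed

lemma conj_idempotent:
  assumes "e \<in> idempotents" shows "s\<^sup>\<star> * e * s \<in> idempotents"
proof -
  have "s\<^sup>\<star> * e * s = (e * s)\<^sup>\<star> * (e * s)"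
    by (simp add: star_mult idempotent_star assms mult.assoc idempotentsD)
  then show ?thesis by simp
qed

lemma idempotent_mult_right:
  assumes "e \<in> idempotents" shows "e * s = s * (s\<^sup>\<star> * e * s)"
  using idempotents_commute[OF assms, of "s * s\<^sup>\<star>"]
  by (metis mult.assoc star_mult_idempotent(2) star_props(1))

end

section \<open>Partial homomorphisms and the consequences of purity\<close>

lemma partial_hom_idempotent:
  assumes "partial_hom \<phi>" "e \<in> idempotents" "e \<noteq> 0" shows "\<phi> e = 0"
proof -
  have "\<phi> e + 0 = \<phi> e + \<phi> e" using assms by (metis add_0_right idempotentsD(1) partial_hom_def)
  then show ?thesis by (metis add_left_imp_eq)
qed

lemma univ_map_mult: "s * t \<noteq> 0 \<Longrightarrow> univ_map (s * t) = univ_map s + univ_map t"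
proof transfer
  fix s t :: 'a assume st: "s * t \<noteq> 0"
  then have "s \<noteq> 0" "t \<noteq> 0" by auto
  with st univ_rel.sym[OF univ_rel.relation[OF st]]
  show "univ_rel (if s * t = 0 then [] else [(s * t, True)])
      ((if s = 0 then [] else [(s, True)]) @ (if t = 0 then [] else [(t, True)]))" by simp
qed

lemma partial_hom_univ_map: "partial_hom univ_map"
  by (simp add: partial_hom_def univ_map_mult)

lemma univ_map_star:
  assumes "s \<noteq> 0" shows "univ_map (s\<^sup>\<star>) = - univ_map s"
proof -
  have "s\<^sup>\<star> * s \<noteq> 0" using assms star_props(1)[of s] by (metis mult.assoc mult_zero_right)
  then have "univ_map (s\<^sup>\<star>) + univ_map s = 0"
    using univ_map_mult[of "s\<^sup>\<star>" s] partial_hom_idempotent[OF partial_hom_univ_map, of "s\<^sup>\<star> * s"] by simp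
  then show ?thesis by (simp add: eq_neg_iff_add_eq_0)
qed

fun word_value :: "('s \<Rightarrow> 'g::group_add) \<Rightarrow> ('s \<times> bool) list \<Rightarrow> 'g" where
  "word_value \<phi> [] = 0"
| "word_value \<phi> ((s, b) # w) = (if b then \<phi> s else - \<phi> s) + word_value \<phi> w"

lemma word_value_append: "word_value \<phi> (u @ v) = word_value \<phi> u + word_value \<phi> v"
  by (induction \<phi> u rule: word_value.induct) (simp_all add: add.assoc)

text \<open>Every partial homomorphism respects the relations of the universal group, so evaluation
  of words descends to it.\<close>

lemma word_value_univ_rel:
  assumes "univ_rel u v" "partial_hom \<phi>" shows "word_value \<phi> u = word_value \<phi> v"
  using assms by induction (auto simp: word_value_append partial_hom_def)

text \<open>\<phi> factors through \<open>univ_map\<close>, so an element that is trivial in the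
  universal group is trivial under \<phi>.\<close>

lemma idempotent_pure_univ_map:
  fixes \<phi> :: "'s::inverse_semigroup_0 \<Rightarrow> 'g::group_add"
  assumes "partial_hom \<phi>" "idempotent_pure \<phi>"
  shows "idempotent_pure (univ_map :: 's \<Rightarrow> 's univ_group)"
proof -
  have "s \<in> idempotents" if s: "s \<noteq> 0" and 0: "univ_map s = 0" for s :: 's
  proof -
    from 0 s have "univ_rel [(s, True)] []" by transfer simp
    from word_value_univ_rel[OF this assms(1)] have "\<phi> s = 0" by simp
    then show ?thesis using s assms(2) by (auto simp: idempotent_pure_def)
  qed
  then show ?thesis unfolding idempotent_pure_def
    using partial_hom_idempotent[OF partial_hom_univ_map] by auto
qed

locale pure_semigroup =
  fixes S :: "'s::inverse_semigroup_0 itself"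
  assumes pure: "idempotent_pure (univ_map :: 's \<Rightarrow> 's univ_group)"
begin

lemma univ_map_eq_0D: "s \<noteq> 0 \<Longrightarrow> univ_map s = 0 \<Longrightarrow> s \<in> idempotents" for s :: 's
  using pure by (auto simp: idempotent_pure_def)

text \<open>Let e be \<open>s * t\<^sup>\<star>\<close>. Then e t = s, so e is non-zero and trivial
  in the group, hence idempotent and self-adjoint. Therefore t = t s* s = e s = e e t = e t =
  s.\<close>

lemma univ_map_inj:
  fixes s t :: 's
  assumes "s \<noteq> 0" "t \<noteq> 0" "univ_map s = univ_map t" "s\<^sup>\<star> * s = t\<^sup>\<star> * t"
  shows "s = t"
proof -
  have st: "s * t\<^sup>\<star> * t = s" using assms(4) by (metis mult.assoc star_props(1))
  then have "s * t\<^sup>\<star> \<noteq> 0" using assms(1) by auto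
  then have "univ_map (s * t\<^sup>\<star>) = 0"
    using univ_map_mult[of s "t\<^sup>\<star>"] univ_map_star[OF assms(2)] assms(3) by simp
  with \<open>s * t\<^sup>\<star> \<noteq> 0\<close> have E: "s * t\<^sup>\<star> \<in> idempotents" by (rule univ_map_eq_0D)
  have "s = s * t\<^sup>\<star> * (s * t\<^sup>\<star>) * t" using E st by (simp add: idempotentsD)
  have 1: "s * t\<^sup>\<star> = t * s\<^sup>\<star>" using idempotent_star[OF E] by (simp add: star_mult)
  have "t = t * (s\<^sup>\<star> * s)" using assms(4) by (simp add: star_assoc_props)
  also have "\<dots> = s * t\<^sup>\<star> * s" by (simp add: 1 mult.assoc)
  also have "\<dots> = (s * t\<^sup>\<star>) * (s * t\<^sup>\<star>) * t" by (simp add: mult.assoc st[unfolded mult.assoc])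
  also have "\<dots> = s" using E st by (simp add: idempotentsD)
  finally show ?thesis by simp
qed

end

section \<open>Functions vanishing at infinity\<close>

lemma C0D:
  assumes "f \<in> C0 X"
  shows "continuous_map X euclidean f" "0 < \<epsilon> \<Longrightarrow> compactin X {x \<in> topspace X. \<epsilon> \<le> cmod (f x)}"
    "x \<notin> topspace X \<Longrightarrow> f x = 0"
  using assms by (auto simp: C0_def)

text \<open>Superlevel sets of a continuous function are closed, so it is enough to enclose each of
  them in a compact set.\<close>

lemma C0I:
  assumes cont: "continuous_map X euclidean f"
    and comp: "\<And>\<epsilon>. 0 < \<epsilon> \<Longrightarrow> \<exists>K. compactin X K \<and> (\<forall>x\<in>topspace X - K. cmod (f x) < \<epsilon>)"
    and zero: "\<And>x. x \<notin> topspace X \<Longrightarrow> f x = 0"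
  shows "f \<in> C0 X"
proof -
  have "compactin X {x \<in> topspace X. \<epsilon> \<le> cmod (f x)}" if "0 < \<epsilon>" for \<epsilon>
  proof -
    from comp[OF that] obtain K where K: "compactin X K" "\<forall>x\<in>topspace X - K. cmod (f x) < \<epsilon>" by blast
    have "continuous_map X euclidean (\<lambda>x. cmod (f x))"
      using continuous_map_compose[OF cont, of euclidean norm] by (simp add: comp_def continuous_on_norm_id)
    from closedin_continuous_map_preimage[OF this, of "{\<epsilon>..}"]
    have cl: "closedin X {x \<in> topspace X. \<epsilon> \<le> cmod (f x)}" by simp
    show ?thesis
      by (rule closed_compactin[OF K(1) _ cl]) (use K(2) in force)
  qed
  then show ?thesis using cont zero by (simp add: C0_def)
qed

lemma C0_bounded:
  assumes "f \<in> C0 X" obtains B where "0 \<le> B" "\<And>x. cmod (f x) \<le> B"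
proof -
  let ?K = "{x \<in> topspace X. 1 \<le> cmod (f x)}"
  have "compact (f ` ?K)"
    using image_compactin[OF C0D(2)[OF assms] C0D(1)[OF assms], of 1] by simp
  then obtain B where B: "\<And>y. y \<in> f ` ?K \<Longrightarrow> norm y \<le> B"
    using compact_imp_bounded bounded_iff by metis
  have "cmod (f x) \<le> max 1 B" for x
    using B[of "f x"] C0D(3)[OF assms, of x] by (cases "x \<in> topspace X"; cases "1 \<le> cmod (f x)") auto
  then show ?thesis using that[of "max 1 B"] by simp
qed

lemma C0_bdd_above: "f \<in> C0 X \<Longrightarrow> bdd_above (range (\<lambda>x. cmod (f x)))"
  by (metis C0_bounded bdd_aboveI2)

lemma C0_zero: "(\<lambda>_. 0) \<in> C0 X"
  by (rule C0I) (auto intro: exI[of _ "{}"])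

lemma C0_comp:
  assumes f: "f \<in> C0 X" and h: "continuous_on UNIV h" "\<And>z. cmod (h z) \<le> B * cmod z"
  shows "(\<lambda>x. h (f x)) \<in> C0 X"
proof (rule C0I)
  show "continuous_map X euclidean (\<lambda>x. h (f x))"
    using continuous_map_compose[OF C0D(1)[OF f], of euclidean h] h(1) by (simp add: comp_def)
  have h0: "h 0 = 0" using h(2)[of 0] by simp
  then show "h (f x) = 0" if "x \<notin> topspace X" for x using C0D(3)[OF f that] by simp
  fix \<epsilon> :: real assume e: "0 < \<epsilon>"
  show "\<exists>K. compactin X K \<and> (\<forall>x\<in>topspace X - K. cmod (h (f x)) < \<epsilon>)"
  proof (intro exI conjI ballI)
    have pos: "0 < \<epsilon> / (\<bar>B\<bar> + 1)" using e by simp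
    show "compactin X {x \<in> topspace X. \<epsilon> / (\<bar>B\<bar> + 1) \<le> cmod (f x)}" by (rule C0D(2)[OF f pos])
    fix x assume "x \<in> topspace X - {x \<in> topspace X. \<epsilon> / (\<bar>B\<bar> + 1) \<le> cmod (f x)}"
    then have "cmod (f x) * (\<bar>B\<bar> + 1) < \<epsilon>" by (simp add: not_le pos_less_divide_eq)
    moreover have "cmod (h (f x)) \<le> cmod (f x) * (\<bar>B\<bar> + 1)"
    proof -
      have "B * cmod (f x) \<le> (\<bar>B\<bar> + 1) * cmod (f x)" by (intro mult_right_mono) auto
      then show ?thesis using h(2)[of "f x"] by (simp add: mult.commute)
    qed
    ultimately show "cmod (h (f x)) < \<epsilon>" by linarith
  qed
qed

lemma C0_scale: "f \<in> C0 X \<Longrightarrow> (\<lambda>x. c * f x) \<in> C0 X"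
  by (rule C0_comp[where B = "cmod c"]) (auto simp: norm_mult intro!: continuous_intros)

lemma C0_cnj: "f \<in> C0 X \<Longrightarrow> (\<lambda>x. cnj (f x)) \<in> C0 X"
  by (rule C0_comp[where B = 1]) (auto intro!: continuous_intros)

lemma C0_add:
  assumes "f \<in> C0 X" "g \<in> C0 X" shows "(\<lambda>x. f x + g x) \<in> C0 X"
proof (rule C0I)
  show "continuous_map X euclidean (\<lambda>x. f x + g x)"
    using C0D(1) assms by (intro continuous_map_add)
  fix \<epsilon> :: real assume e: "0 < \<epsilon>"
  show "\<exists>K. compactin X K \<and> (\<forall>x\<in>topspace X - K. cmod (f x + g x) < \<epsilon>)"
  proof (intro exI conjI ballI)
    show "compactin X ({x \<in> topspace X. \<epsilon>/2 \<le> cmod (f x)} \<union> {x \<in> topspace X. \<epsilon>/2 \<le> cmod (g x)})"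
      using e assms by (intro compactin_Un C0D(2)) auto
    fix x assume "x \<in> topspace X -
      ({x \<in> topspace X. \<epsilon>/2 \<le> cmod (f x)} \<union> {x \<in> topspace X. \<epsilon>/2 \<le> cmod (g x)})"
    then have "cmod (f x) < \<epsilon>/2" "cmod (g x) < \<epsilon>/2" by auto
    then show "cmod (f x + g x) < \<epsilon>" using norm_triangle_ineq[of "f x" "g x"] by linarith
  qed
qed (simp add: C0D(3)[OF assms(1)] C0D(3)[OF assms(2)])

lemma C0_diff:
  assumes "f \<in> C0 X" "g \<in> C0 X" shows "(\<lambda>x. f x - g x) \<in> C0 X"
  using C0_add[OF assms(1) C0_scale[OF assms(2), of "-1"]] by simp

lemma C0_mult:
  assumes f: "f \<in> C0 X" and g: "g \<in> C0 X" shows "(\<lambda>x. f x * g x) \<in> C0 X"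
proof (rule C0I)
  show "continuous_map X euclidean (\<lambda>x. f x * g x)"
    using C0D(1) assms unfolding continuous_map_atin by (auto intro: tendsto_mult)
  obtain B where B: "0 \<le> B" "\<And>x. cmod (g x) \<le> B" using C0_bounded[OF g] by blast
  fix \<epsilon> :: real assume e: "0 < \<epsilon>"
  have pos: "0 < \<epsilon> / (B + 1)" using e B by simp
  show "\<exists>K. compactin X K \<and> (\<forall>x\<in>topspace X - K. cmod (f x * g x) < \<epsilon>)"
  proof (intro exI conjI ballI)
    show "compactin X {x \<in> topspace X. \<epsilon> / (B + 1) \<le> cmod (f x)}" by (rule C0D(2)[OF f pos])
    fix x assume "x \<in> topspace X - {x \<in> topspace X. \<epsilon> / (B + 1) \<le> cmod (f x)}"
    then have "cmod (f x) * (B + 1) < \<epsilon>" using B by (simp add: not_le pos_less_divide_eq)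
    moreover have "cmod (f x * g x) \<le> cmod (f x) * (B + 1)"
      unfolding norm_mult using B(2)[of x] by (intro mult_left_mono) auto
    ultimately show "cmod (f x * g x) < \<epsilon>" by linarith
  qed
qed (use C0D(3) assms in auto)

lemma C0_uniform_limit:
  assumes "\<And>\<epsilon>. 0 < \<epsilon> \<Longrightarrow> \<exists>g\<in>C0 X. \<forall>x. cmod (f x - g x) < \<epsilon>"
  shows "f \<in> C0 X"
proof (rule C0I)
  have "\<exists>g. g \<in> C0 X \<and> (\<forall>x. cmod (f x - g x) < inverse (real (Suc n)))" for n
    using assms[of "inverse (real (Suc n))"] by auto
  then obtain g where g: "\<And>n. g n \<in> C0 X" "\<And>n x. cmod (f x - g n x) < inverse (real (Suc n))"
    by metis
  have cont: "continuous_map X euclidean (g n)" for n by (rule C0D(1)[OF g(1)])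
  have lim: "\<forall>\<^sub>F n in sequentially. \<forall>x\<in>topspace X. dist (g n x) (f x) < \<epsilon>" if "0 < \<epsilon>" for \<epsilon>
  proof -
    obtain N where "inverse (real (Suc N)) < \<epsilon>" using reals_Archimedean[OF \<open>0 < \<epsilon>\<close>] by blast
    then have *: "inverse (real (Suc n)) < \<epsilon>" if "N \<le> n" for n
      by (rule le_less_trans[rotated]) (use that in simp)
    have "dist (g n x) (f x) < \<epsilon>" if "N \<le> n" for n x
      using less_trans[OF g(2)[of x n] *[OF that]] by (simp add: dist_norm norm_minus_commute)
    then show ?thesis by (auto simp: eventually_sequentially)
  qed
  show "continuous_map X euclidean f"
    by (rule Met_TC.continuous_map_uniform_limit[simplified, where f = g and F = sequentially])
      (use cont lim in \<open>auto intro: always_eventually\<close>)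
  show "f x = 0" if "x \<notin> topspace X" for x
  proof -
    have "cmod (f x) < \<epsilon>" if "0 < \<epsilon>" for \<epsilon>
    proof -
      obtain g where "g \<in> C0 X" "cmod (f x - g x) < \<epsilon>" using assms[OF \<open>0 < \<epsilon>\<close>] by blast
      then show ?thesis using C0D(3)[OF _ \<open>x \<notin> topspace X\<close>, of g] by simp
    qed
    then show ?thesis by (metis less_irrefl zero_less_norm_iff)
  qed
  fix \<epsilon> :: real assume e: "0 < \<epsilon>"
  then obtain g where g: "g \<in> C0 X" "\<And>x. cmod (f x - g x) < \<epsilon>/2" using assms[of "\<epsilon>/2"] by auto
  show "\<exists>K. compactin X K \<and> (\<forall>x\<in>topspace X - K. cmod (f x) < \<epsilon>)"
  proof (intro exI conjI ballI)
    show "compactin X {x \<in> topspace X. \<epsilon>/2 \<le> cmod (g x)}" using e by (intro C0D(2)[OF g(1)]) simp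
    fix x assume "x \<in> topspace X - {x \<in> topspace X. \<epsilon>/2 \<le> cmod (g x)}"
    then have "cmod (g x) < \<epsilon>/2" by auto
    then show "cmod (f x) < \<epsilon>" using g(2)[of x] norm_triangle_sub[of "f x" "g x"] by linarith
  qed
qed

text \<open>These are the sets whose indicators are projections in \<open>C0 X\<close>. Closedness
  is part of the definition since X carries no separation axiom here.\<close>

definition compact_open :: "'x topology \<Rightarrow> 'x set \<Rightarrow> bool" where
  "compact_open X A \<longleftrightarrow> openin X A \<and> closedin X A \<and> compactin X A"

lemma compact_open_subset: "compact_open X A \<Longrightarrow> A \<subseteq> topspace X"
  by (auto simp: compact_open_def openin_subset)

lemma compact_open_empty: "compact_open X {}"
  by (simp add: compact_open_def)

lemma compact_open_Un: "compact_open X A \<Longrightarrow> compact_open X B \<Longrightarrow> compact_open X (A \<union> B)"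
  by (auto simp: compact_open_def intro: compactin_Un)

lemma compact_open_Int: "compact_open X A \<Longrightarrow> compact_open X B \<Longrightarrow> compact_open X (A \<inter> B)"
  by (auto simp: compact_open_def intro: compact_Int_closedin)

lemma compact_open_Diff: "compact_open X A \<Longrightarrow> compact_open X B \<Longrightarrow> compact_open X (A - B)"
  by (auto simp: compact_open_def intro: openin_diff closedin_diff closed_compactin[of X A])

lemma compact_open_UN:
  "finite I \<Longrightarrow> (\<And>i. i \<in> I \<Longrightarrow> compact_open X (A i)) \<Longrightarrow> compact_open X (\<Union>i\<in>I. A i)"
  by (induction I rule: finite_induct) (auto intro: compact_open_Un compact_open_empty)

lemma indicator_C0:
  assumes "compact_open X A" shows "indicator A \<in> C0 X"
proof (rule C0I)
  have "openin X {x \<in> topspace X. indicator A x \<in> U}" for U :: "complex set"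
  proof -
    have "{x \<in> topspace X. indicator A x \<in> U}
        = (if 1 \<in> U then A else {}) \<union> (if 0 \<in> U then topspace X - A else {})"
      using compact_open_subset[OF assms] by (auto simp: indicator_def split: if_splits)
    then show ?thesis using assms by (auto simp: compact_open_def)
  qed
  then show "continuous_map X euclidean (indicator A :: _ \<Rightarrow> complex)"
    by (simp add: continuous_map_def)
  show "\<exists>K. compactin X K \<and> (\<forall>x\<in>topspace X - K. cmod (indicator A x) < \<epsilon>)" if "0 < \<epsilon>" for \<epsilon>
    using that assms by (intro exI[of _ A]) (auto simp: compact_open_def)
qed (use compact_open_subset[OF assms] in \<open>auto simp: indicator_def\<close>)


subsection \<open>Representations\<close>

locale C0_rep =
  fixes X :: "'x topology" and \<pi> :: "('x \<Rightarrow> complex) \<Rightarrow> 'h::complex_hilbert_space \<Rightarrow>\<^sub>L 'h"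
  assumes hom: "star_hom (C0_alg X) (op_alg bounded_ops) \<pi>"
begin

lemma rep_bounded_ops: "f \<in> C0 X \<Longrightarrow> \<pi> f \<in> bounded_ops"
  and rep_add: "f \<in> C0 X \<Longrightarrow> g \<in> C0 X \<Longrightarrow> \<pi> (\<lambda>x. f x + g x) = \<pi> f + \<pi> g"
  and rep_scale: "f \<in> C0 X \<Longrightarrow> \<pi> (\<lambda>x. c * f x) = scale_op c (\<pi> f)"
  and rep_mult: "f \<in> C0 X \<Longrightarrow> g \<in> C0 X \<Longrightarrow> \<pi> (\<lambda>x. f x * g x) = \<pi> f o\<^sub>L \<pi> g"
  and rep_cnj: "f \<in> C0 X \<Longrightarrow> \<pi> (\<lambda>x. cnj (f x)) = adj_op (\<pi> f)"
  using hom unfolding star_hom_def by (simp_all add: C0_alg_def op_alg_def)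

lemma rep_zero: "\<pi> (\<lambda>_. 0) = 0"
  using rep_add[OF C0_zero C0_zero] by simp

lemma rep_diff: "f \<in> C0 X \<Longrightarrow> g \<in> C0 X \<Longrightarrow> \<pi> (\<lambda>x. f x - g x) = \<pi> f - \<pi> g"
  using rep_add[OF C0_diff[of f X g], of g] by simp

text \<open>With \<open>h = 1 - sqrt (1 - \<bar>f\<bar>\<^sup>2)\<close> one has \<open>\<bar>f\<bar>\<^sup>2 = 2h - h\<^sup>2\<close>, so that
  \<open>\<parallel>\<pi>(f)v\<parallel>\<^sup>2 = \<parallel>v\<parallel>\<^sup>2 - \<parallel>v - \<pi>(h)v\<parallel>\<^sup>2\<close>; no unit is needed.\<close>

lemma rep_contractive:
  assumes f: "f \<in> C0 X" and le: "\<And>x. cmod (f x) \<le> 1"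
  shows "norm (blinfun_apply (\<pi> f) v) \<le> norm v"
proof -
  \<comment> \<open>\<open>min 1\<close> extends the function continuously to the whole plane with
    |k z| \<le> |z|, as \<open>C0_comp\<close> requires; f takes its values in the unit disc, where
    it changes nothing.\<close>
  define k where "k z = complex_of_real (1 - sqrt (1 - (min 1 (cmod z))\<^sup>2))" for z :: complex
  define h where "h x = k (f x)" for x
  have "cmod (k z) \<le> 1 * cmod z" for z
  proof -
    define t where "t = min 1 (cmod z)"
    have t: "0 \<le> t" "t \<le> 1" "t \<le> cmod z" by (auto simp: t_def)
    then have "t\<^sup>2 \<le> 1" by (simp add: power_le_one)
    moreover have "(1 - t)\<^sup>2 \<le> 1 - t\<^sup>2"
      using mult_left_le[of t t] t by (simp add: power2_eq_square algebra_simps)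
    ultimately have "1 - t \<le> sqrt (1 - t\<^sup>2)" using t by (intro real_le_rsqrt)
    moreover have "sqrt (1 - t\<^sup>2) \<le> 1" by simp
    ultimately have "\<bar>1 - sqrt (1 - t\<^sup>2)\<bar> \<le> cmod z" using t by linarith
    then show ?thesis unfolding k_def t_def norm_of_real by simp
  qed
  then have h: "h \<in> C0 X" unfolding h_def
    by (intro C0_comp[OF f, where B = 1]) (auto simp: k_def intro!: continuous_intros)
  have hr: "cnj (h x) = h x" for x by (simp add: h_def k_def)
  have eq: "cnj (f x) * f x = 2 * h x - h x * h x" for x
  proof -
    define q where "q = sqrt (1 - (cmod (f x))\<^sup>2)"
    have hq: "h x = complex_of_real (1 - q)" unfolding h_def k_def q_def min_absorb2[OF le] ..
    have "2 * h x - h x * h x = complex_of_real (1 - q\<^sup>2)"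
      unfolding hq by (simp add: power2_eq_square algebra_simps)
    also have "q\<^sup>2 = 1 - (cmod (f x))\<^sup>2"
      unfolding q_def using le[of x] by (simp add: power_le_one)
    also have "complex_of_real (1 - (1 - (cmod (f x))\<^sup>2)) = complex_of_real ((cmod (f x))\<^sup>2)" by simp
    finally have "2 * h x - h x * h x = complex_of_real ((cmod (f x))\<^sup>2)" .
    then show ?thesis using complex_norm_square[of "f x"] by (simp add: mult.commute)
  qed
  let ?f = "blinfun_apply (\<pi> f)" and ?h = "blinfun_apply (\<pi> h)"
  have adj_h: "adj_op (\<pi> h) = \<pi> h" using rep_cnj[OF h] unfolding hr by metis
  have "(\<pi> (\<lambda>x. cnj (f x)) o\<^sub>L \<pi> f) = \<pi> (\<lambda>x. 2 * h x - h x * h x)"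
    using rep_mult[OF C0_cnj[OF f] f] eq by simp
  also have "\<dots> = scale_op 2 (\<pi> h) - (\<pi> h o\<^sub>L \<pi> h)"
    using rep_diff[OF C0_scale[OF h] C0_mult[OF h h]] rep_scale[OF h] rep_mult[OF h h] by simp
  finally have "blinfun_apply (adj_op (\<pi> f)) (?f v) = 2 *\<^sub>C ?h v - ?h (?h v)"
    unfolding rep_cnj[OF f] by (metis blinfun.diff_left blinfun_apply_blinfun_compose scale_op_apply)
  then have "cinner (?f v) (?f v) = 2 * cinner v (?h v) - cinner (?h v) (?h v)"
    using cinner_adj_op(1)[OF rep_bounded_ops[OF f], of v "?f v"]
      cinner_adj_op(1)[OF rep_bounded_ops[OF h], of v "?h v"]
    by (simp add: adj_h cinner_diff_right cinner_scaleC_right)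
  then have "Re (cinner (?f v) (?f v)) = Re (2 * cinner v (?h v) - cinner (?h v) (?h v))" by simp
  then have "(norm (?f v))\<^sup>2 = 2 * Re (cinner v (?h v)) - (norm (?h v))\<^sup>2"
    unfolding cinner_self by simp
  also have "\<dots> = (norm v)\<^sup>2 - (norm (v - ?h v))\<^sup>2" by (simp add: norm_diff_power2)
  also have "\<dots> \<le> (norm v)\<^sup>2" by simp
  finally show ?thesis by (rule power2_le_imp_le) simp
qed

lemma rep_norm_le:
  assumes f: "f \<in> C0 X" and le: "\<And>x. cmod (f x) \<le> B"
  shows "norm (blinfun_apply (\<pi> f) v) \<le> B * norm v"
proof (cases "0 < B")
  case True
  have "norm (blinfun_apply (\<pi> (\<lambda>x. of_real (1 / B) * f x)) v) \<le> norm v"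
    using True le by (intro rep_contractive C0_scale f) (simp add: norm_mult norm_divide)
  then have "norm (of_real (1 / B) *\<^sub>C blinfun_apply (\<pi> f) v) \<le> norm v"
    unfolding rep_scale[OF f] scale_op_apply .
  then show ?thesis using True by (simp add: norm_scaleC norm_divide field_simps)
next
  case False
  then have "f = (\<lambda>_. 0)" using le by (metis norm_le_zero_iff not_less order_trans ext)
  moreover have "0 \<le> B" using le norm_ge_zero order_trans by blast
  ultimately show ?thesis by (simp add: rep_zero)
qed

end

section \<open>The spectrum of the idempotents\<close>

lemma topspace_spectrum:
  "topspace spectrum = {\<phi> \<in> extensional idempotents.
     (\<forall>e\<in>idempotents. \<forall>f\<in>idempotents. \<phi> (e * f) \<longleftrightarrow> \<phi> e \<and> \<phi> f) \<and>
     (\<exists>e\<in>idempotents. \<phi> e) \<and> \<not> \<phi> 0}"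
  by (auto simp: spectrum_def PiE_UNIV_domain PiE_def)

lemma spectrum_mult:
  "x \<in> topspace spectrum \<Longrightarrow> e \<in> idempotents \<Longrightarrow> f \<in> idempotents \<Longrightarrow> x (e * f) \<longleftrightarrow> x e \<and> x f"
  and spectrum_zero: "x \<in> topspace spectrum \<Longrightarrow> \<not> x 0"
  and spectrum_nonzero: "x \<in> topspace spectrum \<Longrightarrow> \<exists>e\<in>idempotents. x e"
  and spectrum_extensional: "x \<in> topspace spectrum \<Longrightarrow> x \<in> extensional idempotents"
  by (auto simp: topspace_spectrum)

lemma Hausdorff_spectrum: "Hausdorff_space spectrum"
  unfolding spectrum_def
  by (intro Hausdorff_space_subtopology) (simp add: Hausdorff_space_product_topology)

lemma spectrum_basic_iff: "x \<in> spectrum_basic e \<longleftrightarrow> x \<in> topspace spectrum \<and> x e"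
  by (simp add: spectrum_basic_def)

lemma spectrum_basic_zero [simp]: "spectrum_basic 0 = {}"
  by (auto simp: spectrum_basic_iff spectrum_zero)

lemma spectrum_basic_mult:
  "e \<in> idempotents \<Longrightarrow> f \<in> idempotents \<Longrightarrow>
   spectrum_basic (e * f) = spectrum_basic e \<inter> spectrum_basic f"
  by (auto simp: spectrum_basic_iff spectrum_mult)

text \<open>Being non-zero is not a closed condition on homomorphisms, so the spectrum need not be
  compact. On D(e) it is implied by x(e) = 1, and what remains cuts a closed set out of a compact
  product of two-point spaces.\<close>

lemma compact_open_spectrum_basic:
  fixes e :: "'s::inverse_semigroup_0"
  assumes e: "e \<in> idempotents" shows "compact_open spectrum (spectrum_basic e)"
proof -
  let ?P = "product_topology (\<lambda>_. discrete_topology (UNIV :: bool set)) (idempotents :: 's set)"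
  have clo: "closedin ?P {\<phi> \<in> topspace ?P. \<phi> f}" "openin ?P {\<phi> \<in> topspace ?P. \<phi> f}"
    if "f \<in> idempotents" for f
  proof -
    have c: "continuous_map ?P (discrete_topology UNIV) (\<lambda>\<phi>. \<phi> f)"
      by (rule continuous_map_product_projection) (use that in simp)
    show "closedin ?P {\<phi> \<in> topspace ?P. \<phi> f}" "openin ?P {\<phi> \<in> topspace ?P. \<phi> f}"
      using closedin_continuous_map_preimage[OF c, of "{True}"]
        openin_continuous_map_preimage[OF c, of "{True}"] by simp_all
  qed
  define C where "C f g = {\<phi> \<in> topspace ?P. \<phi> (f * g) \<longleftrightarrow> \<phi> f \<and> \<phi> g}" for f g
  have C: "closedin ?P (C f g)" if "f \<in> idempotents" "g \<in> idempotents" for f g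
  proof -
    let ?A = "{\<phi> \<in> topspace ?P. \<phi> f} \<inter> {\<phi> \<in> topspace ?P. \<phi> g}"
    let ?B = "{\<phi> \<in> topspace ?P. \<phi> (f * g)}"
    have fg: "f * g \<in> idempotents" using that by (rule idempotents_mult)
    have "C f g = (?A \<inter> ?B) \<union> ((topspace ?P - ?A) \<inter> (topspace ?P - ?B))"
      by (auto simp: C_def)
    moreover have "closedin ?P ?A" "closedin ?P ?B" "openin ?P ?A" "openin ?P ?B"
      using clo that fg by auto
    ultimately show ?thesis
      by (simp only: closedin_Un closedin_Int closedin_diff closedin_topspace)
  qed
  define Z where "Z = {\<phi> \<in> topspace ?P. \<phi> e} \<inter> (topspace ?P - {\<phi> \<in> topspace ?P. \<phi> 0}) \<inter>
    (\<Inter>p\<in>idempotents \<times> idempotents. C (fst p) (snd p))"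
  have Zcl: "closedin ?P Z" unfolding Z_def
  proof (intro closedin_Int closedin_INT)
    show "closedin ?P (topspace ?P - {\<phi> \<in> topspace ?P. \<phi> 0})"
      using clo(2)[OF zero_idempotent] by (intro closedin_diff closedin_topspace)
    show "closedin ?P {\<phi> \<in> topspace ?P. \<phi> e}" by (rule clo(1)[OF e])
    show "idempotents \<times> idempotents \<noteq> ({} :: ('s \<times> 's) set)" using zero_idempotent by blast
    show "closedin ?P (C (fst p) (snd p))" if "p \<in> idempotents \<times> idempotents" for p
      using that by (intro C) auto
  qed
  have "compact_space ?P"
    by (simp add: compact_space_product_topology compact_space_discrete_topology)
  then have "compactin ?P Z" using Zcl by (simp add: closedin_compact_space)
  moreover have Zeq: "Z = spectrum_basic e"
    using e by (auto simp: Z_def C_def spectrum_basic_def topspace_spectrum PiE_UNIV_domain PiE_def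
        split: prod.splits)
  moreover have "spectrum_basic e \<subseteq> topspace spectrum" by (auto simp: spectrum_basic_def)
  ultimately have comp: "compactin spectrum (spectrum_basic e)"
    unfolding spectrum_def compactin_subtopology by (auto simp: topspace_spectrum spectrum_basic_def)
  have "openin spectrum (spectrum_basic e)"
    unfolding spectrum_def openin_subtopology
    using clo(2)[OF e] by (intro exI conjI) (auto simp: spectrum_basic_def spectrum_def)
  with comp compactin_imp_closedin[OF Hausdorff_spectrum comp] show ?thesis
    by (simp add: compact_open_def)
qed

text \<open>Multiply the elements of A with an idempotent at which x is 1; the latter, which exists
  because x is non-zero, covers the case of empty A.\<close>

lemma finite_idempotents_lower_bound:
  assumes "finite A" "A \<subseteq> idempotents" and x: "x \<in> topspace spectrum" "\<forall>a\<in>A. x a"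
  shows "\<exists>e\<in>idempotents. x e \<and> (\<forall>a\<in>A. e * a = e)"
  using assms(1,2,4)
proof (induction A rule: finite_induct)
  case empty
  then show ?case using spectrum_nonzero[OF x(1)] by auto
next
  case (insert a A)
  then obtain e where e: "e \<in> idempotents" "x e" "\<forall>a\<in>A. e * a = e" by auto
  from insert.prems have a: "a \<in> idempotents" "x a" by auto
  show ?case
  proof (intro bexI[of _ "e * a"] conjI ballI)
    show "e * a \<in> idempotents" using e a by (simp add: idempotents_mult)
    show "x (e * a)" using e a x by (simp add: spectrum_mult)
    fix b assume "b \<in> insert a A"
    then show "e * a * b = e * a"
    proof
      assume "b = a" then show ?thesis using a by (simp add: mult.assoc idempotentsD)
    next
      assume b: "b \<in> A"
      then have "a * b = b * a" using a insert.prems by (intro idempotents_commute) auto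
      then show ?thesis using e(3) b by (metis mult.assoc)
    qed
  qed
qed

text \<open>A basic set of the product topology restricts finitely many coordinates. Those at which
  x is 1 are controlled by the value at a single common lower bound e; those at which x is 0 form
  N.\<close>

lemma spectrum_neighbourhood:
  fixes x :: "'s::inverse_semigroup_0 \<Rightarrow> bool"
  assumes U: "openin spectrum U" and x: "x \<in> U"
  obtains e N where "e \<in> idempotents" "finite N" "N \<subseteq> idempotents"
    "x \<in> spectrum_basic e - (\<Union>f\<in>N. spectrum_basic f)"
    "spectrum_basic e - (\<Union>f\<in>N. spectrum_basic f) \<subseteq> U"
proof -
  have xs: "x \<in> topspace spectrum" using openin_subset[OF U] x by blast
  obtain W where W: "openin (product_topology (\<lambda>_. discrete_topology (UNIV :: bool set)) (idempotents :: 's set)) W"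
    "U = W \<inter> topspace spectrum"
  proof -
    from U[unfolded spectrum_def openin_subtopology] obtain W where W:
      "openin (product_topology (\<lambda>_. discrete_topology (UNIV :: bool set)) (idempotents :: 's set)) W"
      "U = W \<inter> {\<phi>. (\<forall>e\<in>idempotents. \<forall>f\<in>idempotents. \<phi> (e * f) \<longleftrightarrow> \<phi> e \<and> \<phi> f) \<and>
          (\<exists>e\<in>idempotents. \<phi> e) \<and> \<not> \<phi> 0}" by blast
    show thesis
      by (rule that[OF W(1)])
        (use openin_subset[OF W(1)] in \<open>unfold W(2) spectrum_def topspace_subtopology, blast\<close>)
  qed
  have "x \<in> W" using x W(2) by simp
  note iffD1[OF openin_product_topology_alt W(1), THEN bspec, OF this]
  then obtain V where V: "finite {i \<in> idempotents. V i \<noteq> (UNIV :: bool set)}"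
    "x \<in> Pi\<^sub>E idempotents V" "Pi\<^sub>E idempotents V \<subseteq> W"
    unfolding topspace_discrete_topology by (elim exE conjE) (rule that)
  define M where "M = {i \<in> idempotents. V i \<noteq> (UNIV :: bool set)}"
  have fin: "finite {i \<in> M. x i}" "finite {i \<in> M. \<not> x i}" using V(1) unfolding M_def[symmetric] by simp_all
  obtain e where e: "e \<in> idempotents" "x e" "\<forall>a\<in>{i \<in> M. x i}. e * a = e"
  proof -
    have "{i \<in> M. x i} \<subseteq> idempotents" by (auto simp: M_def)
    from finite_idempotents_lower_bound[OF fin(1) this xs] show thesis using that by auto
  qed
  show ?thesis
  proof (rule that[OF e(1) fin(2)])
    show "{i \<in> M. \<not> x i} \<subseteq> idempotents" by (auto simp: M_def)
    show "x \<in> spectrum_basic e - (\<Union>f\<in>{i \<in> M. \<not> x i}. spectrum_basic f)"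
      using xs e by (auto simp: spectrum_basic_iff)
    show "spectrum_basic e - (\<Union>f\<in>{i \<in> M. \<not> x i}. spectrum_basic f) \<subseteq> U"
    proof
      fix y assume y: "y \<in> spectrum_basic e - (\<Union>f\<in>{i \<in> M. \<not> x i}. spectrum_basic f)"
      then have ys: "y \<in> topspace spectrum" "y e" by (auto simp: spectrum_basic_iff)
      have "y i \<in> V i" if i: "i \<in> idempotents" for i
      proof (cases "i \<in> M")
        case False
        then show ?thesis using i by (simp add: M_def)
      next
        case True
        have "y i = x i"
        proof (cases "x i")
          case True
          then have "e * i = e" using \<open>i \<in> M\<close> e(3) by simp
          then show ?thesis using True ys spectrum_mult[OF ys(1) e(1) i] by simp
        next
          case False
          then show ?thesis using y ys \<open>i \<in> M\<close> by (auto simp: spectrum_basic_iff)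
        qed
        then show ?thesis using V(2) i by (auto simp: PiE_iff)
      qed
      then have "y \<in> Pi\<^sub>E idempotents V"
        using spectrum_extensional[OF ys(1)] by (auto simp: PiE_iff)
      then show "y \<in> U" using V(3) W(2) ys(1) by blast
    qed
  qed
qed

text \<open>The indicator of the filter of all idempotents above e.\<close>

definition principal_char :: "'s::inverse_semigroup_0 \<Rightarrow> 's \<Rightarrow> bool" where
  "principal_char e = (\<lambda>f\<in>idempotents. e * f = e)"

lemma principal_char:
  assumes e: "e \<in> idempotents" "e \<noteq> 0"
  shows "principal_char e \<in> topspace spectrum"
    and "f \<in> idempotents \<Longrightarrow> principal_char e f \<longleftrightarrow> e * f = e"
proof -
  have 1: "e * f = e \<and> e * g = e" if "f \<in> idempotents" "g \<in> idempotents" "e * (f * g) = e" for f g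
  proof -
    have "e * f = e * (f * g) * f" using that by simp
    also have "\<dots> = e * (f * (f * g))"
      using idempotents_commute[OF that(1) idempotents_mult[OF that(1,2)]] by (simp add: mult.assoc)
    also have "\<dots> = e" using that by (simp add: idempotentsD)
    finally show ?thesis using that by (metis mult.assoc)
  qed
  have 2: "e * (f * g) = e" if "e * f = e" "e * g = e" for f g
    using that by (metis mult.assoc)
  show "principal_char e \<in> topspace spectrum"
    unfolding topspace_spectrum principal_char_def
    using e idempotentsD(1)[OF e(1)]
    by (auto simp: idempotents_mult dest: 1 2 intro!: bexI[of _ e])
  show "f \<in> idempotents \<Longrightarrow> principal_char e f \<longleftrightarrow> e * f = e"
    by (simp add: principal_char_def)
qed

subsection \<open>The partial action\<close>

context pure_semigroup
begin

lemma domain_restrict: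
  fixes s :: 's
  assumes "e \<in> idempotents" shows "(s * e)\<^sup>\<star> * (s * e) = s\<^sup>\<star> * s * e"
  using idempotents_commute[OF assms star_mult_idempotent(1)[of s]] assms
  by (simp add: star_mult idempotent_star mult.assoc) (metis idempotentsD(2) mult.assoc)

lemma univ_map_restrict:
  "s * e \<noteq> 0 \<Longrightarrow> e \<in> idempotents \<Longrightarrow> univ_map (s * e) = univ_map s" for s e :: 's
  using univ_map_mult[of s e] partial_hom_idempotent[OF partial_hom_univ_map, of e]
  by (metis add_0_right mult_zero_right)

lemma univ_map_restrict_left:
  "e * s \<noteq> 0 \<Longrightarrow> e \<in> idempotents \<Longrightarrow> univ_map (e * s) = univ_map s" for s e :: 's
  using univ_map_mult[of e s] partial_hom_idempotent[OF partial_hom_univ_map, of e]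
  by (metis add_0 mult_zero_left)

text \<open>Restricted to e, both elements have source e and the same image in the group.\<close>

lemma univ_map_compatible:
  fixes s t :: 's
  assumes "s \<noteq> 0" "t \<noteq> 0" "univ_map s = univ_map t"
    and e: "e \<in> idempotents" "e * (s\<^sup>\<star> * s) = e" "e * (t\<^sup>\<star> * t) = e"
  shows "s * e = t * e"
proof (cases "e = 0")
  case False
  have d: "(s * e)\<^sup>\<star> * (s * e) = e" "(t * e)\<^sup>\<star> * (t * e) = e"
    using e idempotents_commute[OF e(1) star_mult_idempotent(1)] by (simp_all add: domain_restrict)
  then have nz: "s * e \<noteq> 0" "t * e \<noteq> 0" using False by auto
  show ?thesis
    by (rule univ_map_inj[OF nz]) (use nz e d assms in \<open>simp_all add: univ_map_restrict\<close>)
qed simp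

text \<open>Well-definedness of the partial action. Let f be the meet of the sources of s and t.
  Then s f = t f, and a character that is 1 at f has the same value at u* a u as at (u f)* a (u f)
  for every idempotent a.\<close>

lemma spectrum_act_compatible:
  fixes s t :: 's
  assumes st: "s \<noteq> 0" "t \<noteq> 0" "univ_map s = univ_map t"
    and x: "x \<in> spectrum_basic (s\<^sup>\<star> * s)" "x \<in> spectrum_basic (t\<^sup>\<star> * t)"
  shows "spectrum_act s x = spectrum_act t x"
proof -
  define f where "f = (s\<^sup>\<star> * s) * (t\<^sup>\<star> * t)"
  have f: "f \<in> idempotents" by (simp add: f_def idempotents_mult)
  have fs: "f * (s\<^sup>\<star> * s) = f" "f * (t\<^sup>\<star> * t) = f"
    using idempotents_commute[of "s\<^sup>\<star> * s" "t\<^sup>\<star> * t"]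
    by (simp_all add: f_def mult.assoc star_assoc_props)
  have xs: "x \<in> topspace spectrum" using x by (simp add: spectrum_basic_iff)
  have xf: "x f" using x by (auto simp: f_def spectrum_basic_iff spectrum_mult)
  have eq: "s * f = t * f" using st f fs by (rule univ_map_compatible)
  have "x (s\<^sup>\<star> * e * s) = x (t\<^sup>\<star> * e * t)" if e: "e \<in> idempotents" for e
  proof -
    have *: "x (u\<^sup>\<star> * e * u) = x ((u * f)\<^sup>\<star> * e * (u * f))" for u
    proof -
      have "(u * f)\<^sup>\<star> * e * (u * f) = f * (u\<^sup>\<star> * e * u) * f"
        by (simp add: star_mult idempotent_star f mult.assoc)
      then show ?thesis
        using xf xs f conj_idempotent[OF e, of u] by (simp add: spectrum_mult idempotents_mult)
    qed
    show ?thesis using *[of s] *[of t] by (simp add: eq)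
  qed
  then show ?thesis unfolding spectrum_act_def by (rule restrict_ext)
qed

lemma univ_dom_iff:
  "x \<in> univ_dom (- g) \<longleftrightarrow> (\<exists>s. s \<noteq> 0 \<and> univ_map s = g \<and> x \<in> spectrum_basic (s\<^sup>\<star> * s))"
  for x :: "'s \<Rightarrow> bool"
  by (auto simp: univ_dom_def)

lemma univ_dom_eq: "univ_dom g = (\<Union>t\<in>{t. t \<noteq> 0 \<and> univ_map t = g}. spectrum_basic (t * t\<^sup>\<star>))"
  for g :: "'s univ_group"
proof -
  have "s \<in> star ` {t. t \<noteq> 0 \<and> univ_map t = g}" if "s \<noteq> 0" "univ_map s = - g" for s :: 's
    using that by (intro image_eqI[of _ _ "s\<^sup>\<star>"]) (auto simp: univ_map_star)
  then have "{s. s \<noteq> 0 \<and> univ_map s = - g} = star ` {t. t \<noteq> 0 \<and> univ_map t = g}"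
    by (auto simp: univ_map_star)
  then show ?thesis by (simp add: univ_dom_def)
qed

lemma univ_act_eq:
  fixes s :: 's
  assumes "s \<noteq> 0" "univ_map s = g" "x \<in> spectrum_basic (s\<^sup>\<star> * s)"
  shows "univ_act g x = spectrum_act s x"
proof -
  let ?P = "\<lambda>s. s \<noteq> 0 \<and> univ_map s = g \<and> x \<in> spectrum_basic (s\<^sup>\<star> * s)"
  have "?P (SOME s. ?P s)" using assms by (intro someI[of ?P s]) simp
  then show ?thesis unfolding univ_act_def using assms by (intro spectrum_act_compatible) auto
qed

text \<open>The set of all points of the domain of \<open>h\<close> that \<open>h\<close> maps into \<open>D(e)\<close>.\<close>

definition pullback :: "'s univ_group \<Rightarrow> 's \<Rightarrow> ('s \<Rightarrow> bool) set" where
  "pullback h e = (\<Union>t\<in>{t. t \<noteq> 0 \<and> univ_map t = h}. spectrum_basic (t\<^sup>\<star> * e * t))"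

text \<open>x(t* e t) is the value at e of the image of x under h, which does not depend on the
  chosen t over h.\<close>

lemma pullback_at:
  fixes t r :: 's
  assumes t: "t \<noteq> 0" "univ_map t = h" and r: "r \<noteq> 0" "univ_map r = h"
    and e: "e \<in> idempotents" and x: "x \<in> spectrum_basic (t\<^sup>\<star> * e * t)" "x \<in> spectrum_basic (r\<^sup>\<star> * r)"
  shows "x \<in> spectrum_basic (r\<^sup>\<star> * e * r)"
proof -
  have xs: "x \<in> topspace spectrum" using x by (simp add: spectrum_basic_iff)
  have "t\<^sup>\<star> * t * (t\<^sup>\<star> * e * t) = t\<^sup>\<star> * e * t" by (simp add: mult.assoc star_assoc_props)
  then have "x (t\<^sup>\<star> * t)"
    using spectrum_mult[OF xs star_mult_idempotent(1)[of t] conj_idempotent[OF e, of t]] x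
    by (simp add: spectrum_basic_iff)
  then have "spectrum_act t x = spectrum_act r x"
    using t r x xs by (intro spectrum_act_compatible) (auto simp: spectrum_basic_iff)
  then have "spectrum_act t x e = spectrum_act r x e" by simp
  then show ?thesis using e x by (simp add: spectrum_act_def spectrum_basic_iff)
qed

lemma spectrum_act_in_basic_iff:
  fixes s :: 's
  assumes x: "x \<in> spectrum_basic (s\<^sup>\<star> * s)" and e: "e \<in> idempotents"
  shows "spectrum_act s x \<in> spectrum_basic e \<longleftrightarrow> x \<in> spectrum_basic (s\<^sup>\<star> * e * s)"
proof -
  have xs: "x \<in> topspace spectrum" "x (s\<^sup>\<star> * s)" using x by (auto simp: spectrum_basic_iff)
  have m: "x (s\<^sup>\<star> * (f * g) * s) \<longleftrightarrow> x (s\<^sup>\<star> * f * s) \<and> x (s\<^sup>\<star> * g * s)"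
    if "f \<in> idempotents" "g \<in> idempotents" for f g
  proof -
    have "s\<^sup>\<star> * (f * g) * s = s\<^sup>\<star> * f * (g * s)" by (simp add: mult.assoc)
    also have "\<dots> = (s\<^sup>\<star> * f * s) * (s\<^sup>\<star> * g * s)"
      by (subst idempotent_mult_right[OF that(2)]) (simp add: mult.assoc)
    finally show ?thesis
      by (simp add: spectrum_mult xs conj_idempotent that)
  qed
  \<comment> \<open>The image is again a character: multiplicativity is m, and the value at
    \<open>s * s\<^sup>\<star>\<close> shows that it is not zero.\<close>
  have "spectrum_act s x \<in> topspace spectrum"
    unfolding topspace_spectrum spectrum_act_def using xs spectrum_zero[OF xs(1)]
    by (auto simp: idempotents_mult m[unfolded mult.assoc] mult.assoc star_assoc_props
        intro!: bexI[of _ "s * s\<^sup>\<star>"])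
  then show ?thesis using xs e by (simp add: spectrum_basic_iff spectrum_act_def)
qed

lemma basic_conj_subset:
  fixes t :: 's
  assumes "e \<in> idempotents" shows "spectrum_basic (t\<^sup>\<star> * e * t) \<subseteq> spectrum_basic (t\<^sup>\<star> * t)"
proof -
  have "t\<^sup>\<star> * e * t = (t\<^sup>\<star> * t) * (t\<^sup>\<star> * e * t)" by (simp add: mult.assoc star_assoc_props)
  then have "spectrum_basic (t\<^sup>\<star> * e * t) = spectrum_basic (t\<^sup>\<star> * t) \<inter> spectrum_basic (t\<^sup>\<star> * e * t)"
    by (metis spectrum_basic_mult star_mult_idempotent(1) conj_idempotent assms)
  then show ?thesis by blast
qed

text \<open>The part of D(e) inside the range of a single t pulls back to a compact open set,
  whereas the preimage of D(e) itself, \<open>pullback h e\<close>, is only a union of such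
  sets.\<close>

lemma univ_act_in_basic_iff:
  fixes t :: 's
  assumes t: "t \<noteq> 0" "univ_map t = h" and e: "e \<in> idempotents"
  shows "x \<in> univ_dom (- h) \<and> univ_act h x \<in> spectrum_basic (e * (t * t\<^sup>\<star>)) \<longleftrightarrow>
    x \<in> spectrum_basic (t\<^sup>\<star> * e * t)"
proof
  have et: "e * (t * t\<^sup>\<star>) \<in> idempotents" using e by (simp add: idempotents_mult)
  have tet: "t\<^sup>\<star> * (e * (t * t\<^sup>\<star>)) * t = t\<^sup>\<star> * e * t" by (simp add: mult.assoc star_assoc_props)
  show "x \<in> univ_dom (- h) \<and> univ_act h x \<in> spectrum_basic (e * (t * t\<^sup>\<star>))"
    if "x \<in> spectrum_basic (t\<^sup>\<star> * e * t)"
  proof -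
    have x: "x \<in> spectrum_basic (t\<^sup>\<star> * t)" using that basic_conj_subset[OF e] by blast
    show ?thesis
      using t x that spectrum_act_in_basic_iff[OF x et] univ_act_eq[OF t x] tet
      by (auto simp: univ_dom_iff)
  qed
  assume asm: "x \<in> univ_dom (- h) \<and> univ_act h x \<in> spectrum_basic (e * (t * t\<^sup>\<star>))"
  then obtain r where r: "r \<noteq> 0" "univ_map r = h" "x \<in> spectrum_basic (r\<^sup>\<star> * r)"
    by (auto simp: univ_dom_iff)
  have x: "x \<in> spectrum_basic (r\<^sup>\<star> * (e * (t * t\<^sup>\<star>)) * r)"
    using asm univ_act_eq[OF r] spectrum_act_in_basic_iff[OF r(3) et] by simp
  then have xs: "x \<in> topspace spectrum" by (simp add: spectrum_basic_iff)
  have "r\<^sup>\<star> * (e * (t * t\<^sup>\<star>)) * r = r\<^sup>\<star> * e * (t * t\<^sup>\<star> * r)" by (simp add: mult.assoc)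
  also have "\<dots> = (r\<^sup>\<star> * e * r) * (r\<^sup>\<star> * (t * t\<^sup>\<star>) * r)"
    by (subst idempotent_mult_right) (simp_all add: mult.assoc)
  finally have "x (r\<^sup>\<star> * (t * t\<^sup>\<star>) * r)"
    using x xs by (simp add: spectrum_basic_iff spectrum_mult conj_idempotent e)
  \<comment> \<open>x may enter the domain of h through some r other than t. Then t* r is trivial in
    the group, so idempotent by purity, and it puts x into D(t* t).\<close>
  moreover define p where "p = t\<^sup>\<star> * r"
  ultimately have xp: "x (p\<^sup>\<star> * p)" by (simp add: star_mult mult.assoc)
  then have p0: "p \<noteq> 0" using spectrum_zero[OF xs] by auto
  then have "univ_map p = 0"
    using univ_map_mult[of "t\<^sup>\<star>" r] t r by (simp add: p_def univ_map_star)
  with p0 have p: "p \<in> idempotents" by (rule univ_map_eq_0D)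
  then have xp: "x p" using xp by (simp add: idempotent_star idempotentsD)
  have "t\<^sup>\<star> * t * p = p" by (simp add: p_def mult.assoc star_assoc_props)
  then have "x (t\<^sup>\<star> * t)" using spectrum_mult[OF xs star_mult_idempotent(1)[of t] p] xp by simp
  then have "x \<in> spectrum_basic (t\<^sup>\<star> * t)" using xs by (simp add: spectrum_basic_iff)
  from pullback_at[OF r(1,2) t et x this] show "x \<in> spectrum_basic (t\<^sup>\<star> * e * t)"
    unfolding tet .
qed

end

section \<open>Projections of open sets\<close>

lemma compactin_incseq_subset:
  assumes K: "compactin X K" and A: "incseq A" "\<And>n. openin X (A n)" "K \<subseteq> (\<Union>n. A n)"
  obtains n where "K \<subseteq> A n"
proof -
  obtain \<F> where F: "finite \<F>" "\<F> \<subseteq> range A" "K \<subseteq> \<Union>\<F>"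
    using K A(2,3) unfolding compactin_def by (metis (no_types, lifting) imageE)
  then obtain I where I: "finite I" "\<F> = A ` I" by (metis finite_subset_image)
  have "K \<subseteq> A (Max (insert 0 I))"
  proof
    fix x assume "x \<in> K"
    then obtain i where "i \<in> I" "x \<in> A i" using F I by auto
    then show "x \<in> A (Max (insert 0 I))" using incseqD[OF A(1), of i "Max (insert 0 I)"] I(1) by auto
  qed
  then show ?thesis by (rule that)
qed

context C0_rep
begin

abbreviation set_proj :: "'x set \<Rightarrow> 'h \<Rightarrow> 'h" where
  "set_proj A \<equiv> blinfun_apply (\<pi> (indicator A))"

lemma set_proj_empty [simp]: "set_proj {} v = 0"
proof -
  have "(indicator {} :: 'x \<Rightarrow> complex) = (\<lambda>_. 0)" by auto
  then show ?thesis using rep_zero by simp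
qed

lemma set_proj_Int:
  assumes "compact_open X A" "compact_open X B"
  shows "set_proj (A \<inter> B) v = set_proj A (set_proj B v)"
proof -
  have "(indicator (A \<inter> B) :: 'x \<Rightarrow> complex) = (\<lambda>x. indicator A x * indicator B x)"
    by (simp add: fun_eq_iff indicator_inter_arith)
  then show ?thesis using rep_mult[OF indicator_C0 indicator_C0, OF assms] by simp
qed

lemma set_proj_disjoint_Un:
  assumes "compact_open X A" "compact_open X B" "A \<inter> B = {}"
  shows "set_proj (A \<union> B) v = set_proj A v + set_proj B v"
proof -
  have "(indicator (A \<union> B) :: 'x \<Rightarrow> complex) = (\<lambda>x. indicator A x + indicator B x)"
    using assms(3) by (auto simp: fun_eq_iff indicator_def)
  then show ?thesis
    using rep_add[OF indicator_C0 indicator_C0, OF assms(1,2)] by (simp add: blinfun.add_left)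
qed

lemma set_proj_disjoint_UN:
  assumes "finite I" "\<And>i. i \<in> I \<Longrightarrow> compact_open X (A i)" "disjoint_family_on A I"
  shows "set_proj (\<Union>i\<in>I. A i) v = (\<Sum>i\<in>I. set_proj (A i) v)"
  using assms
proof (induction I rule: finite_induct)
  case (insert i I)
  have "A i \<inter> (\<Union>j\<in>I. A j) = {}"
    using insert.prems(2) insert.hyps(2) by (fastforce simp: disjoint_family_on_def)
  moreover have "disjoint_family_on A I"
    using insert.prems(2) by (auto simp: disjoint_family_on_def)
  ultimately show ?case
    using insert by (simp add: set_proj_disjoint_Un compact_open_UN)
qed simp

lemma set_proj_selfadjoint:
  assumes "compact_open X A" shows "cinner (set_proj A v) w = cinner v (set_proj A w)"
proof -
  have "(\<lambda>x. cnj (indicator A x)) = (indicator A :: 'x \<Rightarrow> complex)"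
    by (auto simp: indicator_def)
  then have "adj_op (\<pi> (indicator A)) = \<pi> (indicator A)"
    using rep_cnj[OF indicator_C0[OF assms]] by simp
  then show ?thesis
    using cinner_adj_op(1)[OF rep_bounded_ops[OF indicator_C0[OF assms]]] by simp
qed

lemma set_proj_norm_le: "compact_open X A \<Longrightarrow> norm (set_proj A v) \<le> norm v"
  using rep_contractive[OF indicator_C0, of A v] by (simp add: indicator_def)

lemma set_proj_orthogonal:
  assumes "compact_open X A" "compact_open X B" "A \<inter> B = {}"
  shows "cinner (set_proj A v) (set_proj B w) = 0"
  using set_proj_selfadjoint[OF assms(1), of v "set_proj B w"]
    set_proj_Int[OF assms(1,2), of w] assms(3) by simp

lemma norm_sum_set_proj:
  assumes "finite I" "\<And>i. i \<in> I \<Longrightarrow> compact_open X (A i)" "disjoint_family_on A I"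
  shows "(norm (\<Sum>i\<in>I. set_proj (A i) (v i)))\<^sup>2 = (\<Sum>i\<in>I. (norm (set_proj (A i) (v i)))\<^sup>2)"
  using assms
proof (induction I rule: finite_induct)
  case (insert i I)
  have dis: "A i \<inter> A j = {}" if "j \<in> I" for j
    using insert.prems(2) insert.hyps(2) that by (auto simp: disjoint_family_on_def)
  have "disjoint_family_on A I" using insert.prems(2) by (auto simp: disjoint_family_on_def)
  moreover have "cinner (set_proj (A i) (v i)) (\<Sum>j\<in>I. set_proj (A j) (v j)) = 0"
    unfolding cinner_sum_right using insert.prems(1) dis
    by (intro sum.neutral ballI set_proj_orthogonal) auto
  ultimately show ?case using insert by (simp add: norm_add_power2)
qed simp

text \<open>By Pythagoras the squared distance of two terms is the difference of their squared
  norms, and these increase and are bounded by that of v.\<close>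

lemma set_proj_incseq_convergent:
  assumes A: "incseq A" "\<And>n. compact_open X (A n)"
  shows "convergent (\<lambda>n. set_proj (A n) v)"
proof -
  define a where "a n = (norm (set_proj (A n) v))\<^sup>2" for n
  have split: "(norm (set_proj (A m) v - set_proj (A n) v))\<^sup>2 = a m - a n" if "n \<le> m" for m n
  proof -
    have sub: "A m = (A m - A n) \<union> A n" using incseqD[OF A(1) that] by blast
    have co: "compact_open X (A m - A n)" using A(2) by (simp add: compact_open_Diff)
    have eq: "set_proj (A m) v = set_proj (A m - A n) v + set_proj (A n) v"
      by (subst sub, rule set_proj_disjoint_Un[OF co A(2)]) auto
    have "cinner (set_proj (A m - A n) v) (set_proj (A n) v) = 0"
      by (rule set_proj_orthogonal[OF co A(2)]) auto
    then show ?thesis unfolding a_def eq by (simp add: norm_add_power2)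
  qed
  have mono: "incseq a"
  proof (rule incseq_SucI)
    show "a n \<le> a (Suc n)" for n
      using split[of n "Suc n"] zero_le_power2[of "norm (set_proj (A (Suc n)) v - set_proj (A n) v)"]
      by simp
  qed
  have "a n \<le> (norm v)\<^sup>2" for n
    unfolding a_def using set_proj_norm_le[OF A(2)] by (simp add: power_mono)
  then obtain L where "a \<longlonglongrightarrow> L" using incseq_convergent[OF mono] by metis
  then have Ca: "Cauchy a" by (rule LIMSEQ_imp_Cauchy)
  have "Cauchy (\<lambda>n. set_proj (A n) v)"
  proof (rule CauchyI)
    fix e :: real assume e: "0 < e"
    then obtain M where M: "\<And>m n. m \<ge> M \<Longrightarrow> n \<ge> M \<Longrightarrow> norm (a m - a n) < e\<^sup>2"
      using CauchyD[OF Ca, of "e\<^sup>2"] by auto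
    have *: "norm (set_proj (A m) v - set_proj (A n) v) < e" if "M \<le> n" "n \<le> m" for m n
    proof -
      have "(norm (set_proj (A m) v - set_proj (A n) v))\<^sup>2 < e\<^sup>2"
        using split[OF that(2)] M[of m n] that by simp
      then show ?thesis using e by (simp add: power_less_imp_less_base)
    qed
    show "\<exists>M. \<forall>m\<ge>M. \<forall>n\<ge>M. norm (set_proj (A m) v - set_proj (A n) v) < e"
    proof (intro exI allI impI)
      fix m n assume "M \<le> m" "M \<le> n"
      then show "norm (set_proj (A m) v - set_proj (A n) v) < e"
        using *[of m n] *[of n m] by (cases "n \<le> m") (auto simp: norm_minus_commute)
    qed
  qed
  then show ?thesis by (simp add: Cauchy_convergent_iff)
qed

text \<open>\<open>set_proj\<close> makes sense for compact open sets only; an open W is reached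
  from inside through a sequence of them.\<close>

definition exhausts :: "(nat \<Rightarrow> 'x set) \<Rightarrow> 'x set \<Rightarrow> bool" where
  "exhausts A W \<longleftrightarrow> incseq A \<and> (\<forall>n. compact_open X (A n)) \<and> (\<Union>n. A n) = W"

text \<open>Each C n is compact, so contained in some D m; projecting to C n therefore does not
  distinguish v from the limit along D. In the limit <c, d> = <c, c>, and by symmetry |a - b|^2 =
  0.\<close>

lemma exhausts_limits_eq:
  assumes A: "exhausts A W" "(\<lambda>n. set_proj (A n) v) \<longlonglongrightarrow> a"
    and B: "exhausts B W" "(\<lambda>n. set_proj (B n) v) \<longlonglongrightarrow> b"
  shows "a = b"
proof -
  have eq: "(\<lambda>n. cinner (set_proj (C n) v) d) \<longlonglongrightarrow> cinner c d"
    if "(\<lambda>n. set_proj (C n) v) \<longlonglongrightarrow> c" for C c d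
    by (intro tendsto_intros that)
  have absorb: "set_proj (C n) d = set_proj (C n) v"
    if C: "exhausts C W" and D: "exhausts D W" "(\<lambda>n. set_proj (D n) v) \<longlonglongrightarrow> d" for C D n d
  proof -
    have co: "compact_open X (C n)" "\<And>m. compact_open X (D m)" and inc: "incseq D"
      and sub: "C n \<subseteq> (\<Union>m. D m)"
      using C D(1) by (auto simp: exhausts_def)
    obtain m where m: "C n \<subseteq> D m"
      using compactin_incseq_subset[OF _ inc _ sub] co by (auto simp: compact_open_def)
    have "set_proj (C n) (set_proj (D k) v) = set_proj (C n) v" if "m \<le> k" for k
    proof -
      have "C n \<inter> D k = C n" using m incseqD[OF inc that] by blast
      then show ?thesis using set_proj_Int[OF co(1) co(2)[of k], of v] by simp
    qed
    then have "(\<lambda>k. set_proj (C n) (set_proj (D k) v)) \<longlonglongrightarrow> set_proj (C n) v"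
      by (intro tendsto_eventually) (auto simp: eventually_sequentially)
    moreover have "(\<lambda>k. set_proj (C n) (set_proj (D k) v)) \<longlonglongrightarrow> set_proj (C n) d"
      by (intro tendsto_intros D(2))
    ultimately show ?thesis using LIMSEQ_unique by blast
  qed
  have *: "cinner c d = cinner c c" if C: "exhausts C W" "(\<lambda>n. set_proj (C n) v) \<longlonglongrightarrow> c"
    and D: "exhausts D W" "(\<lambda>n. set_proj (D n) v) \<longlonglongrightarrow> d" for C D c d
  proof -
    have "cinner (set_proj (C n) v) d = cinner (set_proj (C n) v) c" for n
    proof -
      have co: "compact_open X (C n)" using C by (simp add: exhausts_def)
      show ?thesis
        unfolding set_proj_selfadjoint[OF co] absorb[OF C(1) D] absorb[OF C(1) C] ..
    qed
    then have "(\<lambda>n. cinner (set_proj (C n) v) d) = (\<lambda>n. cinner (set_proj (C n) v) c)" by simp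
    from LIMSEQ_unique[OF eq[OF C(2), of d, unfolded this] eq[OF C(2), of c]] show ?thesis .
  qed
  have "cinner (a - b) (a - b) = 0"
    using *[OF A B] *[OF B A] *[OF A A] cinner_commute[of a b]
    by (simp add: cinner_diff_left cinner_diff_right)
  then show ?thesis using cinner_eq_zero_imp_zero by fastforce
qed

text \<open>Where W is exhausted by a sequence, this is the value of the spectral measure of \<pi>
  at W.\<close>

definition open_proj :: "'x set \<Rightarrow> 'h \<Rightarrow> 'h" where
  "open_proj W v = (THE w. \<forall>A. exhausts A W \<longrightarrow> (\<lambda>n. set_proj (A n) v) \<longlonglongrightarrow> w)"

lemma open_proj_lim:
  assumes "exhausts A W" shows "(\<lambda>n. set_proj (A n) v) \<longlonglongrightarrow> open_proj W v"
proof -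
  have conv: "\<exists>b. (\<lambda>n. set_proj (B n) v) \<longlonglongrightarrow> b" if "exhausts B W" for B
    using set_proj_incseq_convergent that by (auto simp: exhausts_def convergent_def)
  obtain a where a: "(\<lambda>n. set_proj (A n) v) \<longlonglongrightarrow> a" using conv[OF assms] by blast
  have "\<forall>B. exhausts B W \<longrightarrow> (\<lambda>n. set_proj (B n) v) \<longlonglongrightarrow> open_proj W v"
    unfolding open_proj_def
  proof (rule theI)
    show 1: "\<forall>B. exhausts B W \<longrightarrow> (\<lambda>n. set_proj (B n) v) \<longlonglongrightarrow> a"
      using conv exhausts_limits_eq[OF assms a] by metis
    show "w = a" if "\<forall>B. exhausts B W \<longrightarrow> (\<lambda>n. set_proj (B n) v) \<longlonglongrightarrow> w" for w
      using that assms a LIMSEQ_unique by blast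
  qed
  then show ?thesis using assms by blast
qed

lemma exhausts_const: "compact_open X A \<Longrightarrow> exhausts (\<lambda>_. A) A"
  by (simp add: exhausts_def)

lemma exhausts_Int: "exhausts A V \<Longrightarrow> exhausts B W \<Longrightarrow> exhausts (\<lambda>n. A n \<inter> B n) (V \<inter> W)"
proof -
  assume A: "exhausts A V" and B: "exhausts B W"
  have "\<exists>n. x \<in> A n \<inter> B n" if "x \<in> A i" "x \<in> B j" for x i j
    using that A B incseqD[of A i "max i j"] incseqD[of B j "max i j"] by (auto simp: exhausts_def)
  then show ?thesis using A B
    by (auto simp: exhausts_def compact_open_Int incseq_def) blast+
qed

lemma open_proj_compact_open: "compact_open X A \<Longrightarrow> open_proj A v = set_proj A v"
  using open_proj_lim[OF exhausts_const] by (simp add: LIMSEQ_const_iff)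

lemma open_proj_empty [simp]: "open_proj {} v = 0"
  using open_proj_compact_open[OF compact_open_empty] by simp

lemma open_proj_selfadjoint:
  assumes "exhausts A W" shows "cinner (open_proj W v) w = cinner v (open_proj W w)"
proof (rule LIMSEQ_unique)
  show "(\<lambda>n. cinner (set_proj (A n) v) w) \<longlonglongrightarrow> cinner (open_proj W v) w"
    by (intro tendsto_intros open_proj_lim assms)
  have "cinner (set_proj (A n) v) w = cinner v (set_proj (A n) w)" for n
    using assms by (intro set_proj_selfadjoint) (simp add: exhausts_def)
  then show "(\<lambda>n. cinner (set_proj (A n) v) w) \<longlonglongrightarrow> cinner v (open_proj W w)"
    by (simp only:) (intro tendsto_intros open_proj_lim assms)
qed

lemma open_proj_Int:
  assumes A: "exhausts A V" and B: "exhausts B W"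
  shows "open_proj (V \<inter> W) v = open_proj V (open_proj W v)"
proof (rule LIMSEQ_unique)
  show "(\<lambda>n. set_proj (A n \<inter> B n) v) \<longlonglongrightarrow> open_proj (V \<inter> W) v"
    by (intro open_proj_lim exhausts_Int assms)
  have coA: "compact_open X (A n)" and coB: "compact_open X (B n)" for n
    using A B by (auto simp: exhausts_def)
  \<comment> \<open>Strong convergence of a product: the projections of A n are contractions, so
    they do not enlarge the error in the inner factor.\<close>
  have eq: "set_proj (A n \<inter> B n) v
      = set_proj (A n) (set_proj (B n) v - open_proj W v) + set_proj (A n) (open_proj W v)" for n
    by (simp add: set_proj_Int[OF coA coB] blinfun.diff_right)
  have "(\<lambda>n. set_proj (A n) (set_proj (B n) v - open_proj W v)) \<longlonglongrightarrow> 0"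
  proof (rule Lim_null_comparison[OF always_eventually])
    show "\<forall>n. norm (set_proj (A n) (set_proj (B n) v - open_proj W v))
        \<le> norm (set_proj (B n) v - open_proj W v)"
      using set_proj_norm_le[OF coA] by blast
    show "(\<lambda>n. norm (set_proj (B n) v - open_proj W v)) \<longlonglongrightarrow> 0"
      using open_proj_lim[OF B] by (simp add: LIM_zero tendsto_norm_zero)
  qed
  from tendsto_add[OF this open_proj_lim[OF A, of "open_proj W v"]]
  show "(\<lambda>n. set_proj (A n \<inter> B n) v) \<longlonglongrightarrow> open_proj V (open_proj W v)"
    unfolding eq by simp
qed

lemma open_proj_of_subset:
  assumes "exhausts A W" "compact_open X C" "C \<subseteq> W"
  shows "open_proj W (set_proj C v) = set_proj C v"
  using open_proj_Int[OF assms(1) exhausts_const[OF assms(2)], of v] assms(2,3)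
  by (simp add: open_proj_compact_open Int_absorb1)

lemma open_proj_of_disjoint:
  assumes "exhausts A W" "compact_open X C" "C \<inter> W = {}"
  shows "open_proj W (set_proj C v) = 0"
  using open_proj_Int[OF assms(1) exhausts_const[OF assms(2)], of v] assms(2,3)
  by (simp add: open_proj_compact_open Int_commute)

end

section \<open>The regular representation of the crossed product\<close>

lemma alg_norm_C0: "alg_norm (C0_alg X) f = (SUP x. cmod (f x))"
  by (simp add: C0_alg_def)

lemma C0_ideal_C0: "f \<in> C0_ideal X U \<Longrightarrow> f \<in> C0 X"
  by (simp add: C0_ideal_def)

lemma C0_ideal_mult: "f \<in> C0 X \<Longrightarrow> g \<in> C0_ideal X U \<Longrightarrow> (\<lambda>x. f x * g x) \<in> C0_ideal X U"
  by (simp add: C0_ideal_def C0_mult)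

lemma C0_ideal_add: "f \<in> C0_ideal X U \<Longrightarrow> g \<in> C0_ideal X U \<Longrightarrow> (\<lambda>x. f x + g x) \<in> C0_ideal X U"
  by (simp add: C0_ideal_def C0_add)

lemma C0_ideal_scale: "f \<in> C0_ideal X U \<Longrightarrow> (\<lambda>x. c * f x) \<in> C0_ideal X U"
  by (simp add: C0_ideal_def C0_scale)

lemma C0_ideal_zero: "(\<lambda>_. 0) \<in> C0_ideal X U"
  by (simp add: C0_ideal_def C0_zero)

lemma indicator_C0_ideal: "compact_open X A \<Longrightarrow> A \<subseteq> U \<Longrightarrow> indicator A \<in> C0_ideal X U"
  by (auto simp: C0_ideal_def indicator_C0 indicator_def)

locale spectrum_rep = pure_semigroup S + C0_rep "spectrum :: ('s \<Rightarrow> bool) topology" \<pi>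
  for S :: "'s::inverse_semigroup_0 itself"
    and \<pi> :: "(('s \<Rightarrow> bool) \<Rightarrow> complex) \<Rightarrow> 'h::complex_hilbert_space \<Rightarrow>\<^sub>L 'h" +
  assumes countable: "countable (UNIV :: 's set)"
    and faithful: "inj_on \<pi> (C0 (spectrum :: ('s \<Rightarrow> bool) topology))"
begin

abbreviation X :: "('s \<Rightarrow> bool) topology" where "X \<equiv> spectrum"

abbreviation D :: "'s \<Rightarrow> ('s \<Rightarrow> bool) set" where "D \<equiv> spectrum_basic"

abbreviation ideal :: "'s univ_group \<Rightarrow> (('s \<Rightarrow> bool) \<Rightarrow> complex) set" where
  "ideal h \<equiv> C0_ideal X (univ_dom h)"

abbreviation alpha :: "'s univ_group \<Rightarrow> (('s \<Rightarrow> bool) \<Rightarrow> complex) \<Rightarrow> ('s \<Rightarrow> bool) \<Rightarrow> complex" where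
  "alpha h \<equiv> partial_alpha univ_dom univ_act (- h)"

lemma alpha_apply: "alpha h f x = (if x \<in> univ_dom (- h) then f (univ_act h x) else 0)"
  by (simp add: partial_alpha_def)

subsection \<open>Density of simple functions\<close>

text \<open>Each generator is the coefficient function of an operator \<open>Vop t\<close> with t
  over h, so that \<open>crossed f h\<close> is a finite combination of such operators.\<close>

inductive_set simple_fun :: "'s univ_group \<Rightarrow> (('s \<Rightarrow> bool) \<Rightarrow> complex) set" for h where
  zero: "(\<lambda>_. 0) \<in> simple_fun h"
| step: "t \<noteq> 0 \<Longrightarrow> univ_map t = h \<Longrightarrow> g \<in> simple_fun h \<Longrightarrow>
    (\<lambda>x. c * indicator (D (t * t\<^sup>\<star>)) x + g x) \<in> simple_fun h"

lemma simple_fun_gen: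
  "t \<noteq> 0 \<Longrightarrow> univ_map t = h \<Longrightarrow> indicator (D (t * t\<^sup>\<star>)) \<in> simple_fun h"
  using simple_fun.step[OF _ _ simple_fun.zero, of t h 1] by simp

lemma simple_fun_add:
  assumes "f \<in> simple_fun h" "g \<in> simple_fun h" shows "(\<lambda>x. f x + g x) \<in> simple_fun h"
  using assms(1)
proof induction
  case (step t f c)
  then show ?case using simple_fun.step[of t h "\<lambda>x. f x + g x" c] by (simp add: add.assoc)
qed (use assms(2) in simp)

lemma simple_fun_scale:
  assumes "f \<in> simple_fun h" shows "(\<lambda>x. c * f x) \<in> simple_fun h"
  using assms
proof induction
  case (step t f d)
  then show ?case
    using simple_fun.step[of t h "\<lambda>x. c * f x" "c * d"] by (simp add: distrib_left mult.assoc)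
qed (use simple_fun.zero in simp)

lemma simple_fun_diff:
  "f \<in> simple_fun h \<Longrightarrow> g \<in> simple_fun h \<Longrightarrow> (\<lambda>x. f x - g x) \<in> simple_fun h"
  using simple_fun_add[of f h "\<lambda>x. -1 * g x"] simple_fun_scale[of g h "-1"] by simp

lemma basic_Int_range:
  assumes e: "e \<in> idempotents" shows "D e \<inter> D (t * t\<^sup>\<star>) = D ((e * t) * (e * t)\<^sup>\<star>)"
proof -
  have "(e * t) * (e * t)\<^sup>\<star> = e * ((t * t\<^sup>\<star>) * e)"
    by (simp add: star_mult idempotent_star e mult.assoc)
  also have "\<dots> = e * (t * t\<^sup>\<star>)"
    unfolding idempotents_commute[OF star_mult_idempotent(2) e] using e by (simp add: idempotentsD)
  finally show ?thesis using e by (simp add: spectrum_basic_mult)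
qed

lemma simple_fun_mult_basic:
  assumes "f \<in> simple_fun h" and e: "e \<in> idempotents"
  shows "(\<lambda>x. f x * indicator (D e) x) \<in> simple_fun h"
  using assms(1)
proof induction
  case (step t f c)
  have eq: "(c * indicator (D (t * t\<^sup>\<star>)) x + f x) * indicator (D e) x
      = c * indicator (D ((e * t) * (e * t)\<^sup>\<star>)) x + f x * indicator (D e) x" for x
    unfolding basic_Int_range[OF e, symmetric] indicator_inter_arith by (simp add: algebra_simps)
  show ?case
  proof (cases "e * t = 0")
    case True
    then show ?thesis unfolding eq using step.IH by simp
  next
    case False
    then show ?thesis unfolding eq
      using step e by (intro simple_fun.step) (auto simp: univ_map_restrict_left)
  qed
qed (use simple_fun.zero in simp)

lemma simple_fun_mult_basic_diff:
  assumes "finite N" "N \<subseteq> idempotents" "f \<in> simple_fun h" "e \<in> idempotents"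
  shows "(\<lambda>x. f x * indicator (D e - (\<Union>g\<in>N. D g)) x) \<in> simple_fun h"
  using assms(1,2)
proof (induction N rule: finite_induct)
  case empty
  then show ?case using simple_fun_mult_basic assms by simp
next
  case (insert g N)
  let ?A = "D e - (\<Union>g\<in>N. D g)"
  have "(\<lambda>x. f x * indicator ?A x - (f x * indicator ?A x) * indicator (D g) x) \<in> simple_fun h"
    using insert by (intro simple_fun_diff simple_fun_mult_basic) auto
  moreover have "f x * indicator (D e - (\<Union>g\<in>insert g N. D g)) x
      = f x * indicator ?A x - (f x * indicator ?A x) * indicator (D g) x" for x
    by (auto simp: indicator_def)
  ultimately show ?case by presburger
qed

lemma compact_open_basic: "e \<in> idempotents \<Longrightarrow> compact_open X (D e)"
  by (rule compact_open_spectrum_basic)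

lemma univ_dom_basic_subset: "t \<noteq> 0 \<Longrightarrow> univ_map t = h \<Longrightarrow> D (t * t\<^sup>\<star>) \<subseteq> univ_dom h"
  by (auto simp: univ_dom_eq)

lemma simple_fun_ideal:
  assumes "f \<in> simple_fun h" shows "f \<in> ideal h"
  using assms
proof induction
  case (step t f c)
  then show ?case
    by (intro C0_ideal_add C0_ideal_scale indicator_C0_ideal compact_open_basic univ_dom_basic_subset)
      auto
qed (rule C0_ideal_zero)

text \<open>The set where |b| \<ge> \<epsilon> is compact and covered by finitely many compact open
  N on which b is almost constant. An approximation on a union is extended by overwriting it on one
  more N with a constant; \<open>good\<close> includes what keeps this inside
  \<open>simple_fun h\<close>.\<close>

lemma simple_fun_dense:
  assumes b: "b \<in> ideal h" and \<epsilon>: "0 < \<epsilon>"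
  shows "\<exists>g\<in>simple_fun h. \<forall>x. cmod (b x - g x) < \<epsilon>"
proof -
  define good where "good N \<longleftrightarrow> openin X N \<and> (\<exists>c. (\<lambda>x. c * indicator N x) \<in> simple_fun h \<and>
    (\<forall>x\<in>N. cmod (b x - c) < \<epsilon>) \<and>
    (\<forall>g\<in>simple_fun h. (\<lambda>x. g x * indicator N x) \<in> simple_fun h))" for N
  have union: "\<exists>g\<in>simple_fun h. \<forall>x. (x \<in> \<Union>\<F> \<longrightarrow> cmod (b x - g x) < \<epsilon>) \<and> (x \<notin> \<Union>\<F> \<longrightarrow> g x = 0)"
    if "finite \<F>" "\<forall>N\<in>\<F>. good N" for \<F>
    using that
  proof (induction \<F> rule: finite_induct)
    case empty
    then show ?case using simple_fun.zero by auto
  next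
    case (insert N \<F>)
    then obtain g where g: "g \<in> simple_fun h" "\<And>x. x \<in> \<Union>\<F> \<Longrightarrow> cmod (b x - g x) < \<epsilon>"
      "\<And>x. x \<notin> \<Union>\<F> \<Longrightarrow> g x = 0" by auto
    obtain c where c: "(\<lambda>x. c * indicator N x) \<in> simple_fun h" "\<And>x. x \<in> N \<Longrightarrow> cmod (b x - c) < \<epsilon>"
      "\<And>g. g \<in> simple_fun h \<Longrightarrow> (\<lambda>x. g x * indicator N x) \<in> simple_fun h"
      using insert.prems by (auto simp: good_def)
    show ?case
    proof (rule bexI)
      show "(\<lambda>x. c * indicator N x + (g x - g x * indicator N x)) \<in> simple_fun h"
        by (intro simple_fun_add simple_fun_diff c g(1))
    qed (use g c(2) in \<open>auto simp: indicator_def\<close>)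
  qed
  have b0: "b \<in> C0 X" using b by (rule C0_ideal_C0)
  define K where "K = {x \<in> topspace X. \<epsilon> \<le> cmod (b x)}"
  have K: "compactin X K" unfolding K_def using C0D(2)[OF b0 \<epsilon>] .
  have "\<exists>N. good N \<and> x \<in> N" if "x \<in> K" for x
  proof -
    have "b x \<noteq> 0" using that \<epsilon> by (auto simp: K_def)
    then have "x \<in> univ_dom h" using b by (auto simp: C0_ideal_def)
    then obtain t where t: "t \<noteq> 0" "univ_map t = h" "x \<in> D (t * t\<^sup>\<star>)" by (auto simp: univ_dom_eq)
    let ?V = "{y \<in> topspace X. b y \<in> ball (b x) \<epsilon>} \<inter> D (t * t\<^sup>\<star>)"
    have "openin X ?V"
      using compact_open_basic[of "t * t\<^sup>\<star>"] openin_continuous_map_preimage[OF C0D(1)[OF b0], of "ball (b x) \<epsilon>"]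
      by (intro openin_Int) (simp_all add: compact_open_def)
    moreover have "x \<in> ?V" using that t \<epsilon> by (auto simp: K_def)
    ultimately obtain e M where M: "e \<in> idempotents" "finite M" "M \<subseteq> idempotents"
      "x \<in> D e - (\<Union>f\<in>M. D f)" "D e - (\<Union>f\<in>M. D f) \<subseteq> ?V"
      by (rule spectrum_neighbourhood)
    let ?N = "D e - (\<Union>f\<in>M. D f)"
    have "(\<lambda>y. (b x * indicator (D (t * t\<^sup>\<star>)) y) * indicator ?N y) \<in> simple_fun h"
      by (intro simple_fun_mult_basic_diff M simple_fun_scale simple_fun_gen t)
    moreover have "(b x * indicator (D (t * t\<^sup>\<star>)) y) * indicator ?N y = b x * indicator ?N y" for y
      using M(5) by (auto simp: indicator_def)
    ultimately have "(\<lambda>y. b x * indicator ?N y) \<in> simple_fun h" by simp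
    moreover have "cmod (b y - b x) < \<epsilon>" if "y \<in> ?N" for y
      using M(5) that by (auto simp: dist_norm norm_minus_commute)
    moreover have "compact_open X ?N"
      using M(1-3) by (intro compact_open_Diff compact_open_UN compact_open_basic) auto
    then have "openin X ?N" by (simp add: compact_open_def)
    ultimately have "good ?N"
      unfolding good_def using simple_fun_mult_basic_diff[OF M(2,3) _ M(1)] by blast
    then show ?thesis using M(4) by blast
  qed
  then have "K \<subseteq> \<Union>{N. good N}" by blast
  moreover have "openin X N" if "N \<in> {N. good N}" for N using that by (simp add: good_def)
  ultimately have "\<exists>\<F>. finite \<F> \<and> \<F> \<subseteq> {N. good N} \<and> K \<subseteq> \<Union>\<F>"
    by (intro compactinD[OF K])
  then obtain \<F> where F: "finite \<F>" "\<F> \<subseteq> {N. good N}" "K \<subseteq> \<Union>\<F>"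
    by blast
  have "\<forall>N\<in>\<F>. good N" using F(2) by blast
  from union[OF F(1) this] obtain g where g0: "g \<in> simple_fun h"
    "\<forall>x. (x \<in> \<Union>\<F> \<longrightarrow> cmod (b x - g x) < \<epsilon>) \<and> (x \<notin> \<Union>\<F> \<longrightarrow> g x = 0)" by (rule bexE)
  have g: "g \<in> simple_fun h" "\<And>x. x \<in> \<Union>\<F> \<Longrightarrow> cmod (b x - g x) < \<epsilon>"
    "\<And>x. x \<notin> \<Union>\<F> \<Longrightarrow> g x = 0" using g0(1) spec[OF g0(2)] by simp_all
  have "cmod (b x - g x) < \<epsilon>" for x
  proof (cases "x \<in> \<Union>\<F>")
    case False
    then have "x \<notin> K" using F by blast
    then have "cmod (b x) < \<epsilon>" using C0D(3)[OF b0, of x] \<epsilon> by (cases "x \<in> topspace X") (auto simp: K_def)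
    then show ?thesis using g(3)[OF False] by simp
  qed (use g(2) in blast)
  then show ?thesis using g(1) by blast
qed

lemma alpha_basic:
  assumes t: "t \<noteq> 0" "univ_map t = h" and e: "e \<in> idempotents"
  shows "alpha h (indicator (D (e * (t * t\<^sup>\<star>)))) = indicator (D (t\<^sup>\<star> * e * t))"
  using univ_act_in_basic_iff[OF t e] by (auto simp: fun_eq_iff alpha_apply indicator_def)

lemma alpha_simple_fun_C0:
  assumes "f \<in> simple_fun h" shows "alpha h f \<in> C0 X"
  using assms
proof induction
  case zero
  have "alpha h (\<lambda>_. 0) = (\<lambda>_. 0)" by (auto simp: fun_eq_iff alpha_apply)
  then show ?case by (simp add: C0_zero)
next
  case (step t f c)
  have "alpha h (indicator (D (t * t\<^sup>\<star>))) = indicator (D (t\<^sup>\<star> * t))"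
    using alpha_basic[OF step(1,2), of "t * t\<^sup>\<star>"] by (simp add: mult.assoc star_assoc_props)
  moreover have "alpha h (\<lambda>x. c * indicator (D (t * t\<^sup>\<star>)) x + f x)
      = (\<lambda>x. c * alpha h (indicator (D (t * t\<^sup>\<star>))) x + alpha h f x)"
    by (auto simp: fun_eq_iff alpha_apply)
  ultimately show ?case
    using step.IH by (simp add: C0_add C0_scale indicator_C0 compact_open_basic)
qed

text \<open>Simple functions go to combinations of indicators of the sets D(t* t), and alpha does
  not increase the supremum norm, so uniform limits stay in C0. Continuity of the partial action
  thus enters only through \<open>univ_act_in_basic_iff\<close>.\<close>

lemma alpha_C0:
  assumes "b \<in> ideal h" shows "alpha h b \<in> C0 X"
proof (rule C0_uniform_limit)
  fix \<epsilon> :: real assume \<epsilon>: "0 < \<epsilon>"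
  from simple_fun_dense[OF assms \<epsilon>] obtain g
    where g: "g \<in> simple_fun h" "\<And>x. cmod (b x - g x) < \<epsilon>" by blast
  then show "\<exists>g\<in>C0 X. \<forall>x. cmod (alpha h b x - g x) < \<epsilon>"
    using \<epsilon> by (intro bexI[OF _ alpha_simple_fun_C0[OF g(1)]]) (auto simp: alpha_apply)
qed


subsection \<open>The strong limits\<close>

definition enum :: "nat \<Rightarrow> 's set" where
  "enum n = from_nat_into UNIV ` {..<n}"

lemma finite_enum: "finite (enum n)"
  by (simp add: enum_def)

lemma incseq_enum: "incseq enum"
  by (auto simp: enum_def incseq_def)

lemma from_nat_into_surj: "\<exists>k. s = from_nat_into (UNIV :: 's set) k"
proof -
  have "range (from_nat_into (UNIV :: 's set)) = UNIV"
    by (intro range_from_nat_into countable) simp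
  then show ?thesis by (metis UNIV_I imageE)
qed

lemma enum_exhausts: "\<exists>n. s \<in> enum n"
proof -
  obtain k where "s = from_nat_into UNIV k" using from_nat_into_surj by blast
  then show ?thesis by (intro exI[of _ "Suc k"]) (simp add: enum_def)
qed

definition fibre :: "nat \<Rightarrow> 's univ_group \<Rightarrow> 's set" where
  "fibre n h = {t \<in> enum n. t \<noteq> 0 \<and> univ_map t = h}"

lemma finite_fibre: "finite (fibre n h)"
  by (simp add: fibre_def finite_enum)

text \<open>Because S is countable, a union over all t above h, possibly infinite, becomes an
  increasing sequence of finite unions.\<close>

lemma exhausts_fibre:
  assumes "\<And>t. A t \<in> idempotents"
  shows "exhausts (\<lambda>n. \<Union>t\<in>fibre n h. D (A t)) (\<Union>t\<in>{t. t \<noteq> 0 \<and> univ_map t = h}. D (A t))"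
  unfolding exhausts_def
proof (intro conjI allI)
  show "incseq (\<lambda>n. \<Union>t\<in>fibre n h. D (A t))"
    using incseqD[OF incseq_enum] by (fastforce simp: incseq_def fibre_def)
  show "compact_open X (\<Union>t\<in>fibre n h. D (A t))" for n
    by (intro compact_open_UN finite_fibre compact_open_basic assms)
  show "(\<Union>n. \<Union>t\<in>fibre n h. D (A t)) = (\<Union>t\<in>{t. t \<noteq> 0 \<and> univ_map t = h}. D (A t))"
    using enum_exhausts by (fastforce simp: fibre_def)
qed

definition unit_set :: "'s univ_group \<Rightarrow> nat \<Rightarrow> ('s \<Rightarrow> bool) set" where
  "unit_set h n = (\<Union>t\<in>fibre n h. D (t * t\<^sup>\<star>))"

lemma exhausts_unit_set: "exhausts (unit_set h) (univ_dom h)"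
  unfolding unit_set_def[abs_def] univ_dom_eq by (rule exhausts_fibre) simp

lemma compact_open_unit_set: "compact_open X (unit_set h n)"
  using exhausts_unit_set by (simp add: exhausts_def)

lemma unit_set_ideal: "indicator (unit_set h n) \<in> ideal h"
  using exhausts_unit_set[of h] by (intro indicator_C0_ideal compact_open_unit_set) (auto simp: exhausts_def)

lemma exhausts_pullback:
  "e \<in> idempotents \<Longrightarrow> exhausts (\<lambda>n. \<Union>t\<in>fibre n h. D (t\<^sup>\<star> * e * t)) (pullback h e)"
  unfolding pullback_def by (rule exhausts_fibre) (rule conj_idempotent)

lemma alpha_basic_unit_set:
  assumes e: "e \<in> idempotents"
  shows "alpha h (\<lambda>x. indicator (D e) x * indicator (unit_set h n) x)
    = indicator (\<Union>t\<in>fibre n h. D (t\<^sup>\<star> * e * t))"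
proof -
  have "x \<in> univ_dom (- h) \<and> univ_act h x \<in> D e \<inter> unit_set h n \<longleftrightarrow>
      x \<in> (\<Union>t\<in>fibre n h. D (t\<^sup>\<star> * e * t))" for x
  proof -
    have "D e \<inter> unit_set h n = (\<Union>t\<in>fibre n h. D (e * (t * t\<^sup>\<star>)))"
      unfolding unit_set_def using e by (auto simp: spectrum_basic_mult)
    moreover have "(x \<in> univ_dom (- h) \<and> univ_act h x \<in> D (e * (t * t\<^sup>\<star>))) \<longleftrightarrow> x \<in> D (t\<^sup>\<star> * e * t)"
      if "t \<in> fibre n h" for t
      using that by (intro univ_act_in_basic_iff e) (auto simp: fibre_def)
    ultimately show ?thesis by auto
  qed
  then show ?thesis
    unfolding indicator_inter_arith[symmetric]
    by (auto simp: fun_eq_iff alpha_apply indicator_def)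
qed

lemma alpha_unit_set:
  "alpha h (indicator (unit_set h n)) = indicator (\<Union>t\<in>fibre n h. D (t\<^sup>\<star> * t))"
proof -
  have "x \<in> univ_dom (- h) \<and> univ_act h x \<in> unit_set h n \<longleftrightarrow> x \<in> (\<Union>t\<in>fibre n h. D (t\<^sup>\<star> * t))" for x
  proof -
    have "(x \<in> univ_dom (- h) \<and> univ_act h x \<in> D (t * t\<^sup>\<star>)) \<longleftrightarrow> x \<in> D (t\<^sup>\<star> * t)"
      if "t \<in> fibre n h" for t
      using univ_act_in_basic_iff[of t h "t * t\<^sup>\<star>" x] that
      by (simp add: fibre_def mult.assoc star_assoc_props)
    then show ?thesis unfolding unit_set_def by auto
  qed
  then show ?thesis by (auto simp: fun_eq_iff alpha_apply indicator_def)
qed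

lemma approx_unit_norm:
  assumes F: "approx_unit X (ideal h) F" and a: "a \<in> ideal h" and \<epsilon>: "0 < \<epsilon>"
  shows "\<forall>\<^sub>F u in F. \<forall>x. cmod (a x * u x - a x) < \<epsilon>"
proof -
  have ev: "\<forall>\<^sub>F u in F. u \<in> ideal h" using F by (auto simp: approx_unit_def elim: eventually_mono)
  have "((\<lambda>u. alg_norm (C0_alg X) (\<lambda>x. a x * u x - a x)) \<longlongrightarrow> 0) F"
    using F a by (simp add: approx_unit_def)
  from order_tendstoD(2)[OF this \<epsilon>] ev show ?thesis
  proof eventually_elim
    case (elim u)
    \<comment> \<open>Membership in C0 makes the supremum that defines the norm a genuine upper
      bound.\<close>
    have "(\<lambda>x. a x * u x - a x) \<in> C0 X"
      using elim(2) a by (intro C0_diff C0_mult C0_ideal_C0)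
    then have "cmod (a x * u x - a x) \<le> alg_norm (C0_alg X) (\<lambda>x. a x * u x - a x)" for x
      unfolding alg_norm_C0 by (intro cSUP_upper C0_bdd_above) auto
    then show ?case using elim(1) le_less_trans by blast
  qed
qed

text \<open>For a in the ideal the set |a| \<ge> \<epsilon>/2 is a compact subset of the domain of
  the inverse of h, hence inside \<open>unit_set h n\<close> for large n; elsewhere a is
  small.\<close>

lemma unit_set_approx_unit:
  "approx_unit X (ideal h) (filtermap (\<lambda>n. indicator (unit_set h n)) sequentially)"
  unfolding approx_unit_def
proof (intro conjI ballI)
  show "filtermap (\<lambda>n. indicator (unit_set h n)) sequentially \<noteq> (bot :: (('s \<Rightarrow> bool) \<Rightarrow> complex) filter)"
    by (simp add: filtermap_bot_iff)
  show "\<forall>\<^sub>F u in filtermap (\<lambda>n. indicator (unit_set h n)) sequentially.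
      u \<in> ideal h \<and> (\<forall>x. \<exists>r\<in>{0..1}. u x = complex_of_real r)"
    unfolding eventually_filtermap
  proof (intro always_eventually allI conjI unit_set_ideal)
    show "\<exists>r\<in>{0..1}. indicator (unit_set h n) x = complex_of_real r" for n x
      by (rule bexI[of _ "indicator (unit_set h n) x"]) (auto simp: indicator_def)
  qed
  fix a assume a: "a \<in> ideal h"
  have "(\<lambda>n. SUP x. cmod (a x * indicator (unit_set h n) x - a x)) \<longlonglongrightarrow> 0"
  proof (rule LIMSEQ_I)
    fix \<epsilon> :: real assume \<epsilon>: "0 < \<epsilon>"
    let ?K = "{x \<in> topspace X. \<epsilon> / 2 \<le> cmod (a x)}"
    have K: "compactin X ?K" using \<epsilon> by (intro C0D(2) C0_ideal_C0[OF a]) simp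
    have "?K \<subseteq> univ_dom h" using a \<epsilon> by (auto simp: C0_ideal_def)
    then have sub: "?K \<subseteq> (\<Union>n. unit_set h n)" using exhausts_unit_set[of h] by (simp add: exhausts_def)
    have inc: "incseq (unit_set h)" and op: "\<And>n. openin X (unit_set h n)"
      using exhausts_unit_set[of h] by (auto simp: exhausts_def compact_open_def)
    obtain N where N: "?K \<subseteq> unit_set h N" by (rule compactin_incseq_subset[OF K inc op sub])
    show "\<exists>N. \<forall>n\<ge>N. norm ((SUP x. cmod (a x * indicator (unit_set h n) x - a x)) - 0) < \<epsilon>"
    proof (intro exI allI impI)
      fix n assume "N \<le> n"
      then have sub: "?K \<subseteq> unit_set h n" using N incseqD[OF inc] by blast
      have le: "cmod (a x * indicator (unit_set h n) x - a x) \<le> \<epsilon> / 2" for x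
        using sub \<epsilon> C0D(3)[OF C0_ideal_C0[OF a], of x]
        by (cases "x \<in> topspace X"; cases "x \<in> unit_set h n") auto
      then have "(SUP x. cmod (a x * indicator (unit_set h n) x - a x)) \<le> \<epsilon> / 2"
        by (intro cSUP_least) auto
      moreover have "0 \<le> (SUP x. cmod (a x * indicator (unit_set h n) x - a x))"
        \<comment> \<open>Any point serves to bound the supremum from below by a norm.\<close>
        by (rule cSUP_upper2[where x = undefined]) (use le in \<open>auto intro: bdd_aboveI2[where M = "\<epsilon> / 2"]\<close>)
      ultimately show "norm ((SUP x. cmod (a x * indicator (unit_set h n) x - a x)) - 0) < \<epsilon>"
        using \<epsilon> by simp
    qed
  qed
  then show "((\<lambda>u. alg_norm (C0_alg X) (\<lambda>x. a x * u x - a x)) \<longlongrightarrow> 0)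
      (filtermap (\<lambda>n. indicator (unit_set h n)) sequentially)"
    unfolding filterlim_filtermap alg_norm_C0 .
qed

lemma rep_alpha_norm_le:
  assumes "b \<in> ideal h" "\<And>x. cmod (b x) \<le> B" "0 \<le> B"
  shows "norm (blinfun_apply (\<pi> (alpha h b)) v) \<le> B * norm v"
  by (rule rep_norm_le[OF alpha_C0[OF assms(1)]]) (use assms in \<open>auto simp: alpha_apply\<close>)

lemma rep_alpha_mult:
  assumes "b \<in> ideal h" "c \<in> ideal h"
  shows "\<pi> (alpha h (\<lambda>x. b x * c x)) = \<pi> (alpha h b) o\<^sub>L \<pi> (alpha h c)"
proof -
  have "alpha h (\<lambda>x. b x * c x) = (\<lambda>x. alpha h b x * alpha h c x)"
    by (auto simp: fun_eq_iff alpha_apply)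
  then show ?thesis using rep_mult[OF alpha_C0 alpha_C0, OF assms] by simp
qed

lemma rep_alpha_add:
  assumes "b \<in> ideal h" "c \<in> ideal h"
  shows "\<pi> (alpha h (\<lambda>x. b x + c x)) = \<pi> (alpha h b) + \<pi> (alpha h c)"
proof -
  have "alpha h (\<lambda>x. b x + c x) = (\<lambda>x. alpha h b x + alpha h c x)"
    by (auto simp: fun_eq_iff alpha_apply)
  then show ?thesis using rep_add[OF alpha_C0 alpha_C0, OF assms] by simp
qed

lemma rep_alpha_scale:
  assumes "b \<in> ideal h" shows "\<pi> (alpha h (\<lambda>x. c * b x)) = scale_op c (\<pi> (alpha h b))"
proof -
  have "alpha h (\<lambda>x. c * b x) = (\<lambda>x. c * alpha h b x)"
    by (auto simp: fun_eq_iff alpha_apply)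
  then show ?thesis using rep_scale[OF alpha_C0[OF assms]] by simp
qed

lemma rep_alpha_diff:
  assumes "b \<in> ideal h" "c \<in> ideal h"
  shows "\<pi> (alpha h (\<lambda>x. b x - c x)) = \<pi> (alpha h b) - \<pi> (alpha h c)"
  using rep_alpha_add[OF assms(1) C0_ideal_scale[OF assms(2), of "-1"]]
    rep_alpha_scale[OF assms(2), of "-1"] scale_op_add_left[of "-1" 1 "\<pi> (alpha h c)"]
  by (simp add: eq_neg_iff_add_eq_0[symmetric])

text \<open>The limit is taken first along an increasing sequence of projections, where convergence comes from
  monotonicity; on vectors fixed in the limit any other approximate unit is then uniformly close.\<close>

lemma rep_shift_exists:
  assumes a: "a \<in> C0 X"
  shows "\<exists>w. \<forall>F. approx_unit X (ideal h) F \<longrightarrow>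
    ((\<lambda>u. blinfun_apply (\<pi> (alpha h (\<lambda>x. a x * u x))) v) \<longlongrightarrow> w) F"
proof -
  obtain B where B: "0 \<le> B" "\<And>x. cmod (a x) \<le> B" using C0_bounded[OF a] by blast
  define u where "u n = (indicator (unit_set h n) :: _ \<Rightarrow> complex)" for n
  define T where "T b = blinfun_apply (\<pi> (alpha h b))" for b
  define s where "s n = T (u n) v" for n
  have u: "u n \<in> ideal h" for n by (simp add: u_def unit_set_ideal)
  have au: "(\<lambda>x. a x * b x) \<in> ideal h" if "b \<in> ideal h" for b by (rule C0_ideal_mult[OF a that])
  have bound: "norm (T (\<lambda>x. a x * u n x) w) \<le> B * norm w" for n w
    unfolding T_def
    by (rule rep_alpha_norm_le[OF au[OF u] _ B(1)])
      (use B in \<open>auto simp: u_def indicator_def\<close>)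
  have "convergent s"
  proof -
    have s_eq: "s = (\<lambda>n. set_proj (\<Union>t\<in>fibre n h. D (t\<^sup>\<star> * t)) v)"
      unfolding s_def[abs_def] T_def u_def alpha_unit_set ..
    show ?thesis unfolding s_eq
      using set_proj_incseq_convergent[of "\<lambda>n. \<Union>t\<in>fibre n h. D (t\<^sup>\<star> * t)" v]
        exhausts_fibre[of "\<lambda>t. t\<^sup>\<star> * t" h] by (simp add: exhausts_def)
  qed
  then obtain \<zeta> where \<zeta>: "s \<longlonglongrightarrow> \<zeta>" by (auto simp: convergent_def)
  have Tmult: "T (\<lambda>x. b x * c x) w = T b (T c w)" if "b \<in> ideal h" "c \<in> ideal h" for b c w
    unfolding T_def by (simp add: rep_alpha_mult[OF that])
  have uu: "u m x * u n x = u n x" if "n \<le> m" for m n x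
  proof -
    have "unit_set h n \<subseteq> unit_set h m"
      using exhausts_unit_set[of h] that by (auto simp: exhausts_def dest: incseqD)
    then show ?thesis by (auto simp: u_def indicator_def)
  qed
  \<comment> \<open>As u m u n = u n for n \<le> m, the difference is a uniformly bounded operator
    applied to s m - s n, and s converges.\<close>
  have diff: "T (\<lambda>x. a x * u m x) v - T (\<lambda>x. a x * u n x) v = T (\<lambda>x. a x * u m x) (s m - s n)"
    if "n \<le> m" for m n
  proof -
    have 1: "T (\<lambda>x. a x * u m x) (s m) = T (\<lambda>x. a x * u m x) v"
      using Tmult[OF au[OF u] u, of m m v] uu[of m m] by (simp add: s_def mult.assoc)
    have 2: "T (\<lambda>x. a x * u m x) (s n) = T (\<lambda>x. a x * u n x) v"
      using Tmult[OF au[OF u] u, of m n v] uu[OF that] by (simp add: s_def mult.assoc)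
    show ?thesis using 1 2 by (simp add: T_def blinfun.diff_right)
  qed
  have "Cauchy (\<lambda>n. T (\<lambda>x. a x * u n x) v)"
  proof (rule CauchyI)
    fix e :: real assume e: "0 < e"
    then have "0 < e / (B + 1)" using B by simp
    then obtain M where M: "\<And>m n. m \<ge> M \<Longrightarrow> n \<ge> M \<Longrightarrow> norm (s m - s n) < e / (B + 1)"
      using CauchyD[OF LIMSEQ_imp_Cauchy[OF \<zeta>]] by meson
    have *: "norm (T (\<lambda>x. a x * u m x) v - T (\<lambda>x. a x * u n x) v) < e" if "M \<le> n" "n \<le> m" for m n
    proof -
      have "norm (T (\<lambda>x. a x * u m x) v - T (\<lambda>x. a x * u n x) v) \<le> B * norm (s m - s n)"
        unfolding diff[OF that(2)] by (rule bound)
      also have "\<dots> \<le> (B + 1) * norm (s m - s n)" by (intro mult_right_mono) auto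
      also have "\<dots> < e" using M[of m n] that B by (simp add: field_simps)
      finally show ?thesis .
    qed
    show "\<exists>M. \<forall>m\<ge>M. \<forall>n\<ge>M. norm (T (\<lambda>x. a x * u m x) v - T (\<lambda>x. a x * u n x) v) < e"
    proof (intro exI allI impI)
      fix m n assume "M \<le> m" "M \<le> n"
      then show "norm (T (\<lambda>x. a x * u m x) v - T (\<lambda>x. a x * u n x) v) < e"
        using *[of m n] *[of n m] by (cases "n \<le> m") (auto simp: norm_minus_commute)
    qed
  qed
  then obtain w where w: "(\<lambda>n. T (\<lambda>x. a x * u n x) v) \<longlonglongrightarrow> w"
    by (auto simp: Cauchy_convergent_iff convergent_def)
  \<comment> \<open>\<zeta> is the projection of v to the subspace on which the ideal acts; elements
    of the ideal do not see the difference.\<close>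
  have T\<zeta>: "T b \<zeta> = T b v" if b: "b \<in> ideal h" for b
  proof (rule LIMSEQ_unique)
    show "(\<lambda>n. T b (s n)) \<longlonglongrightarrow> T b \<zeta>" unfolding T_def by (intro tendsto_intros \<zeta>)
    show "(\<lambda>n. T b (s n)) \<longlonglongrightarrow> T b v"
    proof (rule LIMSEQ_I)
      fix e :: real assume e: "0 < e"
      then have pos: "0 < e / (norm v + 1)" by (simp add: add_nonneg_pos)
      have "\<forall>\<^sub>F n in sequentially. \<forall>x. cmod (b x * u n x - b x) < e / (norm v + 1)"
        using approx_unit_norm[OF unit_set_approx_unit b pos] unfolding eventually_filtermap u_def .
      then obtain N where N: "\<And>n x. N \<le> n \<Longrightarrow> cmod (b x * u n x - b x) < e / (norm v + 1)"
        unfolding eventually_sequentially by blast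
      show "\<exists>N. \<forall>n\<ge>N. norm (T b (s n) - T b v) < e"
      proof (intro exI allI impI)
        fix n assume n: "N \<le> n"
        have bu: "(\<lambda>x. b x * u n x) \<in> ideal h" by (rule C0_ideal_mult[OF C0_ideal_C0[OF b] u])
        have bub: "(\<lambda>x. b x * u n x - b x) \<in> ideal h"
          using C0_ideal_add[OF bu C0_ideal_scale[OF b, of "-1"]] by simp
        have "T b (s n) - T b v = T (\<lambda>x. b x * u n x - b x) v"
          unfolding s_def Tmult[OF b u, symmetric]
          by (simp add: T_def rep_alpha_diff[OF bu b] blinfun.diff_left)
        also have "norm \<dots> \<le> e / (norm v + 1) * norm v"
          unfolding T_def using N[OF n] pos by (intro rep_alpha_norm_le bub) (auto intro: less_imp_le)
        also have "\<dots> < e" using e by (simp add: divide_less_eq add_nonneg_pos)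
        finally show "norm (T b (s n) - T b v) < e" .
      qed
    qed
  qed
  have "((\<lambda>k. T (\<lambda>x. a x * k x) v) \<longlongrightarrow> w) F" if F: "approx_unit X (ideal h) F" for F
  proof (rule tendstoI)
    fix e :: real assume e: "0 < e"
    \<comment> \<open>Three errors of size e/3: replacing v by s n, replacing a k u n by a u n, and
      the convergence of the chosen sequence. The summands 1 keep the denominators positive.\<close>
    have pos: "0 < e / 3 / (B + 1)" "0 < e / 3 / ((B + 1) * (norm v + 1))"
      using e B by (simp_all add: add_nonneg_pos)
    have "\<forall>\<^sub>F n in sequentially. dist (s n) \<zeta> < e / 3 / (B + 1)" using \<zeta> pos(1) by (rule tendstoD)
    moreover have "\<forall>\<^sub>F n in sequentially. dist (T (\<lambda>x. a x * u n x) v) w < e / 3"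
      using w e by (intro tendstoD) auto
    ultimately obtain n where n: "dist (s n) \<zeta> < e / 3 / (B + 1)" "dist (T (\<lambda>x. a x * u n x) v) w < e / 3"
      using eventually_happens[OF eventually_conj] by force
    have "\<forall>\<^sub>F k in F. k \<in> ideal h \<and> (\<forall>x. \<exists>r\<in>{0..1}. k x = complex_of_real r)"
      using F by (simp add: approx_unit_def)
    with approx_unit_norm[OF F u[of n] pos(2)]
    show "\<forall>\<^sub>F k in F. dist (T (\<lambda>x. a x * k x) v) w < e"
    proof eventually_elim
      case (elim k)
      have k: "k \<in> ideal h" "cmod (k x) \<le> 1" for x
        using elim(2) by (blast, metis atLeastAtMost_iff norm_of_real abs_of_nonneg)
      have ak: "(\<lambda>x. a x * k x) \<in> ideal h" by (rule au[OF k(1)])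
      have 1: "norm (T (\<lambda>x. a x * k x) v - T (\<lambda>x. a x * k x) (s n)) \<le> B * norm (s n - \<zeta>)"
      proof -
        have "T (\<lambda>x. a x * k x) v - T (\<lambda>x. a x * k x) (s n) = T (\<lambda>x. a x * k x) (\<zeta> - s n)"
          unfolding T\<zeta>[OF ak, symmetric] by (simp add: T_def blinfun.diff_right)
        also have "norm \<dots> \<le> B * norm (\<zeta> - s n)" unfolding T_def
          using B k(2) by (intro rep_alpha_norm_le[OF ak] B(1))
            (metis mult_left_le mult_mono norm_ge_zero norm_mult mult.right_neutral)
        finally show ?thesis by (simp add: norm_minus_commute)
      qed
      have aku: "(\<lambda>x. a x * k x * u n x) \<in> ideal h" by (rule C0_ideal_mult[OF C0_ideal_C0[OF ak] u])
      have "T (\<lambda>x. a x * k x) (s n) - T (\<lambda>x. a x * u n x) v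
          = T (\<lambda>x. a x * k x * u n x - a x * u n x) v"
        unfolding s_def Tmult[OF ak u, symmetric]
        by (simp add: T_def rep_alpha_diff[OF aku au[OF u]] blinfun.diff_left)
      also have "norm \<dots> \<le> (B * (e / 3 / ((B + 1) * (norm v + 1)))) * norm v"
        unfolding T_def
      proof (rule rep_alpha_norm_le)
        show "(\<lambda>x. a x * k x * u n x - a x * u n x) \<in> ideal h"
          using C0_ideal_add[OF aku C0_ideal_scale[OF au[OF u], of "-1"]] by simp
        show "0 \<le> B * (e / 3 / ((B + 1) * (norm v + 1)))" using B pos(2) by (intro mult_nonneg_nonneg) auto
        show "cmod (a x * k x * u n x - a x * u n x) \<le> B * (e / 3 / ((B + 1) * (norm v + 1)))" for x
        proof -
          have "a x * k x * u n x - a x * u n x = a x * (u n x * k x - u n x)" by (simp add: algebra_simps)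
          then show ?thesis
            using elim(1) B by (simp only: norm_mult) (intro mult_mono, auto intro: less_imp_le)
        qed
      qed
      also have "\<dots> \<le> e / 3"
      proof -
        have "B * norm v \<le> (B + 1) * (norm v + 1)" using B by (intro mult_mono) auto
        moreover have "0 < (B + 1) * (norm v + 1)" using B by (simp add: add_nonneg_pos)
        ultimately have "B * norm v / ((B + 1) * (norm v + 1)) \<le> 1" by simp
        from mult_left_mono[OF this, of "e / 3"] e show ?thesis by (simp add: ac_simps)
      qed
      finally have 2: "norm (T (\<lambda>x. a x * k x) (s n) - T (\<lambda>x. a x * u n x) v) \<le> e / 3" .
      have 3: "B * norm (s n - \<zeta>) < e / 3"
      proof -
        have "B * norm (s n - \<zeta>) \<le> (B + 1) * norm (s n - \<zeta>)" by (intro mult_right_mono) auto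
        also have "\<dots> < e / 3" using n(1) B by (simp add: dist_norm field_simps)
        finally show ?thesis .
      qed
      have "dist (T (\<lambda>x. a x * k x) v) w
          \<le> norm (T (\<lambda>x. a x * k x) v - T (\<lambda>x. a x * k x) (s n))
          + norm (T (\<lambda>x. a x * k x) (s n) - T (\<lambda>x. a x * u n x) v) + norm (T (\<lambda>x. a x * u n x) v - w)"
        unfolding dist_norm by norm
      then show ?case using 1 2 3 n(2) unfolding dist_norm by linarith
    qed
  qed
  then show ?thesis unfolding T_def by blast
qed

abbreviation shift :: "'s univ_group \<Rightarrow> (('s \<Rightarrow> bool) \<Rightarrow> complex) \<Rightarrow> 'h \<Rightarrow> 'h" where
  "shift h a \<equiv> rep_shift X univ_dom univ_act \<pi> h a"

text \<open>The quantifier over approximate units in \<open>rep_shift\<close> determines the vector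
  because \<open>unit_set\<close> provides one of them; from here on limits are computed along that
  sequence.\<close>

lemma rep_shift_lim:
  assumes a: "a \<in> C0 X"
  shows "(\<lambda>n. blinfun_apply (\<pi> (alpha h (\<lambda>x. a x * indicator (unit_set h n) x))) v) \<longlonglongrightarrow> shift h a v"
proof -
  let ?P = "\<lambda>w. \<forall>F. approx_unit X (ideal h) F \<longrightarrow>
    ((\<lambda>u. blinfun_apply (\<pi> (alpha h (\<lambda>x. a x * u x))) v) \<longlongrightarrow> w) F"
  have lim: "(\<lambda>n. blinfun_apply (\<pi> (alpha h (\<lambda>x. a x * indicator (unit_set h n) x))) v) \<longlonglongrightarrow> w"
    if "?P w" for w
    using that unit_set_approx_unit[of h] by (fastforce simp: filterlim_filtermap)
  obtain w where w: "?P w" using rep_shift_exists[OF a] by blast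
  have "?P (shift h a v)" unfolding rep_shift_def
    by (rule theI[of ?P]) (use w LIMSEQ_unique lim in blast)+
  then show ?thesis by (rule lim)
qed

lemma C0_unit_set_ideal:
  "a \<in> C0 X \<Longrightarrow> (\<lambda>x. a x * indicator (unit_set h n) x) \<in> ideal h"
  by (rule C0_ideal_mult[OF _ unit_set_ideal])

lemma shift_add_right: "a \<in> C0 X \<Longrightarrow> shift h a (v + w) = shift h a v + shift h a w"
  by (rule LIMSEQ_unique[OF rep_shift_lim])
    (auto simp: blinfun.add_right intro!: tendsto_add rep_shift_lim)

lemma shift_scale_right:
  assumes a: "a \<in> C0 X" shows "shift h a (c *\<^sub>C v) = c *\<^sub>C shift h a v"
proof (rule LIMSEQ_unique[OF rep_shift_lim[OF a]])
  have "\<pi> (alpha h (\<lambda>x. a x * indicator (unit_set h n) x)) \<in> bounded_ops" for n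
    by (intro rep_bounded_ops alpha_C0 C0_unit_set_ideal a)
  note bounded_opsD[OF this]
  then show "(\<lambda>n. blinfun_apply (\<pi> (alpha h (\<lambda>x. a x * indicator (unit_set h n) x))) (c *\<^sub>C v))
      \<longlonglongrightarrow> c *\<^sub>C shift h a v"
    by (simp only:) (intro tendsto_intros rep_shift_lim a)
qed

lemma shift_norm_le:
  assumes a: "a \<in> C0 X" and B: "\<And>x. cmod (a x) \<le> B" "0 \<le> B"
  shows "norm (shift h a v) \<le> B * norm v"
proof (rule LIMSEQ_le_const2[OF tendsto_norm[OF rep_shift_lim[OF a]]], intro exI allI impI)
  show "norm (blinfun_apply (\<pi> (alpha h (\<lambda>x. a x * indicator (unit_set h n) x))) v) \<le> B * norm v" for n
    by (rule rep_alpha_norm_le[OF C0_unit_set_ideal[OF a] _ B(2)])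
      (use B in \<open>auto simp: indicator_def\<close>)
qed

lemma shift_add_left:
  assumes a: "a \<in> C0 X" and b: "b \<in> C0 X"
  shows "shift h (\<lambda>x. a x + b x) v = shift h a v + shift h b v"
proof (rule LIMSEQ_unique[OF rep_shift_lim[OF C0_add[OF a b]]])
  have "\<pi> (alpha h (\<lambda>x. (a x + b x) * indicator (unit_set h n) x))
      = \<pi> (alpha h (\<lambda>x. a x * indicator (unit_set h n) x))
      + \<pi> (alpha h (\<lambda>x. b x * indicator (unit_set h n) x))" for n
    using rep_alpha_add[OF C0_unit_set_ideal[OF a] C0_unit_set_ideal[OF b], of h n]
    by (simp add: distrib_right)
  then show "(\<lambda>n. blinfun_apply (\<pi> (alpha h (\<lambda>x. (a x + b x) * indicator (unit_set h n) x))) v)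
      \<longlonglongrightarrow> shift h a v + shift h b v"
    by (simp only: blinfun.add_left) (intro tendsto_add rep_shift_lim a b)
qed

lemma shift_scale_left:
  assumes a: "a \<in> C0 X" shows "shift h (\<lambda>x. c * a x) v = c *\<^sub>C shift h a v"
proof (rule LIMSEQ_unique[OF rep_shift_lim[OF C0_scale[OF a]]])
  have "\<pi> (alpha h (\<lambda>x. c * a x * indicator (unit_set h n) x))
      = scale_op c (\<pi> (alpha h (\<lambda>x. a x * indicator (unit_set h n) x)))" for n
    using rep_alpha_scale[OF C0_unit_set_ideal[OF a], of h c] by (simp add: mult.assoc)
  then show "(\<lambda>n. blinfun_apply (\<pi> (alpha h (\<lambda>x. c * a x * indicator (unit_set h n) x))) v)
      \<longlonglongrightarrow> c *\<^sub>C shift h a v"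
    by (simp only: scale_op_apply) (intro tendsto_intros rep_shift_lim a)
qed

text \<open>In the coordinate h the indicator of D(e) acts as the projection belonging to the set of
  points that h moves into D(e).\<close>

lemma shift_basic:
  assumes e: "e \<in> idempotents"
  shows "shift h (indicator (D e)) v = open_proj (pullback h e) v"
  by (rule LIMSEQ_unique[OF rep_shift_lim[OF indicator_C0[OF compact_open_basic[OF e]]]])
    (simp only: alpha_basic_unit_set[OF e] open_proj_lim[OF exhausts_pullback[OF e]])

section \<open>Operators of the crossed product on l^2(G, H)\<close>

abbreviation crossed :: "(('s \<Rightarrow> bool) \<Rightarrow> complex) \<Rightarrow> 's univ_group \<Rightarrow>
    ('s univ_group, 'h) l2 \<Rightarrow>\<^sub>L ('s univ_group, 'h) l2" where
  "crossed \<equiv> crossed_op X univ_dom univ_act \<pi>"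

lemma crossed_op_props:
  assumes a: "a \<in> C0 X"
  shows "crossed a g \<in> bounded_ops"
    and "l2_nth (blinfun_apply (crossed a g) \<xi>) h = shift h a (l2_nth \<xi> (- g + h))"
    and "(\<And>x. cmod (a x) \<le> B) \<Longrightarrow> norm (crossed a g) \<le> B"
proof -
  let ?P = "\<lambda>T. T \<in> bounded_ops \<and>
    (\<forall>\<xi> h. l2_nth (blinfun_apply T \<xi>) h = shift h a (l2_nth \<xi> (- g + h)))"
  have ex: "\<exists>T. ?P T \<and> norm T \<le> B" if B: "\<And>x. cmod (a x) \<le> B" for B
  proof -
    have B0: "0 \<le> B" using B norm_ge_zero order_trans by blast
    show ?thesis
      by (rule l2_reindexed_operator[of "\<lambda>h. shift h a" B "\<lambda>h. - g + h" UNIV])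
        (use a B B0 in \<open>auto simp: shift_add_right shift_scale_right shift_norm_le inj_on_def\<close>)
  qed
  have uniq: "S = T" if "?P S" "?P T" for S T
  proof (rule blinfun_eqI, rule l2_eqI)
    show "l2_nth (blinfun_apply S \<xi>) h = l2_nth (blinfun_apply T \<xi>) h" for \<xi> h
      using that by simp
  qed
  have eq: "crossed a g = T" if "?P T" for T
    unfolding crossed_op_def by (rule the_equality) (use that uniq in blast)+
  obtain B where "\<And>x. cmod (a x) \<le> B" using C0_bounded[OF a] by blast
  from ex[OF this] obtain T where "?P T" by blast
  with eq[OF this] have P: "?P (crossed a g)" by simp
  then show "crossed a g \<in> bounded_ops"
    and "l2_nth (blinfun_apply (crossed a g) \<xi>) h = shift h a (l2_nth \<xi> (- g + h))" by auto
  show "norm (crossed a g) \<le> B" if B: "\<And>x. cmod (a x) \<le> B" for B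
    using ex[OF B] eq by auto
qed

lemma crossed_add:
  "a \<in> C0 X \<Longrightarrow> b \<in> C0 X \<Longrightarrow> crossed (\<lambda>x. a x + b x) g = crossed a g + crossed b g"
  by (rule blinfun_eqI, rule l2_eqI)
    (simp add: blinfun.add_left crossed_op_props C0_add shift_add_left)

lemma crossed_scale:
  "a \<in> C0 X \<Longrightarrow> crossed (\<lambda>x. c * a x) g = scale_op c (crossed a g)"
  by (rule blinfun_eqI, rule l2_eqI) (simp add: crossed_op_props C0_scale shift_scale_left)

lemma crossed_zero: "crossed (\<lambda>_. 0) g = 0"
  using crossed_scale[OF C0_zero, of 0 g] by simp

lemma crossed_diff_norm_le:
  assumes a: "a \<in> C0 X" and b: "b \<in> C0 X" and B: "\<And>x. cmod (a x - b x) \<le> B"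
  shows "norm (crossed a g - crossed b g) \<le> B"
proof -
  have "crossed a g = crossed (\<lambda>x. a x - b x) g + crossed b g"
    using crossed_add[OF C0_diff[OF a b] b, of g] by simp
  then show ?thesis using crossed_op_props(3)[OF C0_diff[OF a b] B, of g] by simp
qed

definition Vop :: "'s \<Rightarrow> ('s univ_group, 'h) l2 \<Rightarrow>\<^sub>L ('s univ_group, 'h) l2" where
  "Vop s = crossed (indicator (D (s * s\<^sup>\<star>))) (univ_map s)"

lemma basic_C0: "e \<in> idempotents \<Longrightarrow> indicator (D e) \<in> C0 X"
  by (intro indicator_C0 compact_open_basic)

lemma Vop_bounded_ops: "Vop s \<in> bounded_ops"
  unfolding Vop_def by (intro crossed_op_props(1) basic_C0) simp

lemma Vop_nth:
  "l2_nth (blinfun_apply (Vop s) \<xi>) h = open_proj (pullback h (s * s\<^sup>\<star>)) (l2_nth \<xi> (- univ_map s + h))"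
  unfolding Vop_def by (simp add: crossed_op_props(2) basic_C0 shift_basic)

text \<open>In contrast, \<open>Lambda 0\<close> is the projection onto the coordinate 0.\<close>

lemma Vop_zero: "Vop 0 = 0"
proof -
  have "(indicator {} :: ('s \<Rightarrow> bool) \<Rightarrow> complex) = (\<lambda>_. 0)" by auto
  then show ?thesis by (simp add: Vop_def crossed_zero)
qed

subsection \<open>The spanning partial isometries\<close>

lemma left_mult_inverse:
  fixes s r :: 's
  assumes "s * s\<^sup>\<star> * r = r"
  shows "s * (s\<^sup>\<star> * r) = r" "(s\<^sup>\<star> * r)\<^sup>\<star> * (s\<^sup>\<star> * r) = r\<^sup>\<star> * r"
    "r \<noteq> 0 \<Longrightarrow> s\<^sup>\<star> * r \<noteq> 0" "r \<noteq> 0 \<Longrightarrow> s \<noteq> 0"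
    "r \<noteq> 0 \<Longrightarrow> univ_map (s\<^sup>\<star> * r) = - univ_map s + univ_map r"
proof -
  show 1: "s * (s\<^sup>\<star> * r) = r" using assms by (simp add: mult.assoc)
  then show "(s\<^sup>\<star> * r)\<^sup>\<star> * (s\<^sup>\<star> * r) = r\<^sup>\<star> * r" by (simp add: star_mult mult.assoc)
  show "r \<noteq> 0 \<Longrightarrow> s\<^sup>\<star> * r \<noteq> 0" "r \<noteq> 0 \<Longrightarrow> s \<noteq> 0" using 1 by auto
  then show "r \<noteq> 0 \<Longrightarrow> univ_map (s\<^sup>\<star> * r) = - univ_map s + univ_map r"
    by (simp add: univ_map_mult univ_map_star)
qed

text \<open>Over the pure semigroup, \<open>r\<close> is determined by \<open>univ_map r\<close> and \<open>r\<^sup>* r\<close>; this set records which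
  \<open>r\<close> over \<open>h\<close> satisfy \<open>e r = r\<close>.\<close>

definition J :: "'s univ_group \<Rightarrow> 's \<Rightarrow> 's set" where
  "J h e = {r\<^sup>\<star> * r | r. r \<noteq> 0 \<and> univ_map r = h \<and> e * r = r}"

lemma J_idempotent: "f \<in> J h e \<Longrightarrow> f \<in> idempotents" "f \<in> J h e \<Longrightarrow> f \<noteq> 0"
proof -
  assume "f \<in> J h e"
  then obtain r where r: "f = r\<^sup>\<star> * r" "r \<noteq> 0" by (auto simp: J_def)
  then show "f \<in> idempotents" by simp
  show "f \<noteq> 0"
  proof
    assume "f = 0"
    then have "r * (r\<^sup>\<star> * r) = 0" using r by simp
    then show False using r by (simp add: star_assoc_props)
  qed
qed

text \<open>The restriction \<open>r * g\<close> of a witness r has source f g and lies over the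
  same group element.\<close>

lemma J_down_closed:
  assumes "f \<in> J h e" "g \<in> idempotents" "f * g \<noteq> 0" shows "f * g \<in> J h e"
proof -
  obtain r where r: "f = r\<^sup>\<star> * r" "r \<noteq> 0" "univ_map r = h" "e * r = r" using assms(1) by (auto simp: J_def)
  have d: "(r * g)\<^sup>\<star> * (r * g) = f * g" using domain_restrict[OF assms(2), of r] r by simp
  then have "r * g \<noteq> 0" using assms(3) by auto
  moreover from this have "univ_map (r * g) = h" using r univ_map_restrict[OF _ assms(2)] by simp
  moreover have "e * (r * g) = r * g" using r(4) by (metis mult.assoc)
  ultimately show ?thesis using d by (auto simp: J_def intro!: exI[of _ "r * g"])
qed

text \<open>Replacing t by \<open>e * t\<close> turns \<open>t\<^sup>\<star> * e * t\<close> into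
  the source of an element fixed by e.\<close>

lemma pullback_eq_J:
  assumes e: "e \<in> idempotents" shows "pullback h e = (\<Union>f\<in>J h e. D f)"
proof (intro equalityI subsetI)
  fix x assume "x \<in> pullback h e"
  then obtain t where t: "t \<noteq> 0" "univ_map t = h" "x \<in> D (t\<^sup>\<star> * e * t)" by (auto simp: pullback_def)
  have d: "(e * t)\<^sup>\<star> * (e * t) = t\<^sup>\<star> * e * t"
    by (simp add: star_mult idempotent_star e mult.assoc idempotentsD)
  with t(3) have "e * t \<noteq> 0" by auto
  then have "t\<^sup>\<star> * e * t \<in> J h e"
    using t e d by (auto simp: J_def univ_map_restrict_left idempotentsD intro!: exI[of _ "e * t"])
  then show "x \<in> (\<Union>f\<in>J h e. D f)" using t by blast
next
  fix x assume "x \<in> (\<Union>f\<in>J h e. D f)"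
  then obtain r where r: "r \<noteq> 0" "univ_map r = h" "e * r = r" "x \<in> D (r\<^sup>\<star> * r)" by (auto simp: J_def)
  then have "x \<in> D (r\<^sup>\<star> * e * r)" by (simp add: mult.assoc)
  then show "x \<in> pullback h e" using r by (auto simp: pullback_def)
qed

text \<open>Cut the two witnesses r and q down to a common source. Then
  \<open>s\<^sup>\<star> * r\<close> and q agree in group element and source, hence are equal, and
  \<open>range_mult_iff\<close> joins the two conditions into one for st.\<close>

lemma pullback_IntD:
  assumes "x \<in> pullback h (s * s\<^sup>\<star>)" "x \<in> pullback (- univ_map s + h) (t * t\<^sup>\<star>)"
  shows "\<exists>r. r \<noteq> 0 \<and> univ_map r = h \<and> (s * t) * (s * t)\<^sup>\<star> * r = r \<and> x \<in> D (r\<^sup>\<star> * r)"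
proof -
  obtain f where f: "f \<in> J h (s * s\<^sup>\<star>)" "x \<in> D f" using assms(1) by (auto simp: pullback_eq_J)
  obtain f' where f': "f' \<in> J (- univ_map s + h) (t * t\<^sup>\<star>)" "x \<in> D f'"
    using assms(2) by (auto simp: pullback_eq_J)
  have E: "f \<in> idempotents" "f' \<in> idempotents" using f f' J_idempotent by auto
  have xff: "x \<in> D (f * f')" using E f f' by (simp add: spectrum_basic_mult)
  then have nz: "f * f' \<noteq> 0" by auto
  have comm: "f' * f = f * f'" using E by (intro idempotents_commute)
  obtain r where r: "f * f' = r\<^sup>\<star> * r" "r \<noteq> 0" "univ_map r = h" "s * s\<^sup>\<star> * r = r"
    using J_down_closed[OF f(1) E(2) nz] by (auto simp: J_def)
  obtain q where q: "f * f' = q\<^sup>\<star> * q" "q \<noteq> 0" "univ_map q = - univ_map s + h" "t * t\<^sup>\<star> * q = q"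
    using J_down_closed[OF f'(1) E(1)] nz by (auto simp: J_def comm)
  note lm = left_mult_inverse[OF r(4)]
  have eq: "s\<^sup>\<star> * r = q"
  proof (rule univ_map_inj)
    show "s\<^sup>\<star> * r \<noteq> 0" "q \<noteq> 0" using lm(3) r(2) q(2) by auto
    show "univ_map (s\<^sup>\<star> * r) = univ_map q" using lm(5)[OF r(2)] r(3) q(3) by simp
    show "(s\<^sup>\<star> * r)\<^sup>\<star> * (s\<^sup>\<star> * r) = q\<^sup>\<star> * q" using lm(2) r(1) q(1) by simp
  qed
  have "(s * t) * (s * t)\<^sup>\<star> * r = r" using r(4) q(4) eq by (simp add: range_mult_iff)
  then show ?thesis using r xff by auto
qed

lemma pullback_Int_zero:
  "s * t = 0 \<Longrightarrow> pullback h (s * s\<^sup>\<star>) \<inter> pullback (- univ_map s + h) (t * t\<^sup>\<star>) = {}"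
  using pullback_IntD by fastforce

lemma pullback_Int:
  assumes st: "s * t \<noteq> 0"
  shows "pullback h (s * s\<^sup>\<star>) \<inter> pullback (- univ_map s + h) (t * t\<^sup>\<star>)
    = pullback h ((s * t) * (s * t)\<^sup>\<star>)"
proof (intro equalityI subsetI)
  fix x assume "x \<in> pullback h (s * s\<^sup>\<star>) \<inter> pullback (- univ_map s + h) (t * t\<^sup>\<star>)"
  then show "x \<in> pullback h ((s * t) * (s * t)\<^sup>\<star>)"
    using pullback_IntD[of x h s t] by (auto simp: pullback_eq_J J_def)
next
  fix x assume "x \<in> pullback h ((s * t) * (s * t)\<^sup>\<star>)"
  then obtain r where r: "r \<noteq> 0" "univ_map r = h" "(s * t) * (s * t)\<^sup>\<star> * r = r" "x \<in> D (r\<^sup>\<star> * r)"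
    by (auto simp: pullback_eq_J J_def)
  from r(3) have sr: "s * s\<^sup>\<star> * r = r" and tr: "t * t\<^sup>\<star> * (s\<^sup>\<star> * r) = s\<^sup>\<star> * r"
    by (auto simp: range_mult_iff)
  note lm = left_mult_inverse[OF sr]
  have "r\<^sup>\<star> * r \<in> J h (s * s\<^sup>\<star>)" using r sr by (auto simp: J_def)
  moreover have "r\<^sup>\<star> * r \<in> J (- univ_map s + h) (t * t\<^sup>\<star>)"
    unfolding J_def using lm(2,3,5) r(1,2) tr by (intro CollectI exI[of _ "s\<^sup>\<star> * r"]) simp
  ultimately show "x \<in> pullback h (s * s\<^sup>\<star>) \<inter> pullback (- univ_map s + h) (t * t\<^sup>\<star>)"
    using r(4) by (auto simp: pullback_eq_J)
qed

lemma Vop_mult: "Vop s o\<^sub>L Vop t = Vop (s * t)"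
proof (rule blinfun_eqI, rule l2_eqI)
  fix \<xi> h
  have L: "l2_nth (blinfun_apply (Vop s o\<^sub>L Vop t) \<xi>) h
      = open_proj (pullback h (s * s\<^sup>\<star>) \<inter> pullback (- univ_map s + h) (t * t\<^sup>\<star>))
          (l2_nth \<xi> (- univ_map t + (- univ_map s + h)))"
    by (simp add: Vop_nth open_proj_Int[OF exhausts_pullback exhausts_pullback])
  show "l2_nth (blinfun_apply (Vop s o\<^sub>L Vop t) \<xi>) h = l2_nth (blinfun_apply (Vop (s * t)) \<xi>) h"
  \<comment> \<open>\<open>univ_map\<close> is multiplicative only where st is non-zero; otherwise
    the two pullbacks are disjoint.\<close>
  proof (cases "s * t = 0")
    case True
    then show ?thesis unfolding L by (simp add: pullback_Int_zero Vop_zero)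
  next
    case False
    then show ?thesis
      unfolding L pullback_Int[OF False] Vop_nth 
      by (simp add: univ_map_mult minus_add add.assoc del: add_uminus_conv_diff)
  qed
qed

lemma pullback_star:
  assumes "s \<noteq> 0" shows "pullback (univ_map s + k) (s * s\<^sup>\<star>) = pullback k (s\<^sup>\<star> * s)"
proof -
  have sub: "pullback (univ_map s + k) (s * s\<^sup>\<star>) \<subseteq> pullback k (s\<^sup>\<star> * s)" if "s \<noteq> 0" for s k
  proof
    fix x assume "x \<in> pullback (univ_map s + k) (s * s\<^sup>\<star>)"
    then obtain r where r: "r \<noteq> 0" "univ_map r = univ_map s + k" "s * s\<^sup>\<star> * r = r" "x \<in> D (r\<^sup>\<star> * r)"
      by (auto simp: pullback_eq_J J_def)
    note lm = left_mult_inverse[OF r(3)]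
    have "s\<^sup>\<star> * s * (s\<^sup>\<star> * r) = s\<^sup>\<star> * r" by (simp add: mult.assoc star_assoc_props)
    then have "r\<^sup>\<star> * r \<in> J k (s\<^sup>\<star> * s)"
      using lm r by (auto simp: J_def add.assoc[symmetric] intro!: exI[of _ "s\<^sup>\<star> * r"])
    then show "x \<in> pullback k (s\<^sup>\<star> * s)" using r by (auto simp: pullback_eq_J)
  qed
  have "pullback k (s\<^sup>\<star> * s) \<subseteq> pullback (univ_map s + k) (s * s\<^sup>\<star>)"
    using sub[of "s\<^sup>\<star>" "univ_map s + k"] assms by (simp add: univ_map_star add.assoc[symmetric])
  then show ?thesis using sub[OF assms] by blast
qed

lemma Vop_star: "adj_op (Vop s) = Vop (s\<^sup>\<star>)"
proof (cases "s = 0")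
  case True
  then show ?thesis by (simp add: Vop_zero)
next
  case False
  let ?g = "univ_map s"
  show ?thesis
  proof (rule adj_op_unique)
    fix x y
    have "cinner (blinfun_apply (Vop s) x) y
        = (\<Sum>\<^sub>\<infinity>h. cinner (open_proj (pullback h (s * s\<^sup>\<star>)) (l2_nth x (- ?g + h))) (l2_nth y h))"
      by (simp add: cinner_l2.rep_eq Vop_nth)
    also have "\<dots> = (\<Sum>\<^sub>\<infinity>h. cinner (l2_nth x (- ?g + h)) (open_proj (pullback h (s * s\<^sup>\<star>)) (l2_nth y h)))"
      by (simp add: open_proj_selfadjoint[OF exhausts_pullback])
    also have "\<dots> = (\<Sum>\<^sub>\<infinity>k. cinner (l2_nth x k) (open_proj (pullback (?g + k) (s * s\<^sup>\<star>)) (l2_nth y (?g + k))))"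
      by (rule infsum_reindex_bij_witness[of _ "\<lambda>k. ?g + k" "\<lambda>h. - ?g + h"])
        (auto simp: add.assoc[symmetric])
    also have "\<dots> = cinner x (blinfun_apply (Vop (s\<^sup>\<star>)) y)"
      using False by (simp add: cinner_l2.rep_eq Vop_nth pullback_star univ_map_star)
    finally show "cinner (blinfun_apply (Vop s) x) y = cinner x (blinfun_apply (Vop (s\<^sup>\<star>)) y)" .
  qed
qed

end

section \<open>The regular representation of the semigroup\<close>

text \<open>The definition moves basis vectors forward along t \<mapsto> st, the coordinate formula
  pulls back along r \<mapsto> s* r; these are mutually inverse bijections between the t with s* s t
  = t and the r with s s* r = r.\<close>

lemma Lambda_props:
  fixes s :: "'s::inverse_semigroup_0"
  shows "Lambda s \<in> bounded_ops" "norm (Lambda s) \<le> 1"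
    "l2_nth (blinfun_apply (Lambda s) \<xi>) r = (if s * s\<^sup>\<star> * r = r then l2_nth \<xi> (s\<^sup>\<star> * r) else 0)"
proof -
  let ?P = "\<lambda>T. T \<in> bounded_ops \<and>
    (\<forall>t. blinfun_apply T (delta t) = (if s\<^sup>\<star> * s * t = t then delta (s * t) else 0))"
  have inj: "inj_on (\<lambda>r. s\<^sup>\<star> * r) {r. s * s\<^sup>\<star> * r = r}"
  proof (rule inj_onI)
    fix r q assume "r \<in> {r. s * s\<^sup>\<star> * r = r}" "q \<in> {r. s * s\<^sup>\<star> * r = r}" "s\<^sup>\<star> * r = s\<^sup>\<star> * q"
    then have "r = s * (s\<^sup>\<star> * r)" "q = s * (s\<^sup>\<star> * r)" by (simp_all add: mult.assoc)
    then show "r = q" by simp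
  qed
  have "\<exists>T :: ('s, complex) l2 \<Rightarrow>\<^sub>L ('s, complex) l2. T \<in> bounded_ops \<and> norm T \<le> 1 \<and> (\<forall>\<xi> r.
      l2_nth (blinfun_apply T \<xi>) r = (if s * s\<^sup>\<star> * r = r then l2_nth \<xi> (s\<^sup>\<star> * r) else 0))"
    by (rule l2_reindexed_operator[of "\<lambda>r v. if s * s\<^sup>\<star> * r = r then v else (0 :: complex)" 1
          "\<lambda>r. s\<^sup>\<star> * r" "{r. s * s\<^sup>\<star> * r = r}"]) (use inj in auto)
  then obtain T :: "('s, complex) l2 \<Rightarrow>\<^sub>L ('s, complex) l2"
    where T': "T \<in> bounded_ops \<and> norm T \<le> 1 \<and> (\<forall>\<xi> r.
      l2_nth (blinfun_apply T \<xi>) r = (if s * s\<^sup>\<star> * r = r then l2_nth \<xi> (s\<^sup>\<star> * r) else 0))"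
    by (rule exE)
  then have T: "T \<in> bounded_ops" "norm T \<le> 1"
    "\<And>\<xi> r. l2_nth (blinfun_apply T \<xi>) r = (if s * s\<^sup>\<star> * r = r then l2_nth \<xi> (s\<^sup>\<star> * r) else 0)"
    by auto
  have "blinfun_apply T (delta t) = (if s\<^sup>\<star> * s * t = t then delta (s * t) else 0)" for t
  proof (rule l2_eqI)
    fix r
    have 1: "(s * s\<^sup>\<star> * r = r \<and> s\<^sup>\<star> * r = t) \<longleftrightarrow> (s\<^sup>\<star> * s * t = t \<and> r = s * t)"
    proof
      assume "s * s\<^sup>\<star> * r = r \<and> s\<^sup>\<star> * r = t"
      then show "s\<^sup>\<star> * s * t = t \<and> r = s * t" by (auto simp: mult.assoc)
    next
      assume "s\<^sup>\<star> * s * t = t \<and> r = s * t"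
      then show "s * s\<^sup>\<star> * r = r \<and> s\<^sup>\<star> * r = t" by (metis mult.assoc)
    qed
    show "l2_nth (blinfun_apply T (delta t)) r
        = l2_nth (if s\<^sup>\<star> * s * t = t then delta (s * t) else 0) r"
      unfolding T(3) using 1 by (auto simp: l2_nth_delta)
  qed
  then have P: "?P T" using T(1) by blast
  have "Lambda s = T" unfolding Lambda_def
    by (rule the_equality[of ?P, OF P]) (rule bounded_ops_eq_if_eq_on_delta, use T(1) P in auto)
  then show "Lambda s \<in> bounded_ops" "norm (Lambda s) \<le> 1"
    "l2_nth (blinfun_apply (Lambda s) \<xi>) r = (if s * s\<^sup>\<star> * r = r then l2_nth \<xi> (s\<^sup>\<star> * r) else 0)"
    using T by simp_all
qed

lemma Lambda_mult: "Lambda s o\<^sub>L Lambda t = Lambda (s * t)"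
  by (rule blinfun_eqI, rule l2_eqI)
    (use range_mult_iff[of s t] in \<open>auto simp: Lambda_props(3) star_mult mult.assoc\<close>)

lemma Lambda_star: "adj_op (Lambda s) = Lambda (s\<^sup>\<star>)"
proof (rule adj_op_unique)
  fix x y
  have "cinner (blinfun_apply (Lambda s) x) y
      = (\<Sum>\<^sub>\<infinity>r\<in>{r. s * s\<^sup>\<star> * r = r}. cnj (l2_nth x (s\<^sup>\<star> * r)) * l2_nth y r)"
    unfolding cinner_l2.rep_eq
    by (intro infsum_cong_neutral) (auto simp: Lambda_props(3) cinner_complex_def)
  also have "\<dots> = (\<Sum>\<^sub>\<infinity>t\<in>{t. s\<^sup>\<star> * s * t = t}. cnj (l2_nth x t) * l2_nth y (s * t))"
    by (rule infsum_reindex_bij_witness[of _ "\<lambda>t. s * t" "\<lambda>r. s\<^sup>\<star> * r"])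
      (auto simp: mult.assoc star_assoc_props)
  also have "\<dots> = cinner x (blinfun_apply (Lambda (s\<^sup>\<star>)) y)"
    unfolding cinner_l2.rep_eq
    by (intro infsum_cong_neutral) (auto simp: Lambda_props(3) cinner_complex_def)
  finally show "cinner (blinfun_apply (Lambda s) x) y = cinner x (blinfun_apply (Lambda (s\<^sup>\<star>)) y)" .
qed

definition off_zero :: "('s::inverse_semigroup_0, complex) l2 \<Rightarrow>\<^sub>L ('s, complex) l2" where
  "off_zero = id_blinfun - Lambda 0"

lemma off_zero_nth: "l2_nth (blinfun_apply off_zero \<xi>) r = (if r = 0 then 0 else l2_nth \<xi> r)"
  by (auto simp: off_zero_def blinfun.diff_left Lambda_props(3))

lemma norm_off_zero_apply: "norm (blinfun_apply off_zero \<xi>) \<le> norm \<xi>"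
proof (rule l2_norm_le)
  fix F :: "'a set" assume "finite F"
  have "(\<Sum>r\<in>F. (norm (l2_nth (blinfun_apply off_zero \<xi>) r))\<^sup>2) \<le> (\<Sum>r\<in>F. (norm (l2_nth \<xi> r))\<^sup>2)"
    by (intro sum_mono) (simp add: off_zero_nth)
  also have "\<dots> \<le> (norm \<xi>)\<^sup>2" using \<open>finite F\<close> by (rule l2_sum_le_norm)
  finally show "(\<Sum>r\<in>F. (norm (l2_nth (blinfun_apply off_zero \<xi>) r))\<^sup>2) \<le> (norm \<xi>)\<^sup>2" .
qed simp

lemma finite_semilattice_least:
  fixes A :: "'s::inverse_semigroup_0 set"
  assumes "finite A" "A \<noteq> {}" "A \<subseteq> idempotents" "\<And>a b. a \<in> A \<Longrightarrow> b \<in> A \<Longrightarrow> a * b \<in> A"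
  shows "\<exists>e\<in>A. \<forall>a\<in>A. e * a = e"
proof -
  have "\<exists>e\<in>A. \<forall>b\<in>B. e * b = e" if "finite B" "B \<subseteq> A" for B
    using that
  proof (induction B rule: finite_induct)
    case empty
    then show ?case using assms(2) by blast
  next
    case (insert b B)
    then obtain e where e: "e \<in> A" "\<forall>b\<in>B. e * b = e" by blast
    have "e * b * a = e * b" if "a \<in> insert b B" for a
    proof (cases "a = b")
      case True
      then show ?thesis using insert.prems assms(3) by (auto simp: mult.assoc idempotentsD)
    next
      case False
      then have a: "e * a = e" "a \<in> A" using e that insert.prems by auto
      have "b * a = a * b" using a(2) insert.prems assms(3) by (intro idempotents_commute) auto
      then show ?thesis using a(1) by (metis mult.assoc)
    qed
    then show ?case using assms(4) e(1) insert.prems by (intro bexI[of _ "e * b"]) auto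
  qed
  from this[OF assms(1) order_refl] show ?thesis .
qed

section \<open>Finite semilattices of idempotents and their atoms\<close>

context spectrum_rep
begin

definition idem_enum :: "nat \<Rightarrow> 's" where
  "idem_enum n = (from_nat_into UNIV n)\<^sup>\<star> * from_nat_into UNIV n"

text \<open>Finite subsemilattices exhausting the idempotents: closure under products makes the atoms of the
  Boolean algebra generated by the sets \<open>D(f)\<close> correspond to the idempotents \<open>f\<close> themselves.\<close>

primrec meets :: "nat \<Rightarrow> 's set" where
  "meets 0 = {}"
| "meets (Suc n) = insert (idem_enum n) (meets n \<union> (\<lambda>f. idem_enum n * f) ` meets n)"

lemma idem_enum_idempotent: "idem_enum n \<in> idempotents"
  by (simp add: idem_enum_def)

lemma meets_idempotents: "meets n \<subseteq> idempotents"
  by (induction n) (auto simp: idem_enum_idempotent idempotents_mult)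

lemma finite_meets: "finite (meets n)"
  by (induction n) auto

lemma incseq_meets: "incseq meets"
  by (rule incseq_SucI) auto

lemma meets_closed: "e \<in> meets n \<Longrightarrow> f \<in> meets n \<Longrightarrow> e * f \<in> meets n"
proof (induction n arbitrary: e f)
  case (Suc n)
  have E: "a \<in> idempotents" if "a \<in> meets n" for a using that meets_idempotents by blast
  have comm: "a * idem_enum n = idem_enum n * a" if "a \<in> meets n" for a
    using that by (intro idempotents_commute E idem_enum_idempotent)
  have 1: "idem_enum n * (idem_enum n * a) = idem_enum n * a" for a by (rule idempotentsD(2)[OF idem_enum_idempotent])
  have 2: "a * (idem_enum n * b) = idem_enum n * (a * b)" if "a \<in> meets n" for a b
    using comm[OF that] by (metis mult.assoc)
  have 3: "idem_enum n * a * b = idem_enum n * (a * b)" for a b by (simp add: mult.assoc)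
  show ?case
    using Suc.prems idempotentsD(1)[OF idem_enum_idempotent, of n]
    by (auto simp: 1 2 3 comm Suc.IH)
qed simp

lemma meets_exhaust:
  assumes "e \<in> idempotents" shows "\<exists>n. e \<in> meets n"
proof -
  obtain k where k: "e = from_nat_into UNIV k" using from_nat_into_surj by blast
  have "idem_enum k = e" using assms by (simp add: idem_enum_def k[symmetric] idempotent_star idempotentsD)
  then show ?thesis by (intro exI[of _ "Suc k"]) auto
qed

text \<open>For e in \<open>meets n\<close> these are the characters for which e is the least
  element of \<open>meets n\<close> with value 1. The non-empty ones are the atoms of the ring of
  sets generated by the D(f) with f in \<open>meets n\<close>.\<close>

definition atom :: "nat \<Rightarrow> 's \<Rightarrow> ('s \<Rightarrow> bool) set" where
  "atom n e = D e - (\<Union>f\<in>{f \<in> meets n. f * e = f \<and> f \<noteq> e}. D f)"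

lemma compact_open_atom: "e \<in> meets n \<Longrightarrow> compact_open X (atom n e)"
  unfolding atom_def using meets_idempotents[of n] finite_meets[of n]
  by (intro compact_open_Diff compact_open_UN compact_open_basic) auto

lemma disjoint_atoms: "disjoint_family_on (atom n) (meets n)"
  unfolding disjoint_family_on_def
proof (intro ballI impI)
  fix e f assume ef: "e \<in> meets n" "f \<in> meets n" "e \<noteq> f"
  then have E: "e \<in> idempotents" "f \<in> idempotents" using meets_idempotents by auto
  have "x \<notin> atom n f" if x: "x \<in> atom n e" for x
  proof
    assume x': "x \<in> atom n f"
    have "x \<in> D (e * f)" using x x' E by (auto simp: atom_def spectrum_basic_mult)
    moreover have "e * f * e = e * f" "e * f * f = e * f"
      using idempotents_commute[OF E] E by (metis mult.assoc idempotentsD(1))+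
    ultimately show False
      using x x' ef meets_closed[OF ef(1,2)] by (auto simp: atom_def)
  qed
  then show "atom n e \<inter> atom n f = {}" by blast
qed

text \<open>A character x in D(f) lies in the atom of the least e in \<open>meets n\<close> with
  x(e) = 1. Then e = f e, so e stays in the down-closed family.\<close>

lemma union_atoms:
  assumes J: "\<And>f g. f \<in> \<J> \<Longrightarrow> g \<in> meets n \<Longrightarrow> f * g \<noteq> 0 \<Longrightarrow> f * g \<in> \<J>"
  shows "(\<Union>f\<in>\<J> \<inter> meets n. D f) = (\<Union>e\<in>\<J> \<inter> meets n. atom n e)"
proof (intro equalityI subsetI)
  fix x assume "x \<in> (\<Union>f\<in>\<J> \<inter> meets n. D f)"
  then obtain f where f: "f \<in> \<J>" "f \<in> meets n" "x \<in> D f" by blast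
  then have xs: "x \<in> topspace X" by (simp add: spectrum_basic_iff)
  let ?A = "{g \<in> meets n. x g}"
  have "\<exists>e\<in>?A. \<forall>a\<in>?A. e * a = e"
    using f finite_meets[of n] meets_idempotents[of n] meets_closed[of _ n] spectrum_mult[OF xs]
    by (intro finite_semilattice_least) (auto simp: spectrum_basic_iff subset_iff)
  then obtain e where e: "e \<in> meets n" "x e" "\<And>a. a \<in> meets n \<Longrightarrow> x a \<Longrightarrow> e * a = e" by auto
  have E: "a \<in> idempotents" if "a \<in> meets n" for a using that meets_idempotents by blast
  have "f * e = e" using e(3)[OF f(2)] f(3) idempotents_commute[OF E[OF f(2)] E[OF e(1)]]
    by (simp add: spectrum_basic_iff)
  moreover have "e \<noteq> 0" using e(2) spectrum_zero[OF xs] by auto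
  ultimately have "e \<in> \<J>" using J[OF f(1) e(1)] by simp
  moreover have "x \<in> atom n e"
  proof -
    have "g = e" if "g \<in> meets n" "g * e = g" "x g" for g
      using e(3)[OF that(1,3)] that(2) idempotents_commute[OF E[OF that(1)] E[OF e(1)]] by simp
    then show ?thesis using xs e(2) by (auto simp: atom_def spectrum_basic_iff)
  qed
  ultimately show "x \<in> (\<Union>e\<in>\<J> \<inter> meets n. atom n e)" using e(1) by blast
qed (auto simp: atom_def)

text \<open>A second exhaustion of the same open set, adapted to the atoms; \<open>open_proj\<close>
  does not depend on the choice.\<close>

lemma exhausts_J:
  assumes e: "e \<in> idempotents"
  shows "exhausts (\<lambda>n. \<Union>f\<in>J h e \<inter> meets n. D f) (pullback h e)"
  unfolding exhausts_def
proof (intro conjI allI)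
  show "incseq (\<lambda>n. \<Union>f\<in>J h e \<inter> meets n. D f)"
    unfolding incseq_def using incseqD[OF incseq_meets] by (intro allI impI UN_mono) auto
  show "compact_open X (\<Union>f\<in>J h e \<inter> meets n. D f)" for n
    using finite_meets meets_idempotents by (intro compact_open_UN compact_open_basic) auto
  show "(\<Union>n. \<Union>f\<in>J h e \<inter> meets n. D f) = pullback h e"
    unfolding pullback_eq_J[OF e] using meets_exhaust J_idempotent(1) by fast
qed

text \<open>A witness for the membership has the source and the group element of r, so it is r
  itself.\<close>

lemma J_iff:
  fixes r :: 's
  assumes "r \<noteq> 0" shows "r\<^sup>\<star> * r \<in> J (univ_map r) e \<longleftrightarrow> e * r = r"
proof
  assume "r\<^sup>\<star> * r \<in> J (univ_map r) e"
  then obtain q where q: "r\<^sup>\<star> * r = q\<^sup>\<star> * q" "q \<noteq> 0" "univ_map q = univ_map r" "e * q = q"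
    by (auto simp: J_def)
  have "q = r" by (rule univ_map_inj[OF q(2) assms q(3) q(1)[symmetric]])
  then show "e * r = r" using q by simp
qed (use assms in \<open>auto simp: J_def\<close>)

lemma inj_on_univ_map:
  fixes A :: "'s set"
  assumes "\<And>r. r \<in> A \<Longrightarrow> r\<^sup>\<star> * r = e" "e \<noteq> 0" shows "inj_on univ_map A"
proof (rule inj_onI)
  fix r q assume "r \<in> A" "q \<in> A" and eq: "univ_map r = univ_map q"
  then have rq: "r\<^sup>\<star> * r = e" "q\<^sup>\<star> * q = e" using assms(1) by auto
  then have "r \<noteq> 0" "q \<noteq> 0" using assms(2) by auto
  then show "r = q" by (rule univ_map_inj[OF _ _ eq]) (simp add: rq)
qed

lemma unit_vector_in_fibre:
  assumes e: "e \<in> idempotents" "e \<noteq> 0" and N: "finite N" "N \<subseteq> idempotents" "\<And>g. g \<in> N \<Longrightarrow> e * g \<noteq> e"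
  shows "\<exists>w. norm (set_proj (D e - (\<Union>g\<in>N. D g)) w) = 1"
proof -
  let ?C = "D e - (\<Union>g\<in>N. D g)"
  have co: "compact_open X ?C"
    using e N by (intro compact_open_Diff compact_open_UN compact_open_basic) auto
  have "principal_char e \<in> ?C"
    using principal_char[OF e] e(1) N by (auto simp: spectrum_basic_iff idempotentsD)
  then have "(indicator ?C :: _ \<Rightarrow> complex) \<noteq> (\<lambda>_. 0)"
    by (metis indicator_simps(1) zero_neq_one)
  then have "\<pi> (indicator ?C) \<noteq> 0"
    using inj_onD[OF faithful _ indicator_C0[OF co] C0_zero] rep_zero by auto
  then obtain w where w: "set_proj ?C w \<noteq> 0" by (metis blinfun_eqI zero_blinfun.rep_eq)
  show ?thesis
    by (rule exI[of _ "inverse (norm (set_proj ?C w)) *\<^sub>R w"]) (use w in \<open>simp add: blinfun.scaleR_right\<close>)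
qed

subsection \<open>Equality of the norms\<close>

context
  fixes I :: "nat set" and c :: "nat \<Rightarrow> complex" and s :: "nat \<Rightarrow> 's"
  assumes I: "finite I"
begin

abbreviation Lsum :: "('s, complex) l2 \<Rightarrow>\<^sub>L ('s, complex) l2" where
  "Lsum \<equiv> (\<Sum>i\<in>I. scale_op (c i) (Lambda (s i)))"

abbreviation Vsum :: "('s univ_group, 'h) l2 \<Rightarrow>\<^sub>L ('s univ_group, 'h) l2" where
  "Vsum \<equiv> (\<Sum>i\<in>I. scale_op (c i) (Vop (s i)))"

lemma Lsum_nth:
  "l2_nth (blinfun_apply Lsum \<zeta>) r
    = (\<Sum>i | i \<in> I \<and> s i * (s i)\<^sup>\<star> * r = r. c i * l2_nth \<zeta> ((s i)\<^sup>\<star> * r))"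
proof -
  have "l2_nth (blinfun_apply Lsum \<zeta>) r
      = (\<Sum>i\<in>I. if s i * (s i)\<^sup>\<star> * r = r then c i * l2_nth \<zeta> ((s i)\<^sup>\<star> * r) else 0)"
    unfolding blinfun.sum_left l2_nth_sum
    by (intro sum.cong refl) (simp add: Lambda_props(3) scaleC_complex_def)
  also have "\<dots> = (\<Sum>i | i \<in> I \<and> s i * (s i)\<^sup>\<star> * r = r. c i * l2_nth \<zeta> ((s i)\<^sup>\<star> * r))"
    using I by (simp add: sum.inter_filter)
  finally show ?thesis .
qed

lemma Vsum_nth:
  "l2_nth (blinfun_apply Vsum \<xi>) h
    = (\<Sum>i\<in>I. c i *\<^sub>C open_proj (pullback h (s i * (s i)\<^sup>\<star>)) (l2_nth \<xi> (- univ_map (s i) + h)))"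
  by (simp add: blinfun.sum_left l2_nth_sum Vop_nth)

text \<open>The fibre of \<open>l\<^sup>2(S)\<close> over the domain idempotent \<open>e\<close> is invariant, and \<open>r \<mapsto> univ_map r\<close> is
  injective on it.\<close>

lemma fibre_bound:
  fixes \<eta> :: "'s univ_group \<Rightarrow> 'h"
  assumes e: "e \<noteq> 0" and H: "finite H"
  shows "(\<Sum>h\<in>H. (norm (\<Sum>i | i \<in> I \<and> e \<in> J h (s i * (s i)\<^sup>\<star>). c i *\<^sub>C \<eta> (- univ_map (s i) + h)))\<^sup>2)
    \<le> (norm (Lsum o\<^sub>L off_zero))\<^sup>2 * (\<Sum>k\<in>(\<lambda>(i, h). - univ_map (s i) + h) ` (I \<times> H). (norm (\<eta> k))\<^sup>2)"
    (is "sum ?F H \<le> ?C\<^sup>2 * sum ?G ?K")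
proof -
  \<comment> \<open>R is the part of the fibre over e that lies over H, and T below collects the
    preimages of its elements under the s i: the rows and columns of a finite scalar matrix.\<close>
  define R where "R = {r. r\<^sup>\<star> * r = e \<and> univ_map r \<in> H}"
  have R0: "r \<noteq> 0" if "r \<in> R" for r using that e by (auto simp: R_def)
  have injR: "inj_on univ_map R" by (rule inj_on_univ_map[OF _ e]) (simp add: R_def)
  have finR: "finite R"
    by (rule finite_imageD[OF finite_subset[OF _ H] injR]) (auto simp: R_def)
  define P where "P r = {i \<in> I. s i * (s i)\<^sup>\<star> * r = r}" for r
  have finP: "finite (P r)" for r using I by (simp add: P_def)
  define T where "T = (\<lambda>(i, r). (s i)\<^sup>\<star> * r) ` (SIGMA i:I. {r \<in> R. s i * (s i)\<^sup>\<star> * r = r})"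
  have T: "finite T" "\<And>t. t \<in> T \<Longrightarrow> t\<^sup>\<star> * t = e"
    and TR: "\<And>r i. r \<in> R \<Longrightarrow> i \<in> P r \<Longrightarrow> (s i)\<^sup>\<star> * r \<in> T"
  proof -
    show "finite T" unfolding T_def using I finR by auto
    show "t\<^sup>\<star> * t = e" if "t \<in> T" for t
      using that left_mult_inverse(2) by (fastforce simp: T_def R_def)
    show "(s i)\<^sup>\<star> * r \<in> T" if "r \<in> R" "i \<in> P r" for r i
      using that by (auto simp: T_def P_def)
  qed
  have T0: "t \<noteq> 0" if "t \<in> T" for t using T(2)[OF that] e by auto
  have injT: "inj_on univ_map T" by (rule inj_on_univ_map[OF T(2) e])
  have shift: "- univ_map (s i) + univ_map r = univ_map ((s i)\<^sup>\<star> * r)" if "r \<in> R" "i \<in> P r" for r i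
    using left_mult_inverse(5)[of "s i" r] R0 that by (auto simp: P_def)
  have TK: "univ_map ` T \<subseteq> ?K"
  proof
    fix k assume "k \<in> univ_map ` T"
    then obtain i r where "i \<in> I" "r \<in> R" "s i * (s i)\<^sup>\<star> * r = r" "k = univ_map ((s i)\<^sup>\<star> * r)"
      by (auto simp: T_def)
    then have "k = - univ_map (s i) + univ_map r" "univ_map r \<in> H"
      using shift[of r i] by (auto simp: P_def R_def)
    then show "k \<in> ?K" using \<open>i \<in> I\<close> by force
  qed
  have Jset: "{i. i \<in> I \<and> e \<in> J (univ_map r) (s i * (s i)\<^sup>\<star>)} = P r" if "r \<in> R" for r
    using J_iff[OF R0[OF that]] that by (auto simp: P_def R_def)
  \<comment> \<open>Different i may lead from t to the same r, so their coefficients are added up in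
    one matrix entry.\<close>
  define M where "M r t = (\<Sum>i | i \<in> P r \<and> (s i)\<^sup>\<star> * r = t. c i)" for r t
  have M: "(\<Sum>i\<in>P r. c i *\<^sub>C z ((s i)\<^sup>\<star> * r)) = (\<Sum>t\<in>T. M r t *\<^sub>C z t)"
    if r: "r \<in> R" for r and z :: "'s \<Rightarrow> 'a::complex_hilbert_space"
  proof -
    have "(\<Sum>t\<in>T. M r t *\<^sub>C z t)
        = (\<Sum>t\<in>T. \<Sum>i | i \<in> P r \<and> (s i)\<^sup>\<star> * r = t. c i *\<^sub>C z ((s i)\<^sup>\<star> * r))"
      unfolding M_def scaleC_sum_left by (intro sum.cong refl) auto
    also have "\<dots> = (\<Sum>i\<in>P r. c i *\<^sub>C z ((s i)\<^sup>\<star> * r))"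
      by (rule sum.group[OF finP T(1)]) (use TR[OF r] in auto)
    finally show ?thesis by simp
  qed
  \<comment> \<open>The inner sum at h is non-empty only if some r in R lies over h.\<close>
  have "sum ?F H = sum ?F (univ_map ` R)"
  proof (rule sum.mono_neutral_right[OF H])
    show "univ_map ` R \<subseteq> H" by (auto simp: R_def)
    show "\<forall>h\<in>H - univ_map ` R. ?F h = 0"
    proof
      fix h assume "h \<in> H - univ_map ` R"
      then have *: "{i. i \<in> I \<and> e \<in> J h (s i * (s i)\<^sup>\<star>)} = {}" by (auto simp: J_def R_def)
      show "?F h = 0" unfolding * by simp
    qed
  qed
  also have "\<dots> = (\<Sum>r\<in>R. (norm (\<Sum>i\<in>P r. c i *\<^sub>C \<eta> (univ_map ((s i)\<^sup>\<star> * r))))\<^sup>2)"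
    unfolding sum.reindex[OF injR] comp_def
    by (intro sum.cong refl arg_cong[where f = "\<lambda>v. (norm v)\<^sup>2"]) (simp_all add: Jset shift)
  also have "\<dots> = (\<Sum>r\<in>R. (norm (\<Sum>t\<in>T. M r t *\<^sub>C \<eta> (univ_map t)))\<^sup>2)"
    using M[of _ "\<lambda>t. \<eta> (univ_map t)"] by simp
  also have "\<dots> \<le> ?C\<^sup>2 * (\<Sum>t\<in>T. (norm (\<eta> (univ_map t)))\<^sup>2)"
  proof (rule scalar_matrix_ampliation[OF T(1)])
    fix z :: "'s \<Rightarrow> complex"
    \<comment> \<open>The scalar bound comes from applying the operator to the vector with entries z
      on T; since T avoids 0, \<open>off_zero\<close> fixes that vector.\<close>
    obtain \<zeta> :: "('s, complex) l2" where \<zeta>: "l2_nth \<zeta> = (\<lambda>t. if t \<in> T then z t else 0)"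
      "(norm \<zeta>)\<^sup>2 = (\<Sum>t\<in>T. (norm (if t \<in> T then z t else 0))\<^sup>2)"
      by (rule l2_finite_support[OF T(1), of "\<lambda>t. if t \<in> T then z t else 0"]) auto
    have off: "blinfun_apply off_zero \<zeta> = \<zeta>"
      by (rule l2_eqI) (use T0 in \<open>auto simp: off_zero_nth \<zeta>\<close>)
    have "(\<Sum>t\<in>T. M r t * z t) = l2_nth (blinfun_apply (Lsum o\<^sub>L off_zero) \<zeta>) r" if r: "r \<in> R" for r
    proof -
      have "l2_nth (blinfun_apply (Lsum o\<^sub>L off_zero) \<zeta>) r = (\<Sum>i\<in>P r. c i * l2_nth \<zeta> ((s i)\<^sup>\<star> * r))"
        unfolding blinfun_apply_blinfun_compose off Lsum_nth P_def by simp
      also have "\<dots> = (\<Sum>i\<in>P r. c i *\<^sub>C z ((s i)\<^sup>\<star> * r))"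
        using TR[OF r] by (intro sum.cong refl) (simp add: \<zeta>(1) scaleC_complex_def)
      finally show ?thesis using M[OF r, of z] by (simp add: scaleC_complex_def)
    qed
    then have "(\<Sum>r\<in>R. (cmod (\<Sum>t\<in>T. M r t * z t))\<^sup>2)
        = (\<Sum>r\<in>R. (norm (l2_nth (blinfun_apply (Lsum o\<^sub>L off_zero) \<zeta>) r))\<^sup>2)" by simp
    also have "\<dots> \<le> (norm (blinfun_apply (Lsum o\<^sub>L off_zero) \<zeta>))\<^sup>2" by (rule l2_sum_le_norm[OF finR])
    also have "\<dots> \<le> (?C * norm \<zeta>)\<^sup>2" by (intro power_mono norm_blinfun) simp
    also have "\<dots> = ?C\<^sup>2 * (\<Sum>t\<in>T. (cmod (z t))\<^sup>2)" using \<zeta>(2) by (simp add: power_mult_distrib)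
    finally show "(\<Sum>r\<in>R. (cmod (\<Sum>t\<in>T. M r t * z t))\<^sup>2) \<le> ?C\<^sup>2 * (\<Sum>t\<in>T. (cmod (z t))\<^sup>2)" .
  qed
  also have "(\<Sum>t\<in>T. (norm (\<eta> (univ_map t)))\<^sup>2) = sum ?G (univ_map ` T)"
    by (simp add: sum.reindex[OF injT])
  also have "?C\<^sup>2 * sum ?G (univ_map ` T) \<le> ?C\<^sup>2 * sum ?G ?K"
    using I H TK by (intro mult_left_mono sum_mono2) auto
  finally show ?thesis .
qed

text \<open>With \<open>meets n\<close> in place of all idempotents the coordinates split
  orthogonally along the atoms, and on the atom of e only the i with e in J contribute, so
  \<open>fibre_bound\<close> applies there. The bound is uniform in n, and n tends to infinity while
  the finite set H of coordinates is fixed.\<close>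

lemma Vsum_le: "norm Vsum \<le> norm (Lsum o\<^sub>L off_zero)"
proof (rule norm_blinfun_bound[OF norm_ge_zero], rule l2_norm_le)
  let ?C = "norm (Lsum o\<^sub>L off_zero)"
  fix \<xi> :: "('s univ_group, 'h) l2" show "0 \<le> ?C * norm \<xi>" by simp
  fix H :: "'s univ_group set" assume H: "finite H"
  let ?K = "(\<lambda>(i, h). - univ_map (s i) + h) ` (I \<times> H)"
  have K: "finite ?K" using I H by simp
  define q where "q n e = set_proj (atom n e)" for n e
  \<comment> \<open>A finite stage of the coordinates of \<open>Vsum\<close> at \<xi>: each pullback
    is cut to a finite union that splits into atoms.\<close>
  define y where "y n h = (\<Sum>i\<in>I. c i *\<^sub>C set_proj (\<Union>f\<in>J h (s i * (s i)\<^sup>\<star>) \<inter> meets n. D f)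
    (l2_nth \<xi> (- univ_map (s i) + h)))" for n h
  have lim: "(\<lambda>n. y n h) \<longlonglongrightarrow> l2_nth (blinfun_apply Vsum \<xi>) h" for h
    unfolding y_def Vsum_nth
    by (intro tendsto_sum tendsto_scaleC open_proj_lim exhausts_J) simp
  have qC: "q n e (a *\<^sub>C v) = a *\<^sub>C q n e v" if "e \<in> meets n" for n e a v
    unfolding q_def by (rule bounded_opsD[OF rep_bounded_ops[OF indicator_C0[OF compact_open_atom[OF that]]]])
  have y: "y n h = (\<Sum>e\<in>meets n. q n e (\<Sum>i | i \<in> I \<and> e \<in> J h (s i * (s i)\<^sup>\<star>).
      c i *\<^sub>C l2_nth \<xi> (- univ_map (s i) + h)))" for n h
  proof -
    have "set_proj (\<Union>f\<in>J h e' \<inter> meets n. D f) v = (\<Sum>e\<in>J h e' \<inter> meets n. q n e v)" for e' v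
    proof -
      have eq: "(\<Union>f\<in>J h e' \<inter> meets n. D f) = (\<Union>e\<in>J h e' \<inter> meets n. atom n e)"
        using meets_idempotents by (intro union_atoms J_down_closed) auto
      show ?thesis unfolding eq q_def
        using finite_meets disjoint_atoms[of n] compact_open_atom
        by (intro set_proj_disjoint_UN) (auto simp: disjoint_family_on_def)
    qed
    then have "y n h = (\<Sum>i\<in>I. \<Sum>e\<in>J h (s i * (s i)\<^sup>\<star>) \<inter> meets n.
        q n e (c i *\<^sub>C l2_nth \<xi> (- univ_map (s i) + h)))"
      unfolding y_def by (intro sum.cong refl) (simp add: scaleC_sum_right qC)
    also have "\<dots> = (\<Sum>i\<in>I. \<Sum>e | e \<in> meets n \<and> e \<in> J h (s i * (s i)\<^sup>\<star>).
        q n e (c i *\<^sub>C l2_nth \<xi> (- univ_map (s i) + h)))"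
      by (intro sum.cong refl) auto
    also have "\<dots> = (\<Sum>e\<in>meets n. \<Sum>i | i \<in> I \<and> e \<in> J h (s i * (s i)\<^sup>\<star>).
        q n e (c i *\<^sub>C l2_nth \<xi> (- univ_map (s i) + h)))"
      by (rule sum.swap_restrict[OF I finite_meets])
    finally show ?thesis unfolding q_def by (simp add: blinfun.sum_right)
  qed
  have bound: "(\<Sum>h\<in>H. (norm (y n h))\<^sup>2) \<le> (?C * norm \<xi>)\<^sup>2" for n
  proof -
    have normsum: "(norm (\<Sum>e\<in>meets n. q n e (v e)))\<^sup>2 = (\<Sum>e\<in>meets n. (norm (q n e (v e)))\<^sup>2)" for v
      unfolding q_def by (intro norm_sum_set_proj finite_meets compact_open_atom disjoint_atoms)
    have qsum: "q n e (\<Sum>i | i \<in> I \<and> e \<in> J h (s i * (s i)\<^sup>\<star>). c i *\<^sub>C l2_nth \<xi> (- univ_map (s i) + h))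
        = (\<Sum>i | i \<in> I \<and> e \<in> J h (s i * (s i)\<^sup>\<star>). c i *\<^sub>C q n e (l2_nth \<xi> (- univ_map (s i) + h)))"
      if "e \<in> meets n" for e h
      using qC[OF that] unfolding q_def by (simp add: blinfun.sum_right)
    have "(\<Sum>h\<in>H. (norm (y n h))\<^sup>2) = (\<Sum>e\<in>meets n. \<Sum>h\<in>H.
        (norm (\<Sum>i | i \<in> I \<and> e \<in> J h (s i * (s i)\<^sup>\<star>). c i *\<^sub>C q n e (l2_nth \<xi> (- univ_map (s i) + h))))\<^sup>2)"
      unfolding y normsum by (subst sum.swap) (simp add: qsum)
    also have "\<dots> \<le> (\<Sum>e\<in>meets n. ?C\<^sup>2 * (\<Sum>k\<in>?K. (norm (q n e (l2_nth \<xi> k)))\<^sup>2))"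
    proof (rule sum_mono)
      fix e assume "e \<in> meets n"
      show "(\<Sum>h\<in>H. (norm (\<Sum>i | i \<in> I \<and> e \<in> J h (s i * (s i)\<^sup>\<star>).
          c i *\<^sub>C q n e (l2_nth \<xi> (- univ_map (s i) + h))))\<^sup>2)
        \<le> ?C\<^sup>2 * (\<Sum>k\<in>?K. (norm (q n e (l2_nth \<xi> k)))\<^sup>2)"
      proof (cases "e = 0")
        case True
        then have *: "{i. i \<in> I \<and> e \<in> J h (s i * (s i)\<^sup>\<star>)} = {}" for h
          using J_idempotent(2) by blast
        show ?thesis unfolding * by (simp add: sum_nonneg)
      next
        case False
        show ?thesis by (rule fibre_bound[OF False H, of "\<lambda>k. q n e (l2_nth \<xi> k)"])
      qed
    qed
    also have "\<dots> = ?C\<^sup>2 * (\<Sum>k\<in>?K. \<Sum>e\<in>meets n. (norm (q n e (l2_nth \<xi> k)))\<^sup>2)"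
      by (subst sum.swap) (simp add: sum_distrib_left)
    also have "\<dots> = ?C\<^sup>2 * (\<Sum>k\<in>?K. (norm (\<Sum>e\<in>meets n. q n e (l2_nth \<xi> k)))\<^sup>2)"
      by (simp add: normsum)
    also have "\<dots> \<le> ?C\<^sup>2 * (\<Sum>k\<in>?K. (norm (l2_nth \<xi> k))\<^sup>2)"
    proof (intro mult_left_mono sum_mono power_mono norm_ge_zero)
      fix k
      have "(\<Sum>e\<in>meets n. q n e (l2_nth \<xi> k)) = set_proj (\<Union>e\<in>meets n. atom n e) (l2_nth \<xi> k)"
        unfolding q_def
        by (intro set_proj_disjoint_UN[symmetric] finite_meets compact_open_atom disjoint_atoms)
      also have "norm \<dots> \<le> norm (l2_nth \<xi> k)"
        by (intro set_proj_norm_le compact_open_UN finite_meets compact_open_atom)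
      finally show "norm (\<Sum>e\<in>meets n. q n e (l2_nth \<xi> k)) \<le> norm (l2_nth \<xi> k)" .
    qed simp
    also have "\<dots> \<le> ?C\<^sup>2 * (norm \<xi>)\<^sup>2" by (intro mult_left_mono l2_sum_le_norm K) simp
    finally show ?thesis by (simp add: power_mult_distrib)
  qed
  show "(\<Sum>h\<in>H. (norm (l2_nth (blinfun_apply Vsum \<xi>) h))\<^sup>2) \<le> (?C * norm \<xi>)\<^sup>2"
    by (rule LIMSEQ_le_const2[of "\<lambda>n. \<Sum>h\<in>H. (norm (y n h))\<^sup>2"])
      (use bound in \<open>auto intro!: tendsto_intros lim\<close>)
qed

text \<open>Sending \<open>delta t\<close> to \<open>v\<close> in the coordinate \<open>univ_map t\<close> intertwines the two representations on
  the relevant vectors, if the unit vector \<open>v\<close> lives on \<open>D(e)\<close> minus the finitely many smaller \<open>D(g)\<close>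
  with \<open>g = t\<^sup>* s\<^sup>* s t\<close>.\<close>

lemma Vsum_fibre_bound:
  fixes \<zeta> :: "'s \<Rightarrow> complex"
  assumes R: "finite R" "\<And>r. r \<in> R \<Longrightarrow> r\<^sup>\<star> * r = e" and e: "e \<noteq> 0"
  defines "T \<equiv> (\<lambda>(i, r). (s i)\<^sup>\<star> * r) ` (SIGMA i:I. {r \<in> R. s i * (s i)\<^sup>\<star> * r = r})"
  shows "(\<Sum>r\<in>R. (cmod (\<Sum>i | i \<in> I \<and> s i * (s i)\<^sup>\<star> * r = r. c i * \<zeta> ((s i)\<^sup>\<star> * r)))\<^sup>2)
    \<le> (norm (Vsum))\<^sup>2 * (\<Sum>t\<in>T. (cmod (\<zeta> t))\<^sup>2)"
proof (cases "R = {}")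
  case False
  then have eE: "e \<in> idempotents" using R(2) by (metis ex_in_conv star_mult_idempotent(1))
  have R0: "r \<noteq> 0" if "r \<in> R" for r using R(2)[OF that] e by auto
  have injR: "inj_on univ_map R" by (rule inj_on_univ_map[OF R(2) e])
  have finT: "finite T" unfolding T_def using I R(1) by auto
  have T: "t\<^sup>\<star> * t = e" if "t \<in> T" for t
  proof -
    obtain i r where ir: "r \<in> R" "s i * (s i)\<^sup>\<star> * r = r" "t = (s i)\<^sup>\<star> * r"
      using \<open>t \<in> T\<close> by (auto simp: T_def)
    show ?thesis unfolding ir(3) left_mult_inverse(2)[OF ir(2)] by (rule R(2)[OF ir(1)])
  qed
  have TR: "(s i)\<^sup>\<star> * r \<in> T" if "r \<in> R" "i \<in> I" "s i * (s i)\<^sup>\<star> * r = r" for r i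
    using that by (auto simp: T_def)
  have T0: "t \<noteq> 0" if "t \<in> T" for t using T[OF that] e by auto
  have injT: "inj_on univ_map T" by (rule inj_on_univ_map[OF T e])
  \<comment> \<open>These idempotents are the sources of the products \<open>s i * t\<close>.
    Removing D(g) for those g other than e leaves a set over which s i is defined either on all of t
    or nowhere.\<close>
  define N where "N = (\<lambda>(t, i). t\<^sup>\<star> * ((s i)\<^sup>\<star> * s i) * t) ` (T \<times> I) - {e}"
  have N: "finite N" "N \<subseteq> idempotents" unfolding N_def using finT I by (auto intro: conj_idempotent)
  have eN: "e * g \<noteq> e" if g: "g \<in> N" for g
  proof -
    obtain t i where ti: "t \<in> T" "g = t\<^sup>\<star> * ((s i)\<^sup>\<star> * s i) * t" using g by (auto simp: N_def)
    have "e * g = g" unfolding ti(2) T[OF ti(1), symmetric] by (simp add: mult.assoc star_assoc_props)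
    then show ?thesis using g by (auto simp: N_def)
  qed
  let ?C = "D e - (\<Union>g\<in>N. D g)"
  have co: "compact_open X ?C"
    using eE N by (intro compact_open_Diff compact_open_UN compact_open_basic) auto
  obtain w where w: "norm (set_proj ?C w) = 1"
    using unit_vector_in_fibre[OF eE e N eN] by blast
  have projC: "set_proj ?C (d *\<^sub>C w) = d *\<^sub>C set_proj ?C w" for d
    by (rule bounded_opsD[OF rep_bounded_ops[OF indicator_C0[OF co]]])
  \<comment> \<open>Each coordinate over T carries a multiple of one unit vector, so \<xi> has the
    norm of \<zeta> on T and \<open>Vsum\<close> can be computed entrywise.\<close>
  obtain \<xi> :: "('s univ_group, 'h) l2" where \<xi>:
    "l2_nth \<xi> = (\<lambda>k. if k \<in> univ_map ` T then set_proj ?C (\<zeta> (the_inv_into T univ_map k) *\<^sub>C w) else 0)"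
    "(norm \<xi>)\<^sup>2 = (\<Sum>k\<in>univ_map ` T. (norm (if k \<in> univ_map ` T then
      set_proj ?C (\<zeta> (the_inv_into T univ_map k) *\<^sub>C w) else 0))\<^sup>2)"
    by (rule l2_finite_support[of "univ_map ` T" "\<lambda>k. if k \<in> univ_map ` T then
      set_proj ?C (\<zeta> (the_inv_into T univ_map k) *\<^sub>C w) else 0"]) (use finT in auto)
  have \<xi>T: "l2_nth \<xi> (univ_map t) = set_proj ?C (\<zeta> t *\<^sub>C w)" if "t \<in> T" for t
    using that by (simp add: \<xi>(1) the_inv_into_f_f[OF injT])
  have norm\<xi>: "(norm \<xi>)\<^sup>2 = (\<Sum>t\<in>T. (cmod (\<zeta> t))\<^sup>2)"
    unfolding \<xi>(2) sum.reindex[OF injT]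
    by (intro sum.cong refl) (simp add: the_inv_into_f_f[OF injT] projC norm_scaleC w)
  have term1: "open_proj (pullback (univ_map r) (s i * (s i)\<^sup>\<star>)) (l2_nth \<xi> (- univ_map (s i) + univ_map r))
      = \<zeta> ((s i)\<^sup>\<star> * r) *\<^sub>C set_proj ?C w"
    if r: "r \<in> R" "i \<in> I" "s i * (s i)\<^sup>\<star> * r = r" for r i
  proof -
    have "e \<in> J (univ_map r) (s i * (s i)\<^sup>\<star>)"
      using J_iff[OF R0[OF r(1)]] R(2)[OF r(1)] r(3) by simp
    then have "?C \<subseteq> pullback (univ_map r) (s i * (s i)\<^sup>\<star>)" by (auto simp: pullback_eq_J)
    then have "open_proj (pullback (univ_map r) (s i * (s i)\<^sup>\<star>)) (set_proj ?C (\<zeta> ((s i)\<^sup>\<star> * r) *\<^sub>C w))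
        = set_proj ?C (\<zeta> ((s i)\<^sup>\<star> * r) *\<^sub>C w)"
      by (intro open_proj_of_subset[OF exhausts_pullback co]) simp
    then show ?thesis
      using \<xi>T[OF TR[OF r]] left_mult_inverse(5)[OF r(3) R0[OF r(1)]] by (simp add: projC)
  qed
  \<comment> \<open>If r is not in the range of s i, the pullback misses ?C: a common point would
    give x(g) = 1, hence g = e, so \<open>s i * t\<close> would have source e and would equal
    r.\<close>
  have term0: "open_proj (pullback (univ_map r) (s i * (s i)\<^sup>\<star>)) (l2_nth \<xi> (- univ_map (s i) + univ_map r)) = 0"
    if r: "r \<in> R" "i \<in> I" "s i * (s i)\<^sup>\<star> * r \<noteq> r" for r i
  proof (cases "- univ_map (s i) + univ_map r \<in> univ_map ` T")
    case False
    then have "l2_nth \<xi> (- univ_map (s i) + univ_map r) = set_proj {} 0" by (simp add: \<xi>(1))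
    then show ?thesis
      using open_proj_of_disjoint[OF exhausts_pullback[of "s i * (s i)\<^sup>\<star>"] compact_open_empty] by simp
  next
    case True
    then obtain t where t: "t \<in> T" "- univ_map (s i) + univ_map r = univ_map t" by auto
    have "x \<notin> pullback (univ_map r) (s i * (s i)\<^sup>\<star>)" if x: "x \<in> ?C" for x
    proof
      assume "x \<in> pullback (univ_map r) (s i * (s i)\<^sup>\<star>)"
      then obtain f where f: "f \<in> J (univ_map r) (s i * (s i)\<^sup>\<star>)" "x \<in> D f" by (auto simp: pullback_eq_J)
      have fE: "f \<in> idempotents" using f(1) by (rule J_idempotent)
      have xs: "x \<in> topspace X" "x e" "x f" using x f by (auto simp: spectrum_basic_iff)
      define f' where "f' = f * e"
      have f'E: "f' \<in> idempotents" unfolding f'_def by (rule idempotents_mult[OF fE eE])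
      have xf': "x f'" unfolding f'_def using xs fE eE by (simp add: spectrum_mult)
      have f'e: "f' * e = f'" using eE by (simp add: f'_def mult.assoc idempotentsD)
      have "f' \<noteq> 0" using xf' spectrum_zero[OF xs(1)] by auto
      then have "f' \<in> J (univ_map r) (s i * (s i)\<^sup>\<star>)"
        unfolding f'_def by (rule J_down_closed[OF f(1) eE])
      then obtain q where q: "f' = q\<^sup>\<star> * q" "q \<noteq> 0" "univ_map q = univ_map r" "s i * (s i)\<^sup>\<star> * q = q"
        by (auto simp: J_def)
      note lm = left_mult_inverse[OF q(4)]
      \<comment> \<open>Both factors lie over the same group element and are defined on f', so they
        agree there.\<close>
      have "(s i)\<^sup>\<star> * q * f' = t * f'"
      proof (rule univ_map_compatible[OF lm(3)[OF q(2)] T0[OF t(1)]])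
        show "univ_map ((s i)\<^sup>\<star> * q) = univ_map t" using lm(5)[OF q(2)] q(3) t(2) by simp
        show "f' * (((s i)\<^sup>\<star> * q)\<^sup>\<star> * ((s i)\<^sup>\<star> * q)) = f'"
          unfolding lm(2) q(1)[symmetric] by (rule idempotentsD(1)[OF f'E])
        show "f' * (t\<^sup>\<star> * t) = f'" using T[OF t(1)] f'e by simp
      qed (rule f'E)
      moreover have "(s i)\<^sup>\<star> * q * f' = (s i)\<^sup>\<star> * q" by (simp add: q(1) mult.assoc star_assoc_props)
      ultimately have qt: "(s i)\<^sup>\<star> * q = t * f'" by simp
      have dom: "(s i)\<^sup>\<star> * s i * (t * f') = t * f'"
        unfolding qt[symmetric] by (simp add: mult.assoc star_assoc_props)
      define g where "g = t\<^sup>\<star> * ((s i)\<^sup>\<star> * s i) * t"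
      have gE: "g \<in> idempotents" unfolding g_def by (rule conj_idempotent) simp
      have "g * f' = t\<^sup>\<star> * ((s i)\<^sup>\<star> * s i * (t * f'))" by (simp add: g_def mult.assoc)
      also have "\<dots> = e * f'" unfolding dom using T[OF t(1)] by (metis mult.assoc)
      also have "\<dots> = f'" using f'e idempotents_commute[OF eE f'E] by simp
      finally have "x g" using spectrum_mult[OF xs(1) gE f'E] xf' by simp
      then have "g \<notin> N" using x xs(1) by (auto simp: spectrum_basic_iff)
      then have ge: "g = e" using t(1) r(2) by (auto simp: N_def g_def)
      have "(s i)\<^sup>\<star> * s i * t = (s i)\<^sup>\<star> * s i * (t * t\<^sup>\<star>) * t" by (simp add: mult.assoc star_assoc_props)
      also have "(s i)\<^sup>\<star> * s i * (t * t\<^sup>\<star>) = (t * t\<^sup>\<star>) * ((s i)\<^sup>\<star> * s i)"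
        by (rule idempotents_commute) simp_all
      also have "\<dots> * t = t * g" by (simp add: g_def mult.assoc)
      also have "\<dots> = t" unfolding ge T[OF t(1), symmetric] by (simp add: star_assoc_props)
      finally have st: "(s i)\<^sup>\<star> * s i * t = t" .
      have dst: "(s i * t)\<^sup>\<star> * (s i * t) = e"
        using st T[OF t(1)] by (simp add: star_mult mult.assoc)
      then have st0: "s i * t \<noteq> 0" using e by auto
      have "s i * t = r"
      proof (rule univ_map_inj[OF st0 R0[OF r(1)]])
        show "univ_map (s i * t) = univ_map r"
          using univ_map_mult[OF st0] by (simp add: t(2)[symmetric] add.assoc[symmetric])
        show "(s i * t)\<^sup>\<star> * (s i * t) = r\<^sup>\<star> * r" using dst R(2)[OF r(1)] by simp
      qed
      then have "s i * (s i)\<^sup>\<star> * r = r" by (auto simp: mult.assoc star_assoc_props)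
      then show False using r(3) by simp
    qed
    then have "?C \<inter> pullback (univ_map r) (s i * (s i)\<^sup>\<star>) = {}" by blast
    then show ?thesis
      unfolding t(2) \<xi>T[OF t(1)] by (intro open_proj_of_disjoint[OF exhausts_pullback co]) simp_all
  qed
  have "l2_nth (blinfun_apply (Vsum) \<xi>) (univ_map r)
      = (\<Sum>i | i \<in> I \<and> s i * (s i)\<^sup>\<star> * r = r. c i * \<zeta> ((s i)\<^sup>\<star> * r)) *\<^sub>C set_proj ?C w"
    if r: "r \<in> R" for r
  proof -
    have "l2_nth (blinfun_apply (Vsum) \<xi>) (univ_map r)
        = (\<Sum>i\<in>I. if s i * (s i)\<^sup>\<star> * r = r then (c i * \<zeta> ((s i)\<^sup>\<star> * r)) *\<^sub>C set_proj ?C w else 0)"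
      unfolding Vsum_nth
      by (intro sum.cong refl) (simp add: term1[OF r] term0[OF r] scaleC_scaleC)
    also have "\<dots> = (\<Sum>i | i \<in> I \<and> s i * (s i)\<^sup>\<star> * r = r. c i * \<zeta> ((s i)\<^sup>\<star> * r)) *\<^sub>C set_proj ?C w"
      using I by (simp add: sum.inter_filter[symmetric] scaleC_sum_left)
    finally show ?thesis .
  qed
  then have "(\<Sum>r\<in>R. (cmod (\<Sum>i | i \<in> I \<and> s i * (s i)\<^sup>\<star> * r = r. c i * \<zeta> ((s i)\<^sup>\<star> * r)))\<^sup>2)
      = (\<Sum>r\<in>R. (norm (l2_nth (blinfun_apply (Vsum) \<xi>) (univ_map r)))\<^sup>2)"
    by (intro sum.cong refl) (simp add: norm_scaleC w)
  also have "\<dots> = (\<Sum>h\<in>univ_map ` R. (norm (l2_nth (blinfun_apply (Vsum) \<xi>) h))\<^sup>2)"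
    by (simp add: sum.reindex[OF injR])
  also have "\<dots> \<le> (norm (blinfun_apply (Vsum) \<xi>))\<^sup>2" using R(1) by (intro l2_sum_le_norm) simp
  also have "\<dots> \<le> (norm (Vsum) * norm \<xi>)\<^sup>2" by (intro power_mono norm_blinfun) simp
  also have "\<dots> = (norm (Vsum))\<^sup>2 * (\<Sum>t\<in>T. (cmod (\<zeta> t))\<^sup>2)"
    by (simp add: power_mult_distrib norm\<xi>)
  finally show ?thesis .
qed (simp add: sum_nonneg)

text \<open>Rows with different sources draw on columns with different sources, so the bounds of
  \<open>Vsum_fibre_bound\<close> concern disjoint sets of coordinates and add up to at most the
  norm of the whole vector.\<close>

lemma Lsum_le: "norm (Lsum o\<^sub>L off_zero) \<le> norm (Vsum)"
proof (rule norm_blinfun_bound[OF norm_ge_zero], rule l2_norm_le)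
  let ?C = "norm (Vsum)"
  fix \<xi> :: "('s, complex) l2" show "0 \<le> ?C * norm \<xi>" by simp
  fix R :: "'s set" assume R: "finite R"
  define \<zeta> where "\<zeta> = l2_nth (blinfun_apply off_zero \<xi>)"
  have \<zeta>0: "\<zeta> 0 = 0" by (simp add: \<zeta>_def off_zero_nth)
  define y where "y r = (\<Sum>i | i \<in> I \<and> s i * (s i)\<^sup>\<star> * r = r. c i * \<zeta> ((s i)\<^sup>\<star> * r))" for r
  define T where "T e = (\<lambda>(i, r). (s i)\<^sup>\<star> * r) `
    (SIGMA i:I. {r \<in> {r \<in> R. r\<^sup>\<star> * r = e}. s i * (s i)\<^sup>\<star> * r = r})" for e
  have finT: "finite (T e)" for e
    unfolding T_def using I R by (intro finite_imageI finite_SigmaI) auto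
  have T: "t\<^sup>\<star> * t = e" if "t \<in> T e" for t e
  proof -
    obtain i r where ir: "r\<^sup>\<star> * r = e" "s i * (s i)\<^sup>\<star> * r = r" "t = (s i)\<^sup>\<star> * r"
      using \<open>t \<in> T e\<close> by (auto simp: T_def)
    show ?thesis unfolding ir(3) left_mult_inverse(2)[OF ir(2)] by (rule ir(1))
  qed
  have fibre: "(\<Sum>r | r \<in> R \<and> r\<^sup>\<star> * r = e. (cmod (y r))\<^sup>2) \<le> ?C\<^sup>2 * (\<Sum>t\<in>T e. (cmod (\<zeta> t))\<^sup>2)" for e
  proof (cases "e = 0")
    case True
    \<comment> \<open>The only element with source 0 is 0, whose coordinate \<open>off_zero\<close>
      has removed.\<close>
    have "y r = 0" if "r\<^sup>\<star> * r = 0" for r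
    proof -
      have "r = 0" using that by (metis mult_zero_right star_assoc_props(1))
      then show ?thesis by (simp add: y_def \<zeta>0)
    qed
    then have "(\<Sum>r | r \<in> R \<and> r\<^sup>\<star> * r = e. (cmod (y r))\<^sup>2) = 0" using True by (intro sum.neutral) auto
    then show ?thesis by (simp add: sum_nonneg)
  next
    case False
    show ?thesis unfolding y_def T_def
      by (rule Vsum_fibre_bound[OF _ _ False]) (use R in auto)
  qed
  have dis: "T e \<inter> T e' = {}" if "e \<noteq> e'" for e e'
    using T[of _ e] T[of _ e'] that by blast
  let ?E = "(\<lambda>r. r\<^sup>\<star> * r) ` R"
  have "(\<Sum>r\<in>R. (norm (l2_nth (blinfun_apply (Lsum o\<^sub>L off_zero) \<xi>) r))\<^sup>2) = (\<Sum>r\<in>R. (cmod (y r))\<^sup>2)"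
    unfolding blinfun_apply_blinfun_compose Lsum_nth y_def \<zeta>_def ..
  also have "\<dots> = (\<Sum>e\<in>?E. \<Sum>r | r \<in> R \<and> r\<^sup>\<star> * r = e. (cmod (y r))\<^sup>2)"
    using R by (intro sum.group[symmetric]) auto
  also have "\<dots> \<le> (\<Sum>e\<in>?E. ?C\<^sup>2 * (\<Sum>t\<in>T e. (cmod (\<zeta> t))\<^sup>2))" by (intro sum_mono fibre)
  also have "\<dots> = ?C\<^sup>2 * (\<Sum>t\<in>(\<Union>e\<in>?E. T e). (cmod (\<zeta> t))\<^sup>2)"
    unfolding sum_distrib_left[symmetric]
    by (subst sum.UNION_disjoint) (use R finT dis in auto)
  also have "\<dots> \<le> ?C\<^sup>2 * (norm (blinfun_apply off_zero \<xi>))\<^sup>2"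
    unfolding \<zeta>_def using R finT by (intro mult_left_mono l2_sum_le_norm) auto
  also have "\<dots> \<le> ?C\<^sup>2 * (norm \<xi>)\<^sup>2"
    by (intro mult_left_mono power_mono norm_off_zero_apply) auto
  finally show "(\<Sum>r\<in>R. (norm (l2_nth (blinfun_apply (Lsum o\<^sub>L off_zero) \<xi>) r))\<^sup>2) \<le> (?C * norm \<xi>)\<^sup>2"
    by (simp add: power_mult_distrib)
qed

end

end

section \<open>Extension to the closures\<close>

text \<open>Lists of terms, repetitions allowed, stand for elements of the complex semigroup algebra
  of S, and \<open>comb\<close> evaluates them; the three list operations below are those of that
  algebra.\<close>

definition comb :: "('s \<Rightarrow> 'k \<Rightarrow>\<^sub>L 'k) \<Rightarrow> (complex \<times> 's) list \<Rightarrow> ('k::complex_hilbert_space \<Rightarrow>\<^sub>L 'k)" where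
  "comb T xs = sum_list (map (\<lambda>(c, s). scale_op c (T s)) xs)"

definition scale_list :: "complex \<Rightarrow> (complex \<times> 's) list \<Rightarrow> (complex \<times> 's) list" where
  "scale_list d xs = map (\<lambda>(c, s). (d * c, s)) xs"

definition mult_list :: "(complex \<times> 's::times) list \<Rightarrow> (complex \<times> 's) list \<Rightarrow> (complex \<times> 's) list" where
  "mult_list xs ys = concat (map (\<lambda>(c, s). map (\<lambda>(d, t). (c * d, s * t)) ys) xs)"

definition star_list :: "(complex \<times> 's::inverse_semigroup_0) list \<Rightarrow> (complex \<times> 's) list" where
  "star_list xs = map (\<lambda>(c, s). (cnj c, s\<^sup>\<star>)) xs"

lemma comb_simps [simp]:
  "comb T [] = 0" "comb T ((c, s) # xs) = scale_op c (T s) + comb T xs"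
  "comb T (xs @ ys) = comb T xs + comb T ys"
  by (simp_all add: comb_def)

lemma comb_scale_list: "comb T (scale_list d xs) = scale_op d (comb T xs)"
  by (induction xs) (auto simp: scale_list_def)

lemma comb_diff: "comb T xs - comb T ys = comb T (xs @ scale_list (-1) ys)"
proof -
  have "comb T ys + scale_op (-1) (comb T ys) = 0"
    using scale_op_add_left[of 1 "-1" "comb T ys"] by simp
  then show ?thesis by (simp add: comb_scale_list algebra_simps eq_neg_iff_add_eq_0)
qed

lemma comb_eq_sum: "comb T xs = (\<Sum>i<length xs. scale_op (fst (xs ! i)) (T (snd (xs ! i))))"
  unfolding comb_def by (simp add: sum_list_sum_nth atLeast0LessThan case_prod_beta)

text \<open>A *-representation of S that may send 0 to a non-zero operator, as \<open>Lambda\<close>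
  does.\<close>

locale star_family =
  fixes T :: "'s::inverse_semigroup_0 \<Rightarrow> 'k::complex_hilbert_space \<Rightarrow>\<^sub>L 'k"
  assumes family_ops: "T s \<in> bounded_ops"
    and family_mult: "T s o\<^sub>L T t = T (s * t)"
    and family_star: "adj_op (T s) = T (s\<^sup>\<star>)"
begin

lemma comb_ops: "comb T xs \<in> bounded_ops"
  by (induction xs) (auto simp: bounded_ops_zero bounded_ops_add bounded_ops_scale family_ops)

lemma comb_mult_list: "comb T (mult_list xs ys) = comb T xs o\<^sub>L comb T ys"
proof (induction xs)
  case Nil
  show ?case by (simp add: mult_list_def bounded_bilinear.zero_left[OF bounded_bilinear_blinfun_compose])
next
  case (Cons x xs)
  obtain c s where x: "x = (c, s)" by (cases x)
  have "comb T (map (\<lambda>(d, t). (c * d, s * t)) ys) = scale_op c (T s) o\<^sub>L comb T ys"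
  proof (induction ys)
    case Nil
    show ?case by (simp add: bounded_bilinear.zero_right[OF bounded_bilinear_blinfun_compose])
  next
    case (Cons y ys)
    then show ?case
      by (cases y) (simp add: bounded_bilinear.add_right[OF bounded_bilinear_blinfun_compose]
        scale_op_compose_left scale_op_compose_right family_ops family_mult)
  qed
  with Cons show ?case
    by (simp add: x mult_list_def bounded_bilinear.add_left[OF bounded_bilinear_blinfun_compose])
qed

lemma comb_star_list: "comb T (star_list xs) = adj_op (comb T xs)"
  by (induction xs)
    (auto simp: star_list_def adj_op_add adj_op_scale bounded_ops_scale family_ops comb_ops family_star)

definition algebra :: "('k \<Rightarrow>\<^sub>L 'k) set" where
  "algebra = closure (range (comb T))"

lemma algebraE:
  assumes "x \<in> algebra" obtains xs where "(\<lambda>n. comb T (xs n)) \<longlonglongrightarrow> x"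
proof -
  from assms obtain y where y: "\<forall>n. y n \<in> range (comb T)" "y \<longlonglongrightarrow> x"
    unfolding algebra_def closure_sequential by (elim exE conjE)
  then have "\<exists>xs. y n = comb T xs" for n by blast
  then obtain xs where "\<And>n. y n = comb T (xs n)" by metis
  then have "y = (\<lambda>n. comb T (xs n))" by blast
  then show thesis using y(2) that by blast
qed

lemma algebraI: "(\<lambda>n. comb T (xs n)) \<longlonglongrightarrow> x \<Longrightarrow> x \<in> algebra"
  unfolding algebra_def closure_sequential by (intro exI[of _ "\<lambda>n. comb T (xs n)"]) simp

lemma comb_in_algebra: "comb T xs \<in> algebra"
  unfolding algebra_def by (rule subsetD[OF closure_subset]) simp

lemma is_cstar_subalgebra_algebra: "is_cstar_subalgebra algebra"
  unfolding is_cstar_subalgebra_def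
proof (intro conjI ballI allI)
  show "closed algebra" by (simp add: algebra_def)
  show "0 \<in> algebra" using comb_in_algebra[of "[]"] by simp
  show "algebra \<subseteq> bounded_ops" unfolding algebra_def
    by (rule closure_minimal[OF _ closed_bounded_ops]) (use comb_ops in auto)
  fix x assume "x \<in> algebra"
  then obtain xs where xs: "(\<lambda>n. comb T (xs n)) \<longlonglongrightarrow> x" by (rule algebraE)
  show "adj_op x \<in> algebra"
    by (rule algebraI[of "\<lambda>n. star_list (xs n)"])
      (simp add: comb_star_list tendsto_adj_op[OF comb_ops xs])
  show "scale_op c x \<in> algebra" for c
    by (rule algebraI[of "\<lambda>n. scale_list c (xs n)"]) (simp add: comb_scale_list tendsto_scale_op[OF xs])
  fix y assume "y \<in> algebra"
  then obtain ys where ys: "(\<lambda>n. comb T (ys n)) \<longlonglongrightarrow> y" by (rule algebraE)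
  show "x + y \<in> algebra" by (rule algebraI[of "\<lambda>n. xs n @ ys n"]) (simp add: tendsto_add[OF xs ys])
  show "x o\<^sub>L y \<in> algebra"
    by (rule algebraI[of "\<lambda>n. mult_list (xs n) (ys n)"])
      (simp add: comb_mult_list tendsto_blinfun_compose[OF xs ys])
qed

lemma algebra_ops: "algebra \<subseteq> bounded_ops" and algebra_zero: "0 \<in> algebra"
  and algebra_add: "x \<in> algebra \<Longrightarrow> y \<in> algebra \<Longrightarrow> x + y \<in> algebra"
  and algebra_compose: "x \<in> algebra \<Longrightarrow> y \<in> algebra \<Longrightarrow> x o\<^sub>L y \<in> algebra"
  and algebra_adj: "x \<in> algebra \<Longrightarrow> adj_op x \<in> algebra"
  and algebra_scale: "x \<in> algebra \<Longrightarrow> scale_op c x \<in> algebra"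
  and closed_algebra: "closed algebra"
  using is_cstar_subalgebra_algebra by (simp_all add: is_cstar_subalgebra_def)

lemma algebra_diff: "x \<in> algebra \<Longrightarrow> y \<in> algebra \<Longrightarrow> x - y \<in> algebra"
proof -
  assume xy: "x \<in> algebra" "y \<in> algebra"
  have "x + scale_op (-1) y = x - y"
    using scale_op_add_left[of 1 "-1" y] by (simp add: algebra_simps eq_neg_iff_add_eq_0)
  then show ?thesis using algebra_add[OF xy(1) algebra_scale[OF xy(2)]] by metis
qed

lemma family_in_algebra: "T s \<in> algebra"
  using comb_in_algebra[of "[(1, s)]"] by simp

text \<open>The span of the family is already closed under products and adjoints, so only its
  closure has to be taken.\<close>

lemma hull_eq_algebra: "is_cstar_subalgebra hull range T = algebra"
proof (rule hull_unique)
  show "range T \<subseteq> algebra" using family_in_algebra by blast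
  fix B assume B: "range T \<subseteq> B" "is_cstar_subalgebra B"
  have "comb T xs \<in> B" for xs
  proof (induction xs)
    case (Cons x xs)
    obtain c s where x: "x = (c, s)" by (cases x)
    have "T s \<in> B" using B(1) by blast
    then have "scale_op c (T s) \<in> B" using B(2) by (simp add: is_cstar_subalgebra_def)
    then show ?case using B(2) Cons.IH by (simp add: x is_cstar_subalgebra_def)
  qed (use B(2) in \<open>simp add: is_cstar_subalgebra_def\<close>)
  then show "algebra \<subseteq> B" unfolding algebra_def
    using B(2) by (intro closure_minimal) (auto simp: is_cstar_subalgebra_def)
qed (rule is_cstar_subalgebra_algebra)

end

text \<open>First isomorphism theorem. The operations on cosets are unions over all representatives;
  as the cosets are the fibres of f, all cosets in such a union coincide.\<close>

lemma quotient_alg_isomorphic: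
  assumes hom: "star_hom A B f" and surj: "f ` alg_carrier A = alg_carrier B"
    and closed: "\<And>x y. x \<in> alg_carrier A \<Longrightarrow> y \<in> alg_carrier A \<Longrightarrow>
        alg_add A x y \<in> alg_carrier A \<and> alg_mult A x y \<in> alg_carrier A"
      "\<And>x. x \<in> alg_carrier A \<Longrightarrow> alg_star A x \<in> alg_carrier A"
      "\<And>c x. x \<in> alg_carrier A \<Longrightarrow> alg_scale A c x \<in> alg_carrier A"
    and coset: "\<And>x. x \<in> alg_carrier A \<Longrightarrow> alg_coset A I x = {y \<in> alg_carrier A. f y = f x}"
    and norm: "\<And>x. x \<in> alg_carrier A \<Longrightarrow> alg_norm B (f x) = (INF y\<in>alg_coset A I x. alg_norm A y)"
  shows "quotient_alg A I \<cong>\<^sub>C B"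
proof -
  let ?A = "alg_carrier A" and ?Q = "quotient_alg A I" and ?cos = "alg_coset A I"
  have mem: "x \<in> ?cos x" if "x \<in> ?A" for x using coset[OF that] that by simp
  define F where "F Y = f (SOME y. y \<in> Y)" for Y
  have F: "F (?cos x) = f x" if x: "x \<in> ?A" for x
  proof -
    have "(SOME y. y \<in> ?cos x) \<in> ?cos x" by (rule someI[of "\<lambda>y. y \<in> ?cos x", OF mem[OF x]])
    then show ?thesis using coset[OF x] by (simp add: F_def)
  qed
  have fA: "f x \<in> alg_carrier B" if "x \<in> ?A" for x using hom that by (simp add: star_hom_def)
  have eq: "?cos x = ?cos y" if "x \<in> ?A" "y \<in> ?A" "f x = f y" for x y using that by (simp add: coset)
  have hadd: "f (alg_add A x y) = alg_add B (f x) (f y)" "f (alg_mult A x y) = alg_mult B (f x) (f y)"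
    if "x \<in> ?A" "y \<in> ?A" for x y using hom that by (simp_all add: star_hom_def)
  have hscale: "f (alg_scale A c x) = alg_scale B c (f x)" "f (alg_star A x) = alg_star B (f x)"
    if "x \<in> ?A" for x c using hom that by (simp_all add: star_hom_def)
  have add: "(\<Union>u\<in>?cos x. \<Union>v\<in>?cos y. ?cos (h u v)) = ?cos (h x y)"
    if xy: "x \<in> ?A" "y \<in> ?A" and hA: "\<And>u v. u \<in> ?A \<Longrightarrow> v \<in> ?A \<Longrightarrow> h u v \<in> ?A"
      and hf: "\<And>u v u' v'. u \<in> ?A \<Longrightarrow> v \<in> ?A \<Longrightarrow> u' \<in> ?A \<Longrightarrow> v' \<in> ?A \<Longrightarrow> f u = f u' \<Longrightarrow> f v = f v'
        \<Longrightarrow> f (h u v) = f (h u' v')" for h x y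
  proof -
    have "?cos (h u v) = ?cos (h x y)" if "u \<in> ?cos x" "v \<in> ?cos y" for u v
    proof -
      have uv: "u \<in> ?A" "v \<in> ?A" "f u = f x" "f v = f y" using that coset xy by auto
      show ?thesis by (rule eq[OF hA[OF uv(1,2)] hA[OF xy] hf[OF uv(1,2) xy uv(3,4)]])
    qed
    then show ?thesis using mem[OF xy(1)] mem[OF xy(2)] by blast
  qed
  have unary: "(\<Union>u\<in>?cos x. ?cos (h u)) = ?cos (h x)"
    if x: "x \<in> ?A" and hA: "\<And>u. u \<in> ?A \<Longrightarrow> h u \<in> ?A"
      and hf: "\<And>u u'. u \<in> ?A \<Longrightarrow> u' \<in> ?A \<Longrightarrow> f u = f u' \<Longrightarrow> f (h u) = f (h u')" for h x
  proof -
    have "?cos (h u) = ?cos (h x)" if "u \<in> ?cos x" for u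
    proof -
      have u: "u \<in> ?A" "f u = f x" using that coset x by auto
      show ?thesis by (rule eq[OF hA[OF u(1)] hA[OF x] hf[OF u(1) x u(2)]])
    qed
    then show ?thesis using mem[OF x] by blast
  qed
  have Qadd: "alg_add ?Q (?cos x) (?cos y) = ?cos (alg_add A x y)"
    and Qmult: "alg_mult ?Q (?cos x) (?cos y) = ?cos (alg_mult A x y)" if "x \<in> ?A" "y \<in> ?A" for x y
    using add[OF that, of "alg_add A"] add[OF that, of "alg_mult A"] closed(1) hadd
    by (simp_all add: quotient_alg_def)
  have Qscale: "alg_scale ?Q c (?cos x) = ?cos (alg_scale A c x)"
    and Qstar: "alg_star ?Q (?cos x) = ?cos (alg_star A x)" if "x \<in> ?A" for x c
    using unary[OF that, of "alg_scale A c"] unary[OF that, of "alg_star A"] closed(2,3) hscale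
    by (simp_all add: quotient_alg_def)
  have carrier: "alg_carrier ?Q = ?cos ` ?A" by (simp add: quotient_alg_def)
  have "star_hom ?Q B F"
    unfolding star_hom_def carrier ball_simps
    by (auto simp: Qadd Qmult Qscale Qstar F fA closed hadd hscale)
  moreover have "bij_betw F (alg_carrier ?Q) (alg_carrier B)"
    unfolding bij_betw_def carrier surj[symmetric]
  proof
    show "inj_on F (?cos ` ?A)"
    proof (rule inj_onI, elim imageE)
      fix Y Z x y assume Y: "F Y = F Z" "Y = ?cos x" "x \<in> ?A" "Z = ?cos y" "y \<in> ?A"
      then have "f x = f y" using F[OF Y(3)] F[OF Y(5)] by simp
      then show "Y = Z" unfolding Y(2,4) by (rule eq[OF Y(3,5)])
    qed
    show "F ` ?cos ` ?A = f ` ?A" by (auto simp: F image_image)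
  qed
  moreover have "\<forall>Y\<in>alg_carrier ?Q. alg_norm B (F Y) = alg_norm ?Q Y"
    unfolding carrier by (auto simp: F norm quotient_alg_def)
  ultimately show ?thesis unfolding cstar_isomorphic_def by blast
qed

interpretation Lam: star_family "Lambda :: 's::inverse_semigroup_0 \<Rightarrow> _"
  by standard (rule Lambda_props(1) Lambda_mult Lambda_star)+

lemma Lambda_zero_nth: "l2_nth (blinfun_apply (Lambda 0) \<xi>) r = (if r = 0 then l2_nth \<xi> 0 else 0)"
  by (auto simp: Lambda_props(3))

text \<open>If s s* r = r and s* r = 0 then r = 0, so every \<open>Lambda s\<close> maps
  \<open>delta 0\<close> to a multiple of itself, and this passes to combinations and limits.
  Consequently the products x \<Lambda>_0 stay in the one-dimensional ideal.\<close>

lemma algebra_compose_Lambda_zero: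
  fixes x :: "('s::inverse_semigroup_0, complex) l2 \<Rightarrow>\<^sub>L ('s, complex) l2"
  assumes x: "x \<in> Lam.algebra" shows "\<exists>c. x o\<^sub>L Lambda 0 = scale_op c (Lambda 0)"
proof -
  have ops: "x \<in> bounded_ops" using x Lam.algebra_ops by blast
  obtain xs where xs: "(\<lambda>n. comb Lambda (xs n)) \<longlonglongrightarrow> x" using x by (rule Lam.algebraE)
  have comb0: "l2_nth (blinfun_apply (comb Lambda ys) (delta 0)) r = 0" if "r \<noteq> 0" for r :: 's and ys
  proof (induction ys)
    case (Cons y ys)
    obtain c s where y: "y = (c, s)" by (cases y)
    have "s * (s\<^sup>\<star> * r) = 0" if "s\<^sup>\<star> * r = 0" using that by simp
    then show ?case using Cons \<open>r \<noteq> 0\<close>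
      by (auto simp: y blinfun.add_left Lambda_props(3) l2_nth_delta mult.assoc scaleC_complex_def)
  qed simp
  have x0: "l2_nth (blinfun_apply x (delta 0)) r = 0" if r: "r \<noteq> 0" for r
  proof (rule LIMSEQ_unique)
    show "(\<lambda>n. l2_nth (blinfun_apply (comb Lambda (xs n)) (delta 0)) r) \<longlonglongrightarrow> l2_nth (blinfun_apply x (delta 0)) r"
      unfolding cinner_delta[symmetric] by (intro tendsto_intros blinfun.tendsto xs)
    show "(\<lambda>n. l2_nth (blinfun_apply (comb Lambda (xs n)) (delta 0)) r) \<longlonglongrightarrow> 0"
      by (simp add: comb0[OF r])
  qed
  have "x o\<^sub>L Lambda 0 = scale_op (l2_nth (blinfun_apply x (delta 0)) 0) (Lambda 0)"
  proof (rule blinfun_eqI, rule l2_eqI)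
    fix \<xi> :: "('s, complex) l2" and r
    have "blinfun_apply (Lambda 0) \<xi> = l2_nth \<xi> 0 *\<^sub>C delta 0"
      by (rule l2_eqI) (simp add: Lambda_zero_nth l2_nth_delta scaleC_complex_def)
    then show "l2_nth (blinfun_apply (x o\<^sub>L Lambda 0) \<xi>) r
        = l2_nth (blinfun_apply (scale_op (l2_nth (blinfun_apply x (delta 0)) 0) (Lambda 0)) \<xi>) r"
      by (simp add: bounded_opsD[OF ops] x0 l2_nth_delta scaleC_complex_def)
  qed
  then show ?thesis by blast
qed

lemma off_zero_props:
  "Lambda 0 o\<^sub>L off_zero = 0" "norm off_zero \<le> 1" "x o\<^sub>L off_zero = x - (x o\<^sub>L Lambda 0)"
proof -
  show "Lambda 0 o\<^sub>L off_zero = 0"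
    by (rule blinfun_eqI, rule l2_eqI) (simp add: Lambda_zero_nth off_zero_nth)
  show "norm off_zero \<le> 1" by (rule norm_blinfun_bound) (simp_all add: norm_off_zero_apply)
  show "x o\<^sub>L off_zero = x - (x o\<^sub>L Lambda 0)"
    by (rule blinfun_eqI) (simp add: off_zero_def blinfun.diff_left blinfun.diff_right)
qed

lemma norm_compose_off_zero_le: "norm (x o\<^sub>L off_zero) \<le> norm x"
  using norm_blinfun_compose[of x off_zero] off_zero_props(2)
  by (metis mult.right_neutral mult_left_mono norm_ge_zero order_trans)

lemma diff_compose_left: "(x - y) o\<^sub>L z = (x o\<^sub>L z) - (y o\<^sub>L z)"
  by (rule bounded_bilinear.diff_left[OF bounded_bilinear_blinfun_compose])

text \<open>The norm hypothesis lets the assignment of \<open>comb V xs\<close> to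
  \<open>comb Lambda xs\<close> extend to limits independently of the lists. Its kernel consists of
  the x killed by \<open>off_zero\<close>, that is, of the multiples of \<Lambda>_0, and the norm of
  a coset is attained at \<open>x o\<^sub>L off_zero\<close>.\<close>

theorem reduced_cstar_isomorphic:
  fixes V :: "'s::inverse_semigroup_0 \<Rightarrow> 'k::complex_hilbert_space \<Rightarrow>\<^sub>L 'k"
  assumes fam: "star_family V"
    and norm: "\<And>xs. norm (comb V xs) = norm (comb Lambda xs o\<^sub>L off_zero)"
  shows "reduced_cstar TYPE('s) \<cong>\<^sub>C op_alg (closure (range (comb V)))"
proof -
  interpret V: star_family V by fact
  let ?z = "Lambda (0 :: 's)"
  \<comment> \<open>Differences of combinations are combinations, so the norm hypothesis compares
    distances as well.\<close>
  have diffV: "norm (comb V xs - comb V ys) = norm ((comb Lambda xs - comb Lambda ys) o\<^sub>L off_zero)" for xs ys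
    unfolding comb_diff by (rule norm)
  have Cauchy: "Cauchy (\<lambda>n. comb V (xs n))"
    if "Cauchy (\<lambda>n. comb Lambda (xs n) o\<^sub>L off_zero)" for xs
    using that unfolding Cauchy_iff diffV diff_compose_left .
  have "\<exists>w. \<forall>xs. (\<lambda>n. comb Lambda (xs n)) \<longlonglongrightarrow> x \<longrightarrow> (\<lambda>n. comb V (xs n)) \<longlonglongrightarrow> w"
    if "x \<in> Lam.algebra" for x
  proof -
    obtain xs where xs: "(\<lambda>n. comb Lambda (xs n)) \<longlonglongrightarrow> x" using \<open>x \<in> Lam.algebra\<close> by (rule Lam.algebraE)
    have "(\<lambda>n. comb Lambda (xs n) o\<^sub>L off_zero) \<longlonglongrightarrow> (x o\<^sub>L off_zero)"
      by (intro tendsto_blinfun_compose xs tendsto_const)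
    then obtain w where w: "(\<lambda>n. comb V (xs n)) \<longlonglongrightarrow> w"
      using Cauchy[OF LIMSEQ_imp_Cauchy] Cauchy_convergent_iff convergent_def by metis
    have "(\<lambda>n. comb V (ys n)) \<longlonglongrightarrow> w" if ys: "(\<lambda>n. comb Lambda (ys n)) \<longlonglongrightarrow> x" for ys
    proof -
      have "(\<lambda>n. (comb Lambda (ys n) - comb Lambda (xs n)) o\<^sub>L off_zero) \<longlonglongrightarrow> ((x - x) o\<^sub>L off_zero)"
        by (intro tendsto_blinfun_compose tendsto_diff xs ys tendsto_const)
      then have "(\<lambda>n. (comb Lambda (ys n) - comb Lambda (xs n)) o\<^sub>L off_zero) \<longlonglongrightarrow> 0"
        by (simp add: diff_compose_left)
      from tendsto_norm_zero[OF this] have "(\<lambda>n. norm (comb V (ys n) - comb V (xs n))) \<longlonglongrightarrow> 0"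
        unfolding diffV .
      then have "(\<lambda>n. comb V (ys n) - comb V (xs n)) \<longlonglongrightarrow> 0" by (rule tendsto_norm_zero_cancel)
      from tendsto_add[OF this w] show ?thesis by simp
    qed
    then show ?thesis by blast
  qed
  then obtain f where f: "\<And>x xs. (\<lambda>n. comb Lambda (xs n)) \<longlonglongrightarrow> x \<Longrightarrow> (\<lambda>n. comb V (xs n)) \<longlonglongrightarrow> f x"
    using Lam.algebraI by metis
  have fV: "f x \<in> V.algebra" if "x \<in> Lam.algebra" for x
    using Lam.algebraE[OF that] f V.algebraI by metis
  have f_add: "f (x + y) = f x + f y" and f_mult: "f (x o\<^sub>L y) = f x o\<^sub>L f y"
    if xy: "x \<in> Lam.algebra" "y \<in> Lam.algebra" for x y
  proof -
    obtain xs where xs: "(\<lambda>n. comb Lambda (xs n)) \<longlonglongrightarrow> x" using xy(1) by (rule Lam.algebraE)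
    obtain ys where ys: "(\<lambda>n. comb Lambda (ys n)) \<longlonglongrightarrow> y" using xy(2) by (rule Lam.algebraE)
    have "(\<lambda>n. comb V (xs n @ ys n)) \<longlonglongrightarrow> f (x + y)"
      by (rule f) (simp add: tendsto_add[OF xs ys])
    then show "f (x + y) = f x + f y"
      using tendsto_add[OF f[OF xs] f[OF ys]] by (simp add: LIMSEQ_unique)
    have "(\<lambda>n. comb V (mult_list (xs n) (ys n))) \<longlonglongrightarrow> f (x o\<^sub>L y)"
      by (rule f) (simp add: Lam.comb_mult_list tendsto_blinfun_compose[OF xs ys])
    then show "f (x o\<^sub>L y) = f x o\<^sub>L f y"
      using tendsto_blinfun_compose[OF f[OF xs] f[OF ys]] by (simp add: V.comb_mult_list LIMSEQ_unique)
  qed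
  have f_scale: "f (scale_op c x) = scale_op c (f x)" and f_adj: "f (adj_op x) = adj_op (f x)"
    and f_norm: "norm (f x) = norm (x o\<^sub>L off_zero)"
    if x: "x \<in> Lam.algebra" for x c
  proof -
    obtain xs where xs: "(\<lambda>n. comb Lambda (xs n)) \<longlonglongrightarrow> x" using x by (rule Lam.algebraE)
    have "(\<lambda>n. comb V (scale_list c (xs n))) \<longlonglongrightarrow> f (scale_op c x)"
      by (rule f) (simp add: comb_scale_list tendsto_scale_op[OF xs])
    then show "f (scale_op c x) = scale_op c (f x)"
      using tendsto_scale_op[OF f[OF xs], of c] by (simp add: comb_scale_list LIMSEQ_unique)
    have "(\<lambda>n. comb V (star_list (xs n))) \<longlonglongrightarrow> f (adj_op x)"
      by (rule f) (simp add: Lam.comb_star_list tendsto_adj_op[OF Lam.comb_ops xs])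
    then show "f (adj_op x) = adj_op (f x)"
      using tendsto_adj_op[OF V.comb_ops f[OF xs]] by (simp add: V.comb_star_list LIMSEQ_unique)
    have "(\<lambda>n. norm (comb V (xs n))) \<longlonglongrightarrow> norm (x o\<^sub>L off_zero)"
      unfolding norm by (intro tendsto_norm tendsto_blinfun_compose xs tendsto_const)
    then show "norm (f x) = norm (x o\<^sub>L off_zero)"
      using tendsto_norm[OF f[OF xs]] LIMSEQ_unique by blast
  qed
  have f_diff: "f (x - y) = f x - f y" if "x \<in> Lam.algebra" "y \<in> Lam.algebra" for x y
    using f_add[OF Lam.algebra_diff[OF that] that(2)] by (simp add: algebra_simps)
  have z: "?z \<in> Lam.algebra" by (rule Lam.family_in_algebra)
  have off_alg: "x o\<^sub>L off_zero \<in> Lam.algebra" if "x \<in> Lam.algebra"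
    for x :: "('s, complex) l2 \<Rightarrow>\<^sub>L ('s, complex) l2"
    unfolding off_zero_props(3) by (intro Lam.algebra_diff Lam.algebra_compose that z)
  have f_off: "f (x o\<^sub>L off_zero) = f x" if x: "x \<in> Lam.algebra" for x
  proof -
    have xz: "x o\<^sub>L ?z \<in> Lam.algebra" by (intro Lam.algebra_compose x z)
    have "(x o\<^sub>L ?z) o\<^sub>L off_zero = x o\<^sub>L (?z o\<^sub>L off_zero)" by (rule blinfun_eqI) simp
    then have "norm (f (x o\<^sub>L ?z)) = 0"
      unfolding f_norm[OF xz] off_zero_props(1)
      by (simp add: bounded_bilinear.zero_right[OF bounded_bilinear_blinfun_compose])
    then show ?thesis unfolding off_zero_props(3) by (simp add: f_diff x xz)
  qed
  have surj: "f ` Lam.algebra = V.algebra"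
  proof (intro equalityI subsetI)
    fix w assume "w \<in> V.algebra"
    then obtain xs where xs: "(\<lambda>n. comb V (xs n)) \<longlonglongrightarrow> w" by (rule V.algebraE)
    \<comment> \<open>Convergence of \<open>comb V (xs n)\<close> controls
      \<open>comb Lambda (xs n)\<close> only off the coordinate 0, so the preimage is taken as the
      limit of the cut-down operators.\<close>
    have "Cauchy (\<lambda>n. comb Lambda (xs n) o\<^sub>L off_zero)"
      using LIMSEQ_imp_Cauchy[OF xs] unfolding Cauchy_iff diffV diff_compose_left .
    then obtain r where r: "(\<lambda>n. comb Lambda (xs n) o\<^sub>L off_zero) \<longlonglongrightarrow> r"
      by (auto simp: Cauchy_convergent_iff convergent_def)
    have rA: "r \<in> Lam.algebra"
      using closed_sequentially[OF Lam.closed_algebra _ r] off_alg[OF Lam.comb_in_algebra] by blast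
    have "(\<lambda>n. f (comb Lambda (xs n) o\<^sub>L off_zero)) \<longlonglongrightarrow> f r"
    proof (rule LIM_zero_cancel, rule Lim_null_comparison[OF always_eventually, rule_format])
      show "norm (f (comb Lambda (xs n) o\<^sub>L off_zero) - f r) \<le> norm ((comb Lambda (xs n) o\<^sub>L off_zero) - r)" for n
      proof -
        have a: "comb Lambda (xs n) o\<^sub>L off_zero \<in> Lam.algebra" by (rule off_alg[OF Lam.comb_in_algebra])
        show ?thesis
          unfolding f_diff[OF a rA, symmetric] f_norm[OF Lam.algebra_diff[OF a rA]]
          by (rule norm_compose_off_zero_le)
      qed
      show "(\<lambda>n. norm ((comb Lambda (xs n) o\<^sub>L off_zero) - r)) \<longlonglongrightarrow> 0"
        using r by (simp add: LIM_zero tendsto_norm_zero)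
    qed
    moreover have "f (comb Lambda (xs n) o\<^sub>L off_zero) = comb V (xs n)" for n
    proof -
      have "(\<lambda>_. comb V (xs n)) \<longlonglongrightarrow> f (comb Lambda (xs n))"
        using f[of "\<lambda>_. xs n"] by simp
      then show ?thesis using f_off[OF Lam.comb_in_algebra] by (simp add: LIMSEQ_const_iff)
    qed
    ultimately have "f r = w" using xs LIMSEQ_unique by simp
    then show "w \<in> f ` Lam.algebra" using rA by blast
  qed (use fV in blast)
  let ?A = "op_alg (Lam.algebra :: (('s, complex) l2 \<Rightarrow>\<^sub>L ('s, complex) l2) set)"
  let ?I = "range (\<lambda>c. scale_op c ?z)"
  have cos: "alg_coset ?A ?I x = range (\<lambda>c. x + scale_op c ?z)" for x
    by (auto simp: alg_coset_def op_alg_def)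
  have zoff: "scale_op c ?z o\<^sub>L off_zero = 0" for c
    by (simp add: scale_op_compose_left off_zero_props(1))
  have coset: "alg_coset ?A ?I x = {y \<in> Lam.algebra. f y = f x}" if x: "x \<in> Lam.algebra" for x
  proof (intro equalityI subsetI)
    fix y assume "y \<in> alg_coset ?A ?I x"
    then obtain c where y: "y = x + scale_op c ?z" by (auto simp: cos)
    have "norm (f (scale_op c ?z)) = 0" using f_norm[OF Lam.algebra_scale[OF z], of c] zoff by simp
    then show "y \<in> {y \<in> Lam.algebra. f y = f x}"
      using x z by (simp add: y f_add Lam.algebra_add Lam.algebra_scale)
  next
    fix y assume "y \<in> {y \<in> Lam.algebra. f y = f x}"
    then have y: "y \<in> Lam.algebra" "f y = f x" by auto
    have yx: "y - x \<in> Lam.algebra" by (rule Lam.algebra_diff[OF y(1) x])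
    have "norm ((y - x) o\<^sub>L off_zero) = 0"
      using f_norm[OF yx] f_diff[OF y(1) x] y(2) by simp
    then have "y - x = (y - x) o\<^sub>L ?z" unfolding off_zero_props(3) by simp
    moreover obtain c where "(y - x) o\<^sub>L ?z = scale_op c ?z" using algebra_compose_Lambda_zero[OF yx] by blast
    ultimately have "y = x + scale_op c ?z" by (metis add_diff_cancel_left' diff_add_cancel add.commute)
    then show "y \<in> alg_coset ?A ?I x" by (auto simp: cos)
  qed
  have norm_coset: "norm (f x) = (INF y\<in>alg_coset ?A ?I x. norm y)" if x: "x \<in> Lam.algebra" for x
  proof (rule antisym)
    have "norm (f x) \<le> norm y" if "y \<in> alg_coset ?A ?I x" for y
    proof -
      have y: "y \<in> Lam.algebra" "f y = f x" using that coset[OF x] by auto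
      show ?thesis unfolding y(2)[symmetric] f_norm[OF y(1)] by (rule norm_compose_off_zero_le)
    qed
    moreover have "x \<in> alg_coset ?A ?I x" using x by (simp add: coset)
    ultimately show "norm (f x) \<le> (INF y\<in>alg_coset ?A ?I x. norm y)" by (intro cINF_greatest) auto
    have "x o\<^sub>L off_zero \<in> alg_coset ?A ?I x" using x by (simp add: coset off_alg f_off)
    then show "(INF y\<in>alg_coset ?A ?I x. norm y) \<le> norm (f x)"
      unfolding f_norm[OF x] by (intro cINF_lower bdd_belowI2[where m = 0]) auto
  qed
  have "quotient_alg ?A ?I \<cong>\<^sub>C op_alg V.algebra"
  proof (rule quotient_alg_isomorphic[where f = f])
    show "star_hom ?A (op_alg V.algebra) f"
      by (simp add: star_hom_def op_alg_def fV f_add f_mult f_scale f_adj)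
  qed (use surj coset norm_coset in \<open>simp_all add: op_alg_def Lam.algebra_add Lam.algebra_compose
      Lam.algebra_adj Lam.algebra_scale\<close>)
  then show ?thesis unfolding reduced_cstar_def Lam.hull_eq_algebra V.algebra_def .
qed

section \<open>The crossed product as the closed span of the operators \<open>Vop\<close>\<close>

context spectrum_rep
begin

sublocale Vop: star_family Vop
  by standard (rule Vop_bounded_ops Vop_mult Vop_star)+

lemma norm_comb_Vop: "norm (comb Vop xs) = norm (comb Lambda xs o\<^sub>L off_zero)"
proof -
  have fin: "finite {..<length xs}" by simp
  show ?thesis
    unfolding comb_eq_sum using Vsum_le[OF fin] Lsum_le[OF fin] by (rule antisym)
qed

abbreviation fin_sums :: "('s univ_group \<Rightarrow> ('s \<Rightarrow> bool) \<Rightarrow> complex) set" where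
  "fin_sums \<equiv> crossed_sums X univ_dom"

abbreviation rep :: "('s univ_group \<Rightarrow> ('s \<Rightarrow> bool) \<Rightarrow> complex) \<Rightarrow>
    ('s univ_group, 'h) l2 \<Rightarrow>\<^sub>L ('s univ_group, 'h) l2" where
  "rep \<equiv> crossed_rep X univ_dom univ_act \<pi>"

lemma crossed_rep_eq_sum:
  assumes "finite F" "{g. a g \<noteq> (\<lambda>_. 0)} \<subseteq> F"
  shows "rep a = (\<Sum>g\<in>F. crossed (a g) g)"
  unfolding crossed_rep_def
  by (rule sum.mono_neutral_left[OF assms]) (auto simp: crossed_zero)

lemma crossed_rep_add:
  assumes a: "a \<in> fin_sums" and b: "b \<in> fin_sums"
  shows "rep (\<lambda>g x. a g x + b g x) = rep a + rep b" "(\<lambda>g x. a g x + b g x) \<in> fin_sums"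
proof -
  let ?F = "{g. a g \<noteq> (\<lambda>_. 0)} \<union> {g. b g \<noteq> (\<lambda>_. 0)}"
  have F: "finite ?F" using a b by (simp add: crossed_sums_def)
  have sub: "{g. (\<lambda>x. a g x + b g x) \<noteq> (\<lambda>_. 0)} \<subseteq> ?F" by auto
  have C0: "a g \<in> C0 X" "b g \<in> C0 X" for g
    using a b by (auto simp: crossed_sums_def intro: C0_ideal_C0)
  show "rep (\<lambda>g x. a g x + b g x) = rep a + rep b"
    using crossed_rep_eq_sum[OF F sub] crossed_rep_eq_sum[OF F, of a] crossed_rep_eq_sum[OF F, of b]
    by (simp add: crossed_add[OF C0] sum.distrib)
  show "(\<lambda>g x. a g x + b g x) \<in> fin_sums"
    using a b finite_subset[OF sub F] by (auto simp: crossed_sums_def intro: C0_ideal_add)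
qed

lemma crossed_rep_single:
  assumes a: "a \<in> ideal g"
  shows "rep (\<lambda>h. if h = g then a else (\<lambda>_. 0)) = crossed a g"
    "(\<lambda>h. if h = g then a else (\<lambda>_. 0)) \<in> fin_sums"
proof -
  have sub: "{h. (if h = g then a else (\<lambda>_. 0)) \<noteq> (\<lambda>_. 0)} \<subseteq> {g}" by auto
  show "rep (\<lambda>h. if h = g then a else (\<lambda>_. 0)) = crossed a g"
    by (subst crossed_rep_eq_sum[OF _ sub]) simp_all
  show "(\<lambda>h. if h = g then a else (\<lambda>_. 0)) \<in> fin_sums"
    using finite_subset[OF sub] a by (auto simp: crossed_sums_def C0_ideal_zero)
qed

lemma Vop_scaled_in_sums: "scale_op c (Vop s) \<in> rep ` fin_sums"
proof -
  have i: "indicator (D (s * s\<^sup>\<star>)) \<in> ideal (univ_map s)"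
  \<comment> \<open>\<open>univ_map 0\<close> carries no meaning, but D(0) is empty and the zero
    function lies in every ideal.\<close>
  proof (cases "s = 0")
    case True
    then show ?thesis using indicator_C0_ideal[OF compact_open_empty] by simp
  next
    case False
    then show ?thesis
      by (intro indicator_C0_ideal compact_open_basic univ_dom_basic_subset) simp_all
  qed
  note i' = C0_ideal_scale[OF i, of c]
  show ?thesis
    unfolding Vop_def crossed_scale[OF C0_ideal_C0[OF i], symmetric] crossed_rep_single(1)[OF i', symmetric]
    by (rule imageI[OF crossed_rep_single(2)[OF i']])
qed

lemma comb_in_sums: "comb Vop xs \<in> rep ` fin_sums"
proof (induction xs)
  case Nil
  show ?case using Vop_scaled_in_sums[of 0 0] by simp
next
  case (Cons x xs)
  obtain c s where x: "x = (c, s)" by (cases x)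
  from Vop_scaled_in_sums[of c s] Cons obtain a b where ab: "scale_op c (Vop s) = rep a" "a \<in> fin_sums"
    "comb Vop xs = rep b" "b \<in> fin_sums" by (elim imageE)
  show ?case
    unfolding x comb_simps ab(1,3) crossed_rep_add(1)[OF ab(2,4), symmetric]
    by (rule imageI[OF crossed_rep_add(2)[OF ab(2,4)]])
qed

lemma crossed_simple_fun:
  assumes "f \<in> simple_fun g" shows "crossed f g \<in> range (comb Vop)"
  using assms
proof induction
  case zero
  show ?case unfolding crossed_zero by (rule range_eqI[of _ _ "[]"]) simp
next
  case (step t f c)
  then obtain xs where "crossed f g = comb Vop xs" by blast
  moreover have "crossed (\<lambda>x. c * indicator (D (t * t\<^sup>\<star>)) x + f x) g
      = scale_op c (Vop t) + crossed f g"
    using step(2,3)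
    by (simp add: crossed_add C0_scale basic_C0 crossed_scale Vop_def simple_fun_ideal[THEN C0_ideal_C0])
  ultimately show ?case by (intro range_eqI[of _ _ "(c, t) # xs"]) simp
qed

text \<open>\<open>crossed\<close> is contractive in the coefficient function, so uniform density of
  simple functions turns into norm density of the combinations of \<open>Vop\<close>.\<close>

lemma crossed_in_algebra:
  assumes a: "a \<in> ideal g" shows "crossed a g \<in> Vop.algebra"
  unfolding Vop.algebra_def closure_approachable
proof (intro allI impI)
  fix e :: real assume e: "0 < e"
  then obtain f where f: "f \<in> simple_fun g" "\<And>x. cmod (a x - f x) < e / 2"
    using simple_fun_dense[OF a, of "e / 2"] by auto
  have "norm (crossed a g - crossed f g) \<le> e / 2"
    by (rule crossed_diff_norm_le) (use a f simple_fun_ideal in \<open>auto intro: C0_ideal_C0 less_imp_le\<close>)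
  then have "dist (crossed f g) (crossed a g) < e"
    using e by (simp add: dist_norm norm_minus_commute)
  then show "\<exists>y\<in>range (comb Vop). dist y (crossed a g) < e" using crossed_simple_fun[OF f(1)] by blast
qed

lemma closure_crossed_sums: "closure (rep ` fin_sums) = Vop.algebra"
proof (rule antisym)
  have "rep a \<in> Vop.algebra" if "a \<in> fin_sums" for a
  proof -
    have "(\<Sum>g\<in>F. crossed (a g) g) \<in> Vop.algebra" for F
      by (induction F rule: infinite_finite_induct)
        (use \<open>a \<in> fin_sums\<close> in \<open>auto simp: Vop.algebra_zero crossed_sums_def intro!: Vop.algebra_add crossed_in_algebra\<close>)
    then show ?thesis by (simp add: crossed_rep_def)
  qed
  then show "closure (rep ` fin_sums) \<subseteq> Vop.algebra"
    by (intro closure_minimal Vop.closed_algebra) auto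
  show "Vop.algebra \<subseteq> closure (rep ` fin_sums)"
    unfolding Vop.algebra_def by (rule closure_mono) (use comb_in_sums in auto)
qed

end

text \<open>\<pi> ranges over all faithful representations, so the result includes that the crossed
  product does not depend on this choice up to isomorphism.\<close>

theorem theorem5p2:
  fixes \<pi> :: "(('s::inverse_semigroup_0 \<Rightarrow> bool) \<Rightarrow> complex) \<Rightarrow> 'h::complex_hilbert_space \<Rightarrow>\<^sub>L 'h"
  assumes "countable (UNIV :: 's set)"
    and "strongly_0_E_unitary TYPE('s) TYPE('k::group_add)"
    and "faithful_rep (C0_alg (spectrum :: ('s \<Rightarrow> bool) topology)) \<pi>"
  shows "reduced_cstar TYPE('s)
    \<cong>\<^sub>C reduced_crossed_product (spectrum :: ('s \<Rightarrow> bool) topology) univ_dom univ_act \<pi>"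
proof -
  obtain \<phi> :: "'s \<Rightarrow> 'k" where "partial_hom \<phi>" "idempotent_pure \<phi>"
    using assms(2) by (auto simp: strongly_0_E_unitary_def)
  then interpret spectrum_rep "TYPE('s)" \<pi>
    using assms(1,3) by unfold_locales
      (auto simp: faithful_rep_def C0_alg_def intro: idempotent_pure_univ_map)
  show ?thesis
    unfolding reduced_crossed_product_def closure_crossed_sums Vop.algebra_def
    by (rule reduced_cstar_isomorphic[OF Vop.star_family_axioms norm_comb_Vop])
qed

end
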